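(* Let $G$ be a discrete group and let $\mathcal{B}=(B_g)_{g\in G}$ and $\mathcal{C}=(C_g)_{g\in G}$ be Fell bundles over $G$. Let $\pi=\{\pi_g\}_{g\in G}$ be a faithful representation of $\mathcal{C}$ on a Hilbert space $\mathcal{H}$. Suppose that $\phi\colon\mathcal{B}\to\mathbb{B}(\mathcal{H})$ is a completely positive map such that $\phi(B_g)\subseteq \pi_g(C_g)$ for all $g\in G$. Then there is a completely positive map $\phi'\colon \mathrm{C}^*(\mathcal{B})\to\mathrm{C}^*(\mathcal{C})$ with $\|\phi'\|=\|\phi\|$ such that $\pi\circ \phi'|_{\mathcal{B}} = \phi$, that is, $\phi'(b)\in C_g$ and $\pi_g(\phi'(b))=\phi(b)$ for all $g\in G$ and $b\in B_g$.
   Context: For a Fell bundle $\mathcal{B}=(B_g)_{g\in G}$ over a discrete group $G$ (unit $e$), $\mathrm{C}^*(\mathcal{B})$ denotes its full cross-sectional $\mathrm{C}^*$-algebra; each fibre $B_g$ is viewed as a subset of $\mathrm{C}^*(\mathcal{B})$. For $n\ge1$ and $\mathfrak{t}=(t_1,\ldots,t_n)\in G^n$, let $\mathbb{M}_{\mathfrak{t}}(\mathcal{B})$ be the set of $n\times n$ matrices $M$ with $M_{i,j}\in B_{t_i^{-1}t_j}$ for all $i,j$. With entrywise linear operations, matrix multiplication, and involution $(M^* )_{i,j}=(M_{j,i})^*$, it is a $\mathrm{C}^*$-algebra with the norm inherited from $\mathbb{M}_n(\mathrm{C}^*(\mathcal{B}))$. If $\phi\colon\mathcal{B}\to\mathbb{B}(\mathcal{H})$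 is linear on each fibre, let $\phi^{\mathfrak{t}}\colon\mathbb{M}_{\mathfrak{t}}(\mathcal{B})\to\mathbb{M}_n(\mathbb{B}(\mathcal{H}))=\mathbb{B}(\mathcal{H}^n)$, $\phi^{\mathfrak{t}}(M)=(\phi(M_{i,j}))_{i,j}$. A function $\phi\colon\mathcal{B}\to\mathbb{B}(\mathcal{H})$, linear on each fibre, is completely positive if $\phi^{\mathfrak{t}}$ is positive for all $\mathfrak{t}\in\bigcup_{n\ge1}G^n$; its norm is $\|\phi\|:=\sup\{\|\phi(b)\|: b\in\mathcal{B},\ \|b\|\le1\}$. A representation of a Fell bundle $\mathcal{C}$ on $\mathcal{H}$ is a family $\pi=\{\pi_g\}_{g\in G}$ of linear maps $\pi_g\colon C_g\to\mathbb{B}(\mathcal{H})$ with $\pi_g(c)\pi_h(d)=\pi_{gh}(cd)$ and $\pi_g(c)^*=\pi_{g^{-1}}(c^* )$ for $c\in C_g$, $d\in C_h$. It is faithful if $\pi_e$ is injective; then each $\pi_g$ is isometric. *)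

theory Defs
  imports "HOL-Analysis.Analysis"
begin

section \<open>Complex vector spaces, Hilbert spaces and C*-algebras\<close>

class complex_vector = real_vector +
  fixes scaleC :: "complex \<Rightarrow> 'a \<Rightarrow> 'a"  (infixr \<open>*\<^sub>C\<close> 75)
  assumes scaleC_add_right: "c *\<^sub>C (x + y) = c *\<^sub>C x + c *\<^sub>C y"
    and scaleC_add_left: "(c + d) *\<^sub>C x = c *\<^sub>C x + d *\<^sub>C x"
    and scaleC_scaleC: "c *\<^sub>C d *\<^sub>C x = (c * d) *\<^sub>C x"
    and scaleC_one: "1 *\<^sub>C x = x"
    and scaleR_scaleC: "r *\<^sub>R x = complex_of_real r *\<^sub>C x"

class complex_normed_vector = complex_vector + real_normed_vector +
  assumes norm_scaleC: "norm (c *\<^sub>C x) = cmod c * norm x"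

text \<open>The inner product is linear in the first variable.\<close>

class complex_hilbert = complex_normed_vector + banach +
  fixes cinner :: "'a \<Rightarrow> 'a \<Rightarrow> complex"
  assumes cinner_add_left: "cinner (x + y) z = cinner x z + cinner y z"
    and cinner_scaleC_left: "cinner (c *\<^sub>C x) y = c * cinner x y"
    and cinner_commute: "cinner y x = cnj (cinner x y)"
    and cinner_self: "cinner x x = complex_of_real ((norm x)\<^sup>2)"

text \<open>C*-algebras are not required to have a unit.\<close>

class cstar_algebra = complex_normed_vector + real_normed_algebra + banach +
  fixes adj :: "'a \<Rightarrow> 'a"
  assumes mult_scaleC_left: "(c *\<^sub>C x) * y = c *\<^sub>C (x * y)"
    and mult_scaleC_right: "x * (c *\<^sub>C y) = c *\<^sub>C (x * y)"
    and adj_add: "adj (x + y) = adj x + adj y"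
    and adj_scaleC: "adj (c *\<^sub>C x) = cnj c *\<^sub>C adj x"
    and adj_mult: "adj (x * y) = adj y * adj x"
    and adj_adj: "adj (adj x) = x"
    and cstar_identity: "norm (adj x * x) = (norm x)\<^sup>2"

instantiation complex :: complex_normed_vector
begin
definition scaleC_complex :: "complex \<Rightarrow> complex \<Rightarrow> complex"
  where "scaleC_complex c x = c * x"
instance
  by standard (auto simp: scaleC_complex_def algebra_simps norm_mult scaleR_conv_of_real)
end

instantiation complex :: complex_hilbert
begin
definition cinner_complex :: "complex \<Rightarrow> complex \<Rightarrow> complex"
  where "cinner_complex x y = x * cnj y"
instance
  by standard
    (auto simp: cinner_complex_def scaleC_complex_def algebra_simps complex_norm_square[symmetric])
end

instantiation complex :: cstar_algebra
begin
definition adj_complex :: "complex \<Rightarrow> complex"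
  where "adj_complex x = cnj x"
instance
  by standard (auto simp: adj_complex_def scaleC_complex_def norm_mult power2_eq_square)
end

instantiation blinfun :: (real_normed_vector, complex_normed_vector) complex_normed_vector
begin

lift_definition scaleC_blinfun ::
  "complex \<Rightarrow> ('a \<Rightarrow>\<^sub>L 'b) \<Rightarrow> ('a \<Rightarrow>\<^sub>L 'b)" is "\<lambda>c T x. c *\<^sub>C T x"
proof -
  fix c :: complex and T :: "'a \<Rightarrow> 'b"
  assume "bounded_linear T"
  moreover have "bounded_linear (\<lambda>y::'b. c *\<^sub>C y)"
    by (rule bounded_linear_intro[where K = "cmod c"])
      (auto simp: scaleC_add_right scaleR_scaleC scaleC_scaleC norm_scaleC mult.commute)
  ultimately show "bounded_linear (\<lambda>x. c *\<^sub>C T x)"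
    by (rule bounded_linear_compose[rotated])
qed

instance
proof
  fix c d :: complex and r :: real and S T :: "'a \<Rightarrow>\<^sub>L 'b"
  show "c *\<^sub>C (S + T) = c *\<^sub>C S + c *\<^sub>C T"
    by transfer (simp add: scaleC_add_right)
  show "(c + d) *\<^sub>C T = c *\<^sub>C T + d *\<^sub>C T"
    by transfer (simp add: scaleC_add_left)
  show "c *\<^sub>C d *\<^sub>C T = (c * d) *\<^sub>C T"
    by transfer (simp add: scaleC_scaleC)
  show "1 *\<^sub>C T = T"
    by transfer (simp add: scaleC_one)
  show "r *\<^sub>R T = complex_of_real r *\<^sub>C T"
    by transfer (simp add: scaleR_scaleC)
  have "onorm (\<lambda>x. c *\<^sub>C blinfun_apply T x) = onorm (\<lambda>x. cmod c *\<^sub>R blinfun_apply T x)"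
    by (simp add: onorm_def norm_scaleC)
  then show "norm (c *\<^sub>C T) = cmod c * norm T"
    by (simp add: norm_blinfun.rep_eq scaleC_blinfun.rep_eq onorm_scaleR blinfun.bounded_linear_right)
qed

end

definition csubspace :: "'a::complex_vector set \<Rightarrow> bool"
  where "csubspace S \<longleftrightarrow>
    0 \<in> S \<and> (\<forall>x\<in>S. \<forall>y\<in>S. x + y \<in> S) \<and> (\<forall>c. \<forall>x\<in>S. c *\<^sub>C x \<in> S)"

definition clinear_on ::
    "'a::complex_vector set \<Rightarrow> ('a \<Rightarrow> 'b::complex_vector) \<Rightarrow> bool"
  where "clinear_on S f \<longleftrightarrow>
    (\<forall>x\<in>S. \<forall>y\<in>S. f (x + y) = f x + f y) \<and>
    (\<forall>c. \<forall>x\<in>S. f (c *\<^sub>C x) = c *\<^sub>C f x)"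

text \<open>The bounded complex-linear operators \<open>\<bool>(\<H>)\<close>.\<close>

definition bounded_ops :: "('h::complex_hilbert \<Rightarrow>\<^sub>L 'h) set"
  where "bounded_ops = {T. clinear_on UNIV (blinfun_apply T)}"

section \<open>Fell bundles over discrete groups\<close>

text \<open>
  \<^class>\<open>group_add\<close> is the class of groups that need not be commutative; the group law is
  written additively, so \<open>gh\<close>, the inverse of \<open>g\<close> and the unit \<open>e\<close> are
  \<open>g + h\<close>, \<open>- g\<close> and \<open>0\<close>.

  The fibres are complete subspaces of one normed space \<open>'b\<close>, from which they take their
  linear structure and norm.  Nothing is assumed about how different fibres sit relative to each
  other (they may overlap or coincide), hence the multiplication \<open>B\<^sub>g \<times> B\<^sub>h \<rightarrow> B\<^sub>g\<^sub>h\<close>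
  and the involution carry the degrees as arguments.  Every family of Banach spaces
  has such a realisation, e.g. inside its \<open>\<ell>\<^sup>1\<close>-direct sum.
\<close>

record ('g, 'b) bundle_data =
  fibre :: "'g \<Rightarrow> 'b set"
  fmult :: "'g \<Rightarrow> 'g \<Rightarrow> 'b \<Rightarrow> 'b \<Rightarrow> 'b"
  fstar :: "'g \<Rightarrow> 'b \<Rightarrow> 'b"

locale fell_bundle =
  fixes B :: "('g::group_add, 'b::complex_normed_vector) bundle_data"
  assumes fibre_csubspace: "csubspace (fibre B g)"
    and fibre_complete: "complete (fibre B g)"
    and fmult_closed: "x \<in> fibre B g \<Longrightarrow> y \<in> fibre B h \<Longrightarrow> fmult B g h x y \<in> fibre B (g + h)"
    and fmult_linear_left: "y \<in> fibre B h \<Longrightarrow> clinear_on (fibre B g) (\<lambda>x. fmult B g h x y)"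
    and fmult_linear_right: "x \<in> fibre B g \<Longrightarrow> clinear_on (fibre B h) (\<lambda>y. fmult B g h x y)"
    and fmult_assoc: "x \<in> fibre B g \<Longrightarrow> y \<in> fibre B h \<Longrightarrow> z \<in> fibre B k \<Longrightarrow>
      fmult B (g + h) k (fmult B g h x y) z = fmult B g (h + k) x (fmult B h k y z)"
    and norm_fmult: "x \<in> fibre B g \<Longrightarrow> y \<in> fibre B h \<Longrightarrow>
      norm (fmult B g h x y) \<le> norm x * norm y"
    and fstar_closed: "x \<in> fibre B g \<Longrightarrow> fstar B g x \<in> fibre B (- g)"
    and fstar_add: "x \<in> fibre B g \<Longrightarrow> y \<in> fibre B g \<Longrightarrow>
      fstar B g (x + y) = fstar B g x + fstar B g y"
    and fstar_scaleC: "x \<in> fibre B g \<Longrightarrow> fstar B g (c *\<^sub>C x) = cnj c *\<^sub>C fstar B g x"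
    and fstar_fmult: "x \<in> fibre B g \<Longrightarrow> y \<in> fibre B h \<Longrightarrow>
      fstar B (g + h) (fmult B g h x y) = fmult B (- h) (- g) (fstar B h y) (fstar B g x)"
    and fstar_fstar: "x \<in> fibre B g \<Longrightarrow> fstar B (- g) (fstar B g x) = x"
    and norm_fstar: "x \<in> fibre B g \<Longrightarrow> norm (fstar B g x) = norm x"
    and norm_fstar_fmult: "x \<in> fibre B g \<Longrightarrow>
      norm (fmult B (- g) g (fstar B g x) x) = (norm x)\<^sup>2"
    and fstar_fmult_positive: "x \<in> fibre B g \<Longrightarrow>
      \<exists>a\<in>fibre B 0. fmult B (- g) g (fstar B g x) x = fmult B 0 0 (fstar B 0 a) a"

section \<open>The full cross-sectional C*-algebra\<close>

definition sections :: "('g::group_add, 'b::complex_normed_vector) bundle_data \<Rightarrow> ('g \<Rightarrow> 'b) set"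
  where "sections B = {f. (\<forall>g. f g \<in> fibre B g) \<and> finite {g. f g \<noteq> 0}}"

definition section_mult ::
    "('g::group_add, 'b::complex_normed_vector) bundle_data \<Rightarrow> ('g \<Rightarrow> 'b) \<Rightarrow> ('g \<Rightarrow> 'b) \<Rightarrow> 'g \<Rightarrow> 'b"
  where "section_mult B f h = (\<lambda>t. \<Sum>s | f s \<noteq> 0. fmult B s (- s + t) (f s) (h (- s + t)))"

definition section_star ::
    "('g::group_add, 'b::complex_normed_vector) bundle_data \<Rightarrow> ('g \<Rightarrow> 'b) \<Rightarrow> 'g \<Rightarrow> 'b"
  where "section_star B f = (\<lambda>t. fstar B (- t) (f (- t)))"

definition cstar_seminorm ::
    "('g::group_add, 'b::complex_normed_vector) bundle_data \<Rightarrow> (('g \<Rightarrow> 'b) \<Rightarrow> real) \<Rightarrow> bool"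
  where "cstar_seminorm B p \<longleftrightarrow>
    (\<forall>f\<in>sections B. 0 \<le> p f) \<and>
    (\<forall>c. \<forall>f\<in>sections B. p (\<lambda>g. c *\<^sub>C f g) = cmod c * p f) \<and>
    (\<forall>f\<in>sections B. \<forall>h\<in>sections B. p (\<lambda>g. f g + h g) \<le> p f + p h) \<and>
    (\<forall>f\<in>sections B. \<forall>h\<in>sections B. p (section_mult B f h) \<le> p f * p h) \<and>
    (\<forall>f\<in>sections B. p (section_star B f) = p f) \<and>
    (\<forall>f\<in>sections B. p (section_mult B (section_star B f) f) = (p f)\<^sup>2)"

text \<open>
  The largest C*-seminorm on the finitely supported sections.  The supremum is over a nonempty
  set that is bounded above by \<open>\<Sum>g. norm (f g)\<close>.
\<close>

definition universal_norm ::
    "('g::group_add, 'b::complex_normed_vector) bundle_data \<Rightarrow> ('g \<Rightarrow> 'b) \<Rightarrow> real"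
  where "universal_norm B f = (SUP p\<in>{p. cstar_seminorm B p}. p f)"

text \<open>
  The C*-algebra \<open>'a\<close> together with the maps \<open>j g\<close>, through which the fibres are
  viewed as subsets of \<open>'a\<close>, is (a realisation of) \<open>C\<^sup>*(B)\<close>: the completion of
  the *-algebra of finitely supported sections in its largest C*-seminorm.
\<close>

definition full_cross_sectional_algebra ::
    "('g::group_add, 'b::complex_normed_vector) bundle_data \<Rightarrow> ('g \<Rightarrow> 'b \<Rightarrow> 'a::cstar_algebra) \<Rightarrow> bool"
  where "full_cross_sectional_algebra B j \<longleftrightarrow>
    (\<forall>g. clinear_on (fibre B g) (j g)) \<and>
    (\<forall>g h. \<forall>x\<in>fibre B g. \<forall>y\<in>fibre B h. j g x * j h y = j (g + h) (fmult B g h x y)) \<and>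
    (\<forall>g. \<forall>x\<in>fibre B g. adj (j g x) = j (- g) (fstar B g x)) \<and>
    (\<forall>f\<in>sections B. norm (\<Sum>g | f g \<noteq> 0. j g (f g)) = universal_norm B f) \<and>
    closure ((\<lambda>f. \<Sum>g | f g \<noteq> 0. j g (f g)) ` sections B) = UNIV"

section \<open>Representations\<close>

text \<open>The last clause says that the Hilbert space adjoint of \<open>\<pi> g x\<close> is
  \<open>\<pi> (- g) (fstar B g x)\<close>.\<close>

definition representation ::
    "('g::group_add, 'b::complex_normed_vector) bundle_data \<Rightarrow>
     ('g \<Rightarrow> 'b \<Rightarrow> ('h::complex_hilbert \<Rightarrow>\<^sub>L 'h)) \<Rightarrow> bool"
  where "representation B \<pi> \<longleftrightarrow>
    (\<forall>g. clinear_on (fibre B g) (\<pi> g) \<and> \<pi> g ` fibre B g \<subseteq> bounded_ops) \<and>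
    (\<forall>g h. \<forall>x\<in>fibre B g. \<forall>y\<in>fibre B h.
      \<pi> g x o\<^sub>L \<pi> h y = \<pi> (g + h) (fmult B g h x y)) \<and>
    (\<forall>g. \<forall>x\<in>fibre B g. \<forall>\<xi> \<eta>.
      cinner (\<pi> g x \<xi>) \<eta> = cinner \<xi> (\<pi> (- g) (fstar B g x) \<eta>))"

definition faithful_representation ::
    "('g::group_add, 'b::complex_normed_vector) bundle_data \<Rightarrow>
     ('g \<Rightarrow> 'b \<Rightarrow> ('h::complex_hilbert \<Rightarrow>\<^sub>L 'h)) \<Rightarrow> bool"
  where "faithful_representation B \<pi> \<longleftrightarrow> representation B \<pi> \<and> inj_on (\<pi> 0) (fibre B 0)"

section \<open>Completely positive maps\<close>

text \<open>
  An \<open>n \<times> n\<close> matrix is a function of two indices, of which only the entries with indices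
  below \<open>n\<close> matter; likewise a tuple in \<open>G\<^sup>n\<close> is a function \<open>t\<close> on \<open>{..<n}\<close>.
  An element of a C*-algebra is positive if it is of the form \<open>N\<^sup>* N\<close>.
\<close>

definition bundle_matrices ::
    "('g::group_add, 'b::complex_normed_vector) bundle_data \<Rightarrow> nat \<Rightarrow> (nat \<Rightarrow> 'g) \<Rightarrow> (nat \<Rightarrow> nat \<Rightarrow> 'b) set"
  where "bundle_matrices B n t = {M. \<forall>i<n. \<forall>j<n. M i j \<in> fibre B (- t i + t j)}"

definition bundle_matrix_mult ::
    "('g::group_add, 'b::complex_normed_vector) bundle_data \<Rightarrow> nat \<Rightarrow> (nat \<Rightarrow> 'g) \<Rightarrow>
     (nat \<Rightarrow> nat \<Rightarrow> 'b) \<Rightarrow> (nat \<Rightarrow> nat \<Rightarrow> 'b) \<Rightarrow> nat \<Rightarrow> nat \<Rightarrow> 'b"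
  where "bundle_matrix_mult B n t M N =
    (\<lambda>i j. \<Sum>k<n. fmult B (- t i + t k) (- t k + t j) (M i k) (N k j))"

definition bundle_matrix_star ::
    "('g::group_add, 'b::complex_normed_vector) bundle_data \<Rightarrow> (nat \<Rightarrow> 'g) \<Rightarrow>
     (nat \<Rightarrow> nat \<Rightarrow> 'b) \<Rightarrow> nat \<Rightarrow> nat \<Rightarrow> 'b"
  where "bundle_matrix_star B t M = (\<lambda>i j. fstar B (- t j + t i) (M j i))"

definition positive_bundle_matrix ::
    "('g::group_add, 'b::complex_normed_vector) bundle_data \<Rightarrow> nat \<Rightarrow> (nat \<Rightarrow> 'g) \<Rightarrow>
     (nat \<Rightarrow> nat \<Rightarrow> 'b) \<Rightarrow> bool"
  where "positive_bundle_matrix B n t M \<longleftrightarrow>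
    (\<exists>N\<in>bundle_matrices B n t.
      \<forall>i<n. \<forall>j<n. M i j = bundle_matrix_mult B n t (bundle_matrix_star B t N) N i j)"

text \<open>The matrix \<open>T\<close>, viewed as an operator on \<open>\<H>\<^sup>n\<close>, is a positive operator.\<close>

definition positive_operator_matrix ::
    "nat \<Rightarrow> (nat \<Rightarrow> nat \<Rightarrow> ('h::complex_hilbert \<Rightarrow>\<^sub>L 'h)) \<Rightarrow> bool"
  where "positive_operator_matrix n T \<longleftrightarrow>
    (\<forall>\<xi>::nat \<Rightarrow> 'h. (\<Sum>i<n. cinner (\<Sum>j<n. T i j (\<xi> j)) (\<xi> i)) \<in> \<real>\<^sub>\<ge>\<^sub>0)"

definition completely_positive_on_bundle ::
    "('g::group_add, 'b::complex_normed_vector) bundle_data \<Rightarrow>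
     ('g \<Rightarrow> 'b \<Rightarrow> ('h::complex_hilbert \<Rightarrow>\<^sub>L 'h)) \<Rightarrow> bool"
  where "completely_positive_on_bundle B \<phi> \<longleftrightarrow>
    (\<forall>g. clinear_on (fibre B g) (\<phi> g) \<and> \<phi> g ` fibre B g \<subseteq> bounded_ops) \<and>
    (\<forall>n\<ge>1. \<forall>t M. positive_bundle_matrix B n t M \<longrightarrow>
      positive_operator_matrix n (\<lambda>i j. \<phi> (- t i + t j) (M i j)))"

definition positive_matrix :: "nat \<Rightarrow> (nat \<Rightarrow> nat \<Rightarrow> 'a::cstar_algebra) \<Rightarrow> bool"
  where "positive_matrix n M \<longleftrightarrow>
    (\<exists>N. \<forall>i<n. \<forall>j<n. M i j = (\<Sum>k<n. adj (N k i) * N k j))"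

definition completely_positive :: "('a::cstar_algebra \<Rightarrow> 'b::cstar_algebra) \<Rightarrow> bool"
  where "completely_positive \<Phi> \<longleftrightarrow>
    clinear_on UNIV \<Phi> \<and>
    (\<forall>n\<ge>1. \<forall>M. positive_matrix n M \<longrightarrow> positive_matrix n (\<lambda>i j. \<Phi> (M i j)))"

text \<open>Completely positive maps are bounded, so for them the following two suprema are finite.\<close>

definition bundle_map_norm ::
    "('g::group_add, 'b::complex_normed_vector) bundle_data \<Rightarrow>
     ('g \<Rightarrow> 'b \<Rightarrow> 'c::real_normed_vector) \<Rightarrow> real"
  where "bundle_map_norm B \<phi> = Sup {norm (\<phi> g b) |g b. b \<in> fibre B g \<and> norm b \<le> 1}"

definition map_norm :: "('a::cstar_algebra \<Rightarrow> 'b::cstar_algebra) \<Rightarrow> real"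
  where "map_norm \<Phi> = Sup {norm (\<Phi> a) |a. norm a \<le> 1}"

end

(* Put the inclusions of the fibres of C into C*(C) after pi^{-1} phi to get a fibrewise map psi
   from B to C*(C).  Matrices over C that pi maps to positive operator matrices are of the form
   R*R with R over C, because faithful representations are isometric and square roots of matrices
   are norm limits of polynomials; hence psi is completely positive.

   The pairs b (x) x with b in a fibre of B and x in C*(C) generate a pre-Hilbert C*(C)-module with
   <b (x) x, b' (x) x'> = x* psi(b* b') x', on which the sections of B act by bounded operators.
   The operator norm is a C*-seminorm and therefore at most the universal norm, and compression by
   an approximate unit of the unit fibre bounds psi by ||phi|| times that seminorm.  So psi extends
   to C*(B).

   Positivity in C*-algebras is treated without spectra: a self-adjoint operator f is positive if
   ||t - f|| <= t for some t, and the C*-identity enters through unitaries v + i r built from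
   square roots. *)

theory Submission
  imports Defs "HOL-Library.Function_Algebras"
begin

section \<open>Complex vector spaces\<close>

text \<open>The order is studied for operators on a C*-algebra rather than for its elements: an
  algebra without unit still carries the identity operator, so 1 - a, roots of complements and
  unitaries are available. Root elements are recovered because the iterates, minus their scalar
  part, are left multiplications by algebra elements.

  Three obstacles shape the rest. The map \<psi> is not known to be bounded beforehand, and without
  a bound the action on the module cannot be controlled; hence a factorization b = \<sigma> y, which
  reduces every fibre to positive elements of the unit fibre, where unboundedness would contradict
  the existence of \<psi> at the sum of a series. The sharp constant arises because an approximate
  unit e gives vectors e (x) z of norm at most the square root of ||\<phi>|| times ||z||;
  boundedness alone would lose a factor. Finally, the module is neither separated nor completed: its
  vectors are lists and identities hold only after pairing with other lists, which suffices because
  only seminorms are compared.\<close>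

lemma scaleC_zero_left [simp]: "(0::complex) *\<^sub>C (x::'a::complex_vector) = 0"
  using scaleR_scaleC[of 0 x] by simp

lemma scaleC_zero_right [simp]: "c *\<^sub>C (0::'a::complex_vector) = 0"
  using scaleC_scaleC[of c 0 "0::'a"] by simp

lemma scaleC_minus_one [simp]: "(- 1) *\<^sub>C (x::'a::complex_vector) = - x"
  using scaleR_scaleC[of "- 1" x] by simp

lemma scaleC_one_left [simp]: "1 *\<^sub>C (x::'a::complex_vector) = x"
  by (rule scaleC_one)

lemma scaleC_minus_right: "c *\<^sub>C (- x) = - (c *\<^sub>C (x::'a::complex_vector))"
  using scaleC_add_right[of c x "- x"] by (simp add: eq_neg_iff_add_eq_0 add.commute)

lemma scaleC_minus_left: "(- c) *\<^sub>C x = - (c *\<^sub>C (x::'a::complex_vector))"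
  using scaleC_add_left[of "- c" c x] by (simp add: eq_neg_iff_add_eq_0)

lemma scaleC_diff_right: "c *\<^sub>C (x - y) = c *\<^sub>C x - c *\<^sub>C (y::'a::complex_vector)"
  using scaleC_add_right[of c x "- y"] by (simp add: scaleC_minus_right)

lemma csubspaceD:
  assumes "csubspace S"
  shows csubspace_0: "0 \<in> S"
    and csubspace_add: "x \<in> S \<Longrightarrow> y \<in> S \<Longrightarrow> x + y \<in> S"
    and csubspace_scaleC: "x \<in> S \<Longrightarrow> c *\<^sub>C x \<in> S"
    and csubspace_scaleR: "x \<in> S \<Longrightarrow> r *\<^sub>R x \<in> S"
    and csubspace_uminus: "x \<in> S \<Longrightarrow> - x \<in> S"
    and csubspace_diff: "x \<in> S \<Longrightarrow> y \<in> S \<Longrightarrow> x - y \<in> S"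
    and csubspace_subspace: "subspace S"
proof -
  show *: "0 \<in> S" "\<And>x y. x \<in> S \<Longrightarrow> y \<in> S \<Longrightarrow> x + y \<in> S" "\<And>c x. x \<in> S \<Longrightarrow> c *\<^sub>C x \<in> S"
    using assms by (auto simp: csubspace_def)
  show "\<And>r x. x \<in> S \<Longrightarrow> r *\<^sub>R x \<in> S"
    by (simp add: scaleR_scaleC *)
  then show "subspace S"
    by (simp add: subspace_def *)
  then show "\<And>x. x \<in> S \<Longrightarrow> - x \<in> S" "\<And>x y. x \<in> S \<Longrightarrow> y \<in> S \<Longrightarrow> x - y \<in> S"
    by (auto intro: subspace_neg subspace_diff)
qed

lemma csubspace_sum: "csubspace S \<Longrightarrow> (\<And>i. i \<in> I \<Longrightarrow> f i \<in> S) \<Longrightarrow> sum f I \<in> S"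
  using csubspace_subspace subspace_sum by blast

lemma csubspace_UNIV [simp]: "csubspace UNIV"
  by (simp add: csubspace_def)

lemma clinear_on_add: "clinear_on S f \<Longrightarrow> x \<in> S \<Longrightarrow> y \<in> S \<Longrightarrow> f (x + y) = f x + f y"
  by (simp add: clinear_on_def)

lemma clinear_on_scaleC: "clinear_on S f \<Longrightarrow> x \<in> S \<Longrightarrow> f (c *\<^sub>C x) = c *\<^sub>C f x"
  by (simp add: clinear_on_def)

lemma clinear_on_scaleR: "clinear_on S f \<Longrightarrow> x \<in> S \<Longrightarrow> f (r *\<^sub>R x) = r *\<^sub>R f x"
  by (simp add: clinear_on_scaleC scaleR_scaleC)

lemma clinear_on_0: "clinear_on S f \<Longrightarrow> csubspace S \<Longrightarrow> f 0 = 0"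
  using clinear_on_scaleC[of S f 0 0] by (simp add: csubspace_0)

lemma clinear_on_uminus: "clinear_on S f \<Longrightarrow> x \<in> S \<Longrightarrow> f (- x) = - f x"
  using clinear_on_scaleC[of S f x "-1"] by simp

lemma clinear_on_diff: "clinear_on S f \<Longrightarrow> csubspace S \<Longrightarrow> x \<in> S \<Longrightarrow> y \<in> S \<Longrightarrow> f (x - y) = f x - f y"
  using clinear_on_add[of S f x "- y"] by (simp add: clinear_on_uminus csubspace_uminus)

lemma clinear_on_sum:
  assumes "clinear_on S f" "csubspace S" "\<And>i. i \<in> I \<Longrightarrow> u i \<in> S"
  shows "f (\<Sum>i\<in>I. u i) = (\<Sum>i\<in>I. f (u i))"
proof (cases "finite I")
  case True
  then show ?thesis using assms(3)
  proof (induction I)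
    case empty
    then show ?case using clinear_on_0[OF assms(1,2)] by simp
  next
    case (insert i I)
    have "sum u I \<in> S" using insert.prems by (intro csubspace_sum[OF assms(2)]) auto
    then show ?case using insert by (simp add: clinear_on_add[OF assms(1)])
  qed
qed (simp add: clinear_on_0[OF assms(1,2)])

lemma tendsto_norm_diff_bound:
  fixes u :: "nat \<Rightarrow> 'a::real_normed_vector"
  assumes "\<And>m. norm (u m - l) \<le> e m" "e \<longlonglongrightarrow> 0"
  shows "u \<longlonglongrightarrow> l"
  using Lim_null_comparison[OF always_eventually assms(2), of "\<lambda>m. u m - l"] assms(1)
  by (auto dest: LIM_zero_cancel)

text \<open>Tuples of vectors must form a real vector space so that the locale
  \<open>contraction\<close> applies to them, with tuple norms that come from no type class.\<close>

instantiation "fun" :: (type, real_vector) real_vector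
begin

definition scaleR_fun :: "real \<Rightarrow> ('a \<Rightarrow> 'b) \<Rightarrow> 'a \<Rightarrow> 'b"
  where "scaleR_fun r f = (\<lambda>x. r *\<^sub>R f x)"

instance
  by standard (auto simp: scaleR_fun_def fun_eq_iff algebra_simps)

end

section \<open>The square root of a contraction's complement\<close>


text \<open>Replaces the spectral radius formula. Typically \<open>a k\<close> is the norm of
  h^(2^k) applied to a vector of norm b, and Cauchy-Schwarz gives the step. If a 0 = b s with s > r,
  the steps force \<open>a k\<close> to be at least b s^(2^k), which outgrows C 2^k r^(2^k). The
  factor 2^k admits powers whose norms grow linearly in the exponent.\<close>

lemma iterated_cauchy_schwarz:
  fixes a :: "nat \<Rightarrow> real"
  assumes a: "\<And>k. 0 \<le> a k" and b: "0 \<le> b" and r: "0 \<le> r" and "0 \<le> C"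
    and step: "\<And>k. (a k)\<^sup>2 \<le> b * a (Suc k)"
    and bound: "\<And>k. a k \<le> C * 2 ^ k * r ^ (2 ^ k)"
  shows "a 0 \<le> b * r"
proof (rule ccontr)
  assume "\<not> a 0 \<le> b * r"
  then have gt: "b * r < a 0" by simp
  then have a0: "0 < a 0" using b r by (smt (verit) mult_nonneg_nonneg)
  have b0: "0 < b"
    using step[of 0] a0 b by (cases "b = 0") auto
  define s where "s = a 0 / b"
  have s: "r < s" "0 < s" using gt a0 b0 by (auto simp: s_def field_simps)
  have grow: "b * s ^ (2 ^ k) \<le> a k" for k
  proof (induction k)
    case 0
    then show ?case using b0 by (simp add: s_def)
  next
    case (Suc k)
    have "(b * s ^ (2 ^ k))\<^sup>2 \<le> (a k)\<^sup>2"
      using Suc b0 s(2) by (intro power_mono) auto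
    also have "\<dots> \<le> b * a (Suc k)" by (rule step)
    finally have "b * (b * s ^ (2 ^ Suc k)) \<le> b * a (Suc k)"
      by (simp add: power_mult_distrib power2_eq_square mult_2 power_add mult.assoc mult.left_commute)
    then show ?case using b0 by simp
  qed
  have "0 < r"
  proof (rule ccontr)
    assume "\<not> 0 < r"
    then have "r = 0" using r by simp
    then show False using bound[of 0] a0 by simp
  qed
  define u where "u = s / r"
  have u: "1 < u" using s \<open>0 < r\<close> by (simp add: u_def)
  have le: "b * u ^ (2 ^ k) \<le> C * 2 ^ k" for k
    using order_trans[OF grow bound, of k] \<open>0 < r\<close> by (simp add: u_def power_divide field_simps)
  \<comment> \<open>Bernoulli's inequality for u^N, squared, yields quadratic growth in N = 2^k,
    while \<open>le\<close> at Suc k allows only linear growth.\<close>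
  have "b * (real N * (u - 1))\<^sup>2 \<le> 2 * C * real N" if "N = 2 ^ k" for k N
  proof -
    have "real N * (u - 1) \<le> u ^ N"
      using linear_plus_1_le_power[of "u - 1" N] u by simp
    then have "(real N * (u - 1))\<^sup>2 \<le> (u ^ N)\<^sup>2" using u by (intro power_mono) auto
    also have "\<dots> = u ^ (2 ^ Suc k)" by (simp add: that power_mult[symmetric] mult.commute)
    finally have "b * (real N * (u - 1))\<^sup>2 \<le> b * u ^ (2 ^ Suc k)" using b0 by simp
    also have "\<dots> \<le> C * 2 ^ Suc k" by (rule le)
    finally show ?thesis by (simp add: that mult_ac)
  qed
  then have lin: "b * (u - 1)\<^sup>2 * 2 ^ k \<le> 2 * C" for k
    using \<open>\<And>N k. N = 2 ^ k \<Longrightarrow> _\<close>[of "2 ^ k" k]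
    by (simp add: power_mult_distrib power2_eq_square mult_ac)
  obtain k where "2 * C / (b * (u - 1)\<^sup>2) < 2 ^ k"
    using real_arch_pow[of 2] by auto
  then show False using lin[of k] b0 u by (simp add: field_simps)
qed

text \<open>The scalar case f = 1 of the iteration \<open>sqrt_iter\<close> below. The iterates are
  polynomials in f with nonnegative coefficients, so \<open>sqrt_coeff m\<close> is the sum of the
  coefficients of the m-th one and bounds its norm when f is a contraction.\<close>

primrec sqrt_coeff :: "nat \<Rightarrow> real"
  where "sqrt_coeff 0 = 0"
  | "sqrt_coeff (Suc m) = (1 + (sqrt_coeff m)\<^sup>2) / 2"

lemma sqrt_coeff_bounds: "0 \<le> sqrt_coeff m \<and> sqrt_coeff m \<le> 1"
proof (induction m)
  case (Suc m)
  then have "(sqrt_coeff m)\<^sup>2 \<le> 1" by (simp add: power_le_one)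
  then show ?case by (simp add: add_nonneg_nonneg)
qed simp

lemma sqrt_coeff_mono: "incseq sqrt_coeff"
proof (rule incseq_SucI)
  fix m
  have "0 \<le> (1 - sqrt_coeff m)\<^sup>2" by simp
  then show "sqrt_coeff m \<le> sqrt_coeff (Suc m)" by (simp add: power2_eq_square algebra_simps)
qed

lemma sqrt_coeff_tendsto: "sqrt_coeff \<longlonglongrightarrow> 1"
proof -
  obtain l where l: "sqrt_coeff \<longlonglongrightarrow> l"
    using incseq_convergent[OF sqrt_coeff_mono, of 1] sqrt_coeff_bounds by blast
  have "(\<lambda>m. sqrt_coeff (Suc m)) \<longlonglongrightarrow> (1 + l\<^sup>2) / 2"
    unfolding sqrt_coeff.simps by (intro tendsto_intros l) simp
  with LIMSEQ_Suc[OF l] have "l = (1 + l\<^sup>2) / 2" by (rule LIMSEQ_unique)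
  then have "(l - 1)\<^sup>2 = 0" by (simp add: power2_eq_square algebra_simps)
  with l show ?thesis by simp
qed

lemma sqrt_coeff_Cauchy: "Cauchy sqrt_coeff"
  using sqrt_coeff_tendsto LIMSEQ_imp_Cauchy by blast

text \<open>The iteration \<open>D \<mapsto> (f + D\<^sup>2) / 2\<close>, started at \<open>0\<close>, converges to the solution
  \<open>D = 1 - (1 - f)\<^sup>1\<^sup>/\<^sup>2\<close> of \<open>D\<^sup>2 = 2 D - f\<close>.\<close>

primrec sqrt_iter :: "('e::real_vector \<Rightarrow> 'e) \<Rightarrow> nat \<Rightarrow> 'e \<Rightarrow> 'e"
  where "sqrt_iter f 0 = (\<lambda>x. 0)"
  | "sqrt_iter f (Suc m) = (\<lambda>x. (1 / 2) *\<^sub>R (f x + sqrt_iter f m (sqrt_iter f m x)))"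

definition rlinear_on :: "'e::real_vector set \<Rightarrow> ('e \<Rightarrow> 'e) \<Rightarrow> bool"
  where "rlinear_on E g \<longleftrightarrow> (\<forall>x\<in>E. g x \<in> E) \<and> (\<forall>x\<in>E. \<forall>y\<in>E. g (x + y) = g x + g y) \<and>
    (\<forall>c. \<forall>x\<in>E. g (c *\<^sub>R x) = c *\<^sub>R g x)"

text \<open>The norm is a parameter: it is the norm of a Hilbert module in one use and a norm on
  n-tuples in another.\<close>

locale contraction =
  fixes E :: "'e::real_vector set" and nrm :: "'e \<Rightarrow> real" and f :: "'e \<Rightarrow> 'e"
  assumes subspace_E: "subspace E"
    and nrm_add: "x \<in> E \<Longrightarrow> y \<in> E \<Longrightarrow> nrm (x + y) \<le> nrm x + nrm y"
    and nrm_scale: "x \<in> E \<Longrightarrow> nrm (c *\<^sub>R x) = \<bar>c\<bar> * nrm x"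
    and rlinear_f: "rlinear_on E f"
    and f_contr: "x \<in> E \<Longrightarrow> nrm (f x) \<le> nrm x"
begin

lemmas sub = subspace_0[OF subspace_E] subspace_add[OF subspace_E] subspace_scale[OF subspace_E]
  subspace_diff[OF subspace_E]

lemma nrm_0: "nrm 0 = 0"
  using nrm_scale[of 0 0] sub by simp

lemma rlinear_sqrt_iter: "rlinear_on E (sqrt_iter f m)"
proof (induction m)
  case 0
  then show ?case by (simp add: rlinear_on_def sub)
next
  case (Suc m)
  with rlinear_f show ?case
    unfolding rlinear_on_def by (auto simp: sub scaleR_add_right)
qed

lemma sqrt_iter_commute:
  assumes "rlinear_on E g" "\<And>x. x \<in> E \<Longrightarrow> g (f x) = f (g x)" "x \<in> E"
  shows "g (sqrt_iter f m x) = sqrt_iter f m (g x)"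
  using assms(3)
proof (induction m arbitrary: x)
  case 0
  have "g (0 *\<^sub>R x) = 0 *\<^sub>R g x" using assms(1) 0 unfolding rlinear_on_def by blast
  then show ?case by simp
next
  case (Suc m)
  have in_E: "sqrt_iter f m x \<in> E" "f x \<in> E" "sqrt_iter f m (sqrt_iter f m x) \<in> E"
    using rlinear_sqrt_iter[of m] rlinear_f Suc.prems unfolding rlinear_on_def by auto
  show ?case
    using assms(1) in_E Suc.prems unfolding rlinear_on_def by (simp add: Suc.IH assms(2) sub)
qed

lemma sqrt_iter_iter_commute:
  assumes "x \<in> E"
  shows "sqrt_iter f k (sqrt_iter f m x) = sqrt_iter f m (sqrt_iter f k x)"
proof (rule sqrt_iter_commute[OF rlinear_sqrt_iter _ assms])
  fix x assume "x \<in> E"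
  then show "sqrt_iter f k (f x) = f (sqrt_iter f k x)"
    using sqrt_iter_commute[OF rlinear_f, of x k] by simp
qed

lemma sqrt_iter_in: "x \<in> E \<Longrightarrow> sqrt_iter f m x \<in> E"
  and sqrt_iter_diff: "x \<in> E \<Longrightarrow> y \<in> E \<Longrightarrow> sqrt_iter f m (x - y) = sqrt_iter f m x - sqrt_iter f m y"
proof -
  show *: "x \<in> E \<Longrightarrow> sqrt_iter f m x \<in> E" for x
    using rlinear_sqrt_iter[of m] by (simp add: rlinear_on_def)
  have add: "sqrt_iter f m (u + v) = sqrt_iter f m u + sqrt_iter f m v" if "u \<in> E" "v \<in> E" for u v
    using rlinear_sqrt_iter[of m] that by (simp add: rlinear_on_def)
  show "x \<in> E \<Longrightarrow> y \<in> E \<Longrightarrow> sqrt_iter f m (x - y) = sqrt_iter f m x - sqrt_iter f m y"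
    using add[of "x - y" y] by (simp add: sub)
qed

lemma nrm_sqrt_iter: "x \<in> E \<Longrightarrow> nrm (sqrt_iter f m x) \<le> sqrt_coeff m * nrm x"
proof (induction m arbitrary: x)
  case 0
  then show ?case by (simp add: nrm_0)
next
  case (Suc m)
  have fE: "f x \<in> E" using rlinear_f Suc.prems by (simp add: rlinear_on_def)
  note in_E = sqrt_iter_in[OF Suc.prems, of m]
  have "nrm (sqrt_iter f m (sqrt_iter f m x)) \<le> sqrt_coeff m * (sqrt_coeff m * nrm x)"
    using Suc.IH[OF in_E] Suc.IH[OF Suc.prems] sqrt_coeff_bounds[of m]
    by (meson mult_left_mono order_trans)
  with nrm_add[OF fE sqrt_iter_in[OF in_E, of m]] f_contr[OF Suc.prems]
  have "nrm (f x + sqrt_iter f m (sqrt_iter f m x)) \<le> nrm x + sqrt_coeff m * (sqrt_coeff m * nrm x)"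
    by linarith
  then show ?case
    using nrm_scale[OF sub(2)[OF fE sqrt_iter_in[OF in_E, of m]], of "1/2"]
    by (simp add: power2_eq_square algebra_simps)
qed

text \<open>Majorant argument: the iterates commute, so Z^2 - Y^2 = Z (Z - Y) + Y (Z - Y), and z^2 -
  y^2 factors likewise for the scalar sequence. The increments are thus dominated by those of
  \<open>sqrt_coeff\<close>, which telescope.\<close>

lemma nrm_sqrt_iter_Suc_diff:
  "x \<in> E \<Longrightarrow> nrm (sqrt_iter f (Suc m) x - sqrt_iter f m x) \<le> (sqrt_coeff (Suc m) - sqrt_coeff m) * nrm x"
proof (induction m arbitrary: x)
  case 0
  have fE: "f x \<in> E" using rlinear_f 0 by (simp add: rlinear_on_def)
  show ?case using nrm_scale[OF fE, of "1/2"] f_contr[OF 0] by simp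
next
  case (Suc m)
  note x = Suc.prems
  let ?Y = "sqrt_iter f m" and ?Z = "sqrt_iter f (Suc m)"
  let ?y = "sqrt_coeff m" and ?z = "sqrt_coeff (Suc m)"
  define d where "d = ?Z x - ?Y x"
  have Y: "?Y x \<in> E" and Z: "?Z x \<in> E" using x sqrt_iter_in by blast+
  have d: "d \<in> E" using Y Z sub by (simp add: d_def)
  have nd: "nrm d \<le> (?z - ?y) * nrm x" using Suc.IH[OF x] by (simp only: d_def)
  have "sqrt_iter f (Suc (Suc m)) x - ?Z x = (1/2) *\<^sub>R (?Z (?Z x) - ?Y (?Y x))"
    by (simp only: sqrt_iter.simps(2)[of f "Suc m"]) (simp add: algebra_simps)
  also have "?Z (?Z x) - ?Y (?Y x) = ?Z d + ?Y d"
    using sqrt_iter_iter_commute[OF x, of m "Suc m"]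
    by (simp add: d_def sqrt_iter_diff[OF Z Y] del: sqrt_iter.simps)
  finally have eq: "sqrt_iter f (Suc (Suc m)) x - ?Z x = (1/2) *\<^sub>R (?Z d + ?Y d)" .
  have ZYd: "?Z d \<in> E" "?Y d \<in> E" using d sqrt_iter_in by blast+
  have "nrm (?Z d + ?Y d) \<le> ?z * nrm d + ?y * nrm d"
    using nrm_add[OF ZYd] nrm_sqrt_iter[OF d, of m] nrm_sqrt_iter[OF d, of "Suc m"] by linarith
  also have "\<dots> \<le> (?z + ?y) * ((?z - ?y) * nrm x)"
    using mult_left_mono[OF nd, of "?z + ?y"] sqrt_coeff_bounds[of m] sqrt_coeff_bounds[of "Suc m"]
    by (simp add: distrib_right)
  finally have le: "nrm (?Z d + ?Y d) \<le> (?z + ?y) * ((?z - ?y) * nrm x)" .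
  have "sqrt_coeff (Suc (Suc m)) - ?z = (?z + ?y) * (?z - ?y) / 2"
    using sqrt_coeff.simps(2)[of "Suc m"] sqrt_coeff.simps(2)[of m]
    by (simp add: power2_eq_square algebra_simps diff_divide_distrib add_divide_distrib
        del: sqrt_coeff.simps)
  then have "(sqrt_coeff (Suc (Suc m)) - ?z) * nrm x = (?z + ?y) * ((?z - ?y) * nrm x) / 2"
    by (simp only:) simp
  with le show ?case
    unfolding eq using nrm_scale[OF sub(2)[OF ZYd], of "1/2"] by linarith
qed

lemma nrm_sqrt_iter_diff:
  assumes "x \<in> E" "m \<le> k"
  shows "nrm (sqrt_iter f k x - sqrt_iter f m x) \<le> (sqrt_coeff k - sqrt_coeff m) * nrm x"
  using assms(2)
proof (induction k rule: dec_induct)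
  case base
  then show ?case by (simp add: nrm_0)
next
  case (step k)
  have E: "sqrt_iter f (Suc k) x - sqrt_iter f k x \<in> E" "sqrt_iter f k x - sqrt_iter f m x \<in> E"
    using sqrt_iter_in[OF assms(1)] sub(4) by blast+
  show ?case
    using nrm_add[OF E] nrm_sqrt_iter_Suc_diff[OF assms(1), of k] step.IH
    by (simp add: algebra_simps del: sqrt_iter.simps sqrt_coeff.simps)
qed

end

section \<open>Adjointable operators on Hilbert modules\<close>

text \<open>Meant for a C*-algebra over itself with inner product x^* y. No order on the values is
  available yet, so the norm identity for \<open>ip x x\<close> stands in for positivity, and the
  order theory of operators is derived from it.\<close>

locale hilbert_module =
  fixes E :: "'e::complex_normed_vector set" and ip :: "'e \<Rightarrow> 'e \<Rightarrow> 'v::complex_normed_vector"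
  assumes csubspace_E: "csubspace E" and complete_E: "complete E"
    and ip_add_right: "x \<in> E \<Longrightarrow> y \<in> E \<Longrightarrow> z \<in> E \<Longrightarrow> ip x (y + z) = ip x y + ip x z"
    and ip_scaleC_right: "x \<in> E \<Longrightarrow> y \<in> E \<Longrightarrow> ip x (c *\<^sub>C y) = c *\<^sub>C ip x y"
    and ip_add_left: "x \<in> E \<Longrightarrow> y \<in> E \<Longrightarrow> z \<in> E \<Longrightarrow> ip (x + y) z = ip x z + ip y z"
    and ip_scaleC_left: "x \<in> E \<Longrightarrow> y \<in> E \<Longrightarrow> ip (c *\<^sub>C x) y = cnj c *\<^sub>C ip x y"
    and norm_ip: "x \<in> E \<Longrightarrow> y \<in> E \<Longrightarrow> norm (ip x y) \<le> norm x * norm y"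
    and norm_ip_self: "x \<in> E \<Longrightarrow> norm (ip x x) = (norm x)\<^sup>2"
begin

lemmas E_0 [simp] = csubspace_0[OF csubspace_E]
  and E_add [simp] = csubspace_add[OF csubspace_E]
  and E_diff [simp] = csubspace_diff[OF csubspace_E]
  and E_uminus [simp] = csubspace_uminus[OF csubspace_E]
  and E_scaleC [simp] = csubspace_scaleC[OF csubspace_E]
  and E_scaleR [simp] = csubspace_scaleR[OF csubspace_E]

lemma ip_uminus_right: "x \<in> E \<Longrightarrow> y \<in> E \<Longrightarrow> ip x (- y) = - ip x y"
  using ip_scaleC_right[of x y "- 1"] by simp

lemma ip_uminus_left: "x \<in> E \<Longrightarrow> y \<in> E \<Longrightarrow> ip (- x) y = - ip x y"
  using ip_scaleC_left[of x y "- 1"] by simp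

lemma ip_diff_right: "x \<in> E \<Longrightarrow> y \<in> E \<Longrightarrow> z \<in> E \<Longrightarrow> ip x (y - z) = ip x y - ip x z"
  using ip_add_right[of x y "- z"] by (simp add: ip_uminus_right)

lemma ip_diff_left: "x \<in> E \<Longrightarrow> y \<in> E \<Longrightarrow> z \<in> E \<Longrightarrow> ip (x - y) z = ip x z - ip y z"
  using ip_add_left[of x "- y" z] by (simp add: ip_uminus_left)

lemma ip_scaleR_right: "x \<in> E \<Longrightarrow> y \<in> E \<Longrightarrow> ip x (r *\<^sub>R y) = r *\<^sub>R ip x y"
  and ip_scaleR_left: "x \<in> E \<Longrightarrow> y \<in> E \<Longrightarrow> ip (r *\<^sub>R x) y = r *\<^sub>R ip x y"
  by (simp_all add: scaleR_scaleC ip_scaleC_right ip_scaleC_left)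

lemma ip_0_right [simp]: "x \<in> E \<Longrightarrow> ip x 0 = 0"
  and ip_0_left [simp]: "x \<in> E \<Longrightarrow> ip 0 x = 0"
  using ip_scaleR_right[of x 0 0] ip_scaleR_left[of 0 x 0] by simp_all

lemma ip_self_eq_0: "x \<in> E \<Longrightarrow> ip x x = 0 \<Longrightarrow> x = 0"
  using norm_ip_self[of x] by simp

lemma ip_ext:
  assumes "x \<in> E" "y \<in> E" "\<And>z. z \<in> E \<Longrightarrow> ip x z = ip y z"
  shows "x = y"
  using ip_self_eq_0[of "x - y"] assms by (simp add: ip_diff_left)

text \<open>An adjointable operator is encoded as a function together with its adjoint, and only
  values on E count. Linearity is a consequence of adjointness, see
  \<open>adjoint_pair_linear\<close>.\<close>

definition adjoint_pair :: "('e \<Rightarrow> 'e) \<Rightarrow> ('e \<Rightarrow> 'e) \<Rightarrow> bool"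
  where "adjoint_pair f g \<longleftrightarrow> (\<forall>x\<in>E. f x \<in> E \<and> g x \<in> E) \<and>
    (\<forall>x\<in>E. \<forall>y\<in>E. ip (f x) y = ip x (g y) \<and> ip (g x) y = ip x (f y)) \<and>
    (\<exists>K. \<forall>x\<in>E. norm (f x) \<le> K * norm x \<and> norm (g x) \<le> K * norm x)"

abbreviation selfadjoint :: "('e \<Rightarrow> 'e) \<Rightarrow> bool"
  where "selfadjoint f \<equiv> adjoint_pair f f"

lemma adjoint_pairD:
  assumes "adjoint_pair f g"
  shows "x \<in> E \<Longrightarrow> f x \<in> E" "x \<in> E \<Longrightarrow> g x \<in> E"
    "x \<in> E \<Longrightarrow> y \<in> E \<Longrightarrow> ip (f x) y = ip x (g y)"
    "x \<in> E \<Longrightarrow> y \<in> E \<Longrightarrow> ip (g x) y = ip x (f y)"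
  using assms by (auto simp: adjoint_pair_def)

lemma adjoint_pair_bound:
  assumes "adjoint_pair f g"
  obtains K where "0 < K" "\<And>x. x \<in> E \<Longrightarrow> norm (f x) \<le> K * norm x" "\<And>x. x \<in> E \<Longrightarrow> norm (g x) \<le> K * norm x"
proof -
  obtain K where K: "\<forall>x\<in>E. norm (f x) \<le> K * norm x \<and> norm (g x) \<le> K * norm x"
    using assms unfolding adjoint_pair_def by blast
  have "K * norm x \<le> (\<bar>K\<bar> + 1) * norm x" for x :: 'e
    by (intro mult_right_mono) auto
  with K that[of "\<bar>K\<bar> + 1"] show thesis
    by (meson abs_ge_zero add_nonneg_pos order_trans zero_less_one)
qed

lemma adjoint_pairI:
  assumes "\<And>x. x \<in> E \<Longrightarrow> f x \<in> E" "\<And>x. x \<in> E \<Longrightarrow> g x \<in> E"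
    "\<And>x y. x \<in> E \<Longrightarrow> y \<in> E \<Longrightarrow> ip (f x) y = ip x (g y)"
    "\<And>x y. x \<in> E \<Longrightarrow> y \<in> E \<Longrightarrow> ip (g x) y = ip x (f y)"
    "\<And>x. x \<in> E \<Longrightarrow> norm (f x) \<le> K * norm x" "\<And>x. x \<in> E \<Longrightarrow> norm (g x) \<le> K' * norm x"
  shows "adjoint_pair f g"
proof -
  have "norm (f x) \<le> max K K' * norm x \<and> norm (g x) \<le> max K K' * norm x" if "x \<in> E" for x
    using assms(5)[OF that] assms(6)[OF that]
      mult_right_mono[of K "max K K'" "norm x"] mult_right_mono[of K' "max K K'" "norm x"] by auto
  then show ?thesis using assms(1-4) unfolding adjoint_pair_def by blast
qed

lemma adjoint_pair_sym: "adjoint_pair f g \<Longrightarrow> adjoint_pair g f"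
  unfolding adjoint_pair_def by meson

lemma adjoint_pair_cong:
  "adjoint_pair f g \<Longrightarrow> (\<And>x. x \<in> E \<Longrightarrow> f x = f' x) \<Longrightarrow> (\<And>x. x \<in> E \<Longrightarrow> g x = g' x) \<Longrightarrow> adjoint_pair f' g'"
  unfolding adjoint_pair_def by simp

lemma adjoint_pair_id: "selfadjoint (\<lambda>x. x)"
  by (rule adjoint_pairI[where K=1 and K'=1]) auto

lemma adjoint_pair_add:
  assumes "adjoint_pair f f'" "adjoint_pair g g'"
  shows "adjoint_pair (\<lambda>x. f x + g x) (\<lambda>x. f' x + g' x)"
proof -
  obtain K where "0 < K" and K: "\<And>x. x \<in> E \<Longrightarrow> norm (f x) \<le> K * norm x" "\<And>x. x \<in> E \<Longrightarrow> norm (f' x) \<le> K * norm x"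
    using adjoint_pair_bound[OF assms(1)] by blast
  obtain L where "0 < L" and L: "\<And>x. x \<in> E \<Longrightarrow> norm (g x) \<le> L * norm x" "\<And>x. x \<in> E \<Longrightarrow> norm (g' x) \<le> L * norm x"
    using adjoint_pair_bound[OF assms(2)] by blast
  show ?thesis
  proof (rule adjoint_pairI[where K="K+L" and K'="K+L"])
    fix x assume x: "x \<in> E"
    show "norm (f x + g x) \<le> (K + L) * norm x"
      unfolding distrib_right by (intro norm_triangle_mono K L x)
    show "norm (f' x + g' x) \<le> (K + L) * norm x"
      unfolding distrib_right by (intro norm_triangle_mono K L x)
  qed (simp_all add: adjoint_pairD[OF assms(1)] adjoint_pairD[OF assms(2)] ip_add_left ip_add_right)
qed

lemma adjoint_pair_scaleC:
  assumes "adjoint_pair f f'"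
  shows "adjoint_pair (\<lambda>x. c *\<^sub>C f x) (\<lambda>x. cnj c *\<^sub>C f' x)"
proof -
  obtain K where "0 < K" and K: "\<And>x. x \<in> E \<Longrightarrow> norm (f x) \<le> K * norm x" "\<And>x. x \<in> E \<Longrightarrow> norm (f' x) \<le> K * norm x"
    using adjoint_pair_bound[OF assms] by blast
  show ?thesis
  proof (rule adjoint_pairI[where K="cmod c * K" and K'="cmod c * K"])
    fix x assume x: "x \<in> E"
    show "norm (c *\<^sub>C f x) \<le> cmod c * K * norm x"
      using K(1)[OF x] by (simp add: norm_scaleC mult.assoc mult_left_mono)
    show "norm (cnj c *\<^sub>C f' x) \<le> cmod c * K * norm x"
      using K(2)[OF x] by (simp add: norm_scaleC mult.assoc mult_left_mono)
  qed (simp_all add: adjoint_pairD[OF assms] ip_scaleC_left ip_scaleC_right)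
qed

lemma adjoint_pair_scaleR:
  "adjoint_pair f f' \<Longrightarrow> adjoint_pair (\<lambda>x. r *\<^sub>R f x) (\<lambda>x. r *\<^sub>R f' x)"
  using adjoint_pair_scaleC[of f f' "complex_of_real r"] by (simp add: scaleR_scaleC)

lemma adjoint_pair_uminus: "adjoint_pair f f' \<Longrightarrow> adjoint_pair (\<lambda>x. - f x) (\<lambda>x. - f' x)"
  using adjoint_pair_scaleR[of f f' "- 1"] by simp

lemma adjoint_pair_diff:
  "adjoint_pair f f' \<Longrightarrow> adjoint_pair g g' \<Longrightarrow> adjoint_pair (\<lambda>x. f x - g x) (\<lambda>x. f' x - g' x)"
  using adjoint_pair_add[OF _ adjoint_pair_uminus, of f f' g g'] by simp

lemma adjoint_pair_compose:
  assumes "adjoint_pair f f'" "adjoint_pair g g'"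
  shows "adjoint_pair (\<lambda>x. f (g x)) (\<lambda>x. g' (f' x))"
proof -
  obtain K where K: "0 < K" "\<And>x. x \<in> E \<Longrightarrow> norm (f x) \<le> K * norm x" "\<And>x. x \<in> E \<Longrightarrow> norm (f' x) \<le> K * norm x"
    using adjoint_pair_bound[OF assms(1)] by blast
  obtain L where L: "0 < L" "\<And>x. x \<in> E \<Longrightarrow> norm (g x) \<le> L * norm x" "\<And>x. x \<in> E \<Longrightarrow> norm (g' x) \<le> L * norm x"
    using adjoint_pair_bound[OF assms(2)] by blast
  note D = adjoint_pairD[OF assms(1)] adjoint_pairD[OF assms(2)]
  show ?thesis
  proof (rule adjoint_pairI[where K="K*L" and K'="K*L"])
    fix x assume x: "x \<in> E"
    have "norm (f (g x)) \<le> K * (L * norm x)"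
      using K(2)[OF D(5)[OF x]] L(2)[OF x] K(1) by (meson less_imp_le mult_left_mono order_trans)
    then show "norm (f (g x)) \<le> K * L * norm x" by (simp add: mult.assoc)
    have "norm (g' (f' x)) \<le> L * (K * norm x)"
      using L(3)[OF D(2)[OF x]] K(3)[OF x] L(1) by (meson less_imp_le mult_left_mono order_trans)
    then show "norm (g' (f' x)) \<le> K * L * norm x" by (simp add: mult_ac)
  qed (auto simp: D)
qed

lemma adjoint_pair_linear:
  assumes "adjoint_pair f g"
  shows "x \<in> E \<Longrightarrow> y \<in> E \<Longrightarrow> f (x + y) = f x + f y"
    and "x \<in> E \<Longrightarrow> f (c *\<^sub>C x) = c *\<^sub>C f x"
    and "x \<in> E \<Longrightarrow> f (r *\<^sub>R x) = r *\<^sub>R f x"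
    and "x \<in> E \<Longrightarrow> f (- x) = - f x"
    and "x \<in> E \<Longrightarrow> y \<in> E \<Longrightarrow> f (x - y) = f x - f y"
    and "f 0 = 0"
proof -
  note D = adjoint_pairD[OF assms]
  show add: "f (x + y) = f x + f y" if "x \<in> E" "y \<in> E" for x y
    using that by (intro ip_ext) (auto simp: D ip_add_left)
  show sc: "f (c *\<^sub>C x) = c *\<^sub>C f x" if "x \<in> E" for x c
    using that by (intro ip_ext) (auto simp: D ip_scaleC_left)
  show "x \<in> E \<Longrightarrow> f (r *\<^sub>R x) = r *\<^sub>R f x" by (simp add: scaleR_scaleC sc)
  show um: "x \<in> E \<Longrightarrow> f (- x) = - f x" for x using sc[of x "- 1"] by simp
  show "x \<in> E \<Longrightarrow> y \<in> E \<Longrightarrow> f (x - y) = f x - f y" using add[of x "- y"] um[of y] by simp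
  show "f 0 = 0" using sc[of 0 0] by simp
qed

lemma adjoint_pair_rlinear: "adjoint_pair f g \<Longrightarrow> rlinear_on E f"
  by (simp add: rlinear_on_def adjoint_pairD adjoint_pair_linear)

lemma selfadjoint_power: "selfadjoint f \<Longrightarrow> selfadjoint (f ^^ k)"
proof (induction k)
  case 0
  then show ?case using adjoint_pair_id by (simp add: id_def)
next
  case (Suc k)
  have "adjoint_pair (\<lambda>x. f ((f ^^ k) x)) (\<lambda>x. (f ^^ k) (f x))"
    using adjoint_pair_compose Suc by blast
  then show ?case by (simp add: o_def funpow_swap1)
qed

lemma norm_square_le:
  assumes "adjoint_pair f g" "x \<in> E"
  shows "(norm (f x))\<^sup>2 \<le> norm x * norm (g (f x))"
  using norm_ip_self[of "f x"] norm_ip[of x "g (f x)"] assms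
  by (simp add: adjoint_pairD[OF assms(1)])

lemma selfadjoint_square_0:
  assumes "selfadjoint f" "\<And>x. x \<in> E \<Longrightarrow> f (f x) = 0" "x \<in> E"
  shows "f x = 0"
  using norm_square_le[OF assms(1,3)] assms by simp

definition commuting :: "('e \<Rightarrow> 'e) \<Rightarrow> ('e \<Rightarrow> 'e) \<Rightarrow> bool"
  where "commuting f g \<longleftrightarrow> (\<forall>x\<in>E. f (g x) = g (f x))"

text \<open>D is 1 - (1 - f)^(1/2). Besides D the lemma exports the convergence with a rate uniform
  on bounded sets: this later shows that the root of an algebra element is again an element, as a
  limit of polynomials. Commutation with f passes from the iterates to D.\<close>

lemma sqrt_of_complement:
  assumes f: "selfadjoint f" and contr: "\<And>x. x \<in> E \<Longrightarrow> norm (f x) \<le> norm x"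
  obtains D where "selfadjoint D" "\<And>x. x \<in> E \<Longrightarrow> norm (D x) \<le> norm x"
    "\<And>x. x \<in> E \<Longrightarrow> D (D x) = 2 *\<^sub>R D x - f x"
    "\<And>g g'. adjoint_pair g g' \<Longrightarrow> commuting g f \<Longrightarrow> commuting g D"
    "\<And>x. x \<in> E \<Longrightarrow> (\<lambda>m. sqrt_iter f m x) \<longlonglongrightarrow> D x"
    "\<And>x m. x \<in> E \<Longrightarrow> norm (D x - sqrt_iter f m x) \<le> (1 - sqrt_coeff m) * norm x"
proof -
  interpret contraction E norm f
    using adjoint_pair_rlinear[OF f] contr csubspace_subspace[OF csubspace_E]
    by unfold_locales (auto intro: norm_triangle_ineq)
  let ?Y = "sqrt_iter f"
  define D where "D x = lim (\<lambda>m. ?Y m x)" for x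
  have lim: "(\<lambda>m. ?Y m x) \<longlonglongrightarrow> D x \<and> D x \<in> E" if x: "x \<in> E" for x
  proof -
    have "Cauchy (\<lambda>m. ?Y m x)"
    proof (rule CauchyI')
      fix e :: real assume "0 < e"
      then have "0 < e / (norm x + 1)" by (simp add: add_nonneg_pos)
      from CauchyD[OF sqrt_coeff_Cauchy this]
      obtain M where M: "\<And>m n. M \<le> m \<Longrightarrow> M \<le> n \<Longrightarrow> norm (sqrt_coeff m - sqrt_coeff n) < e / (norm x + 1)"
        by blast
      show "\<exists>M. \<forall>m\<ge>M. \<forall>n>m. dist (?Y m x) (?Y n x) < e"
      proof (rule exI[of _ M], intro allI impI)
        fix m n assume mn: "M \<le> m" "m < n"
        have "norm (?Y m x - ?Y n x) \<le> (sqrt_coeff n - sqrt_coeff m) * norm x"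
          using nrm_sqrt_iter_diff[OF x, of m n] mn by (simp add: norm_minus_commute)
        also have "\<dots> \<le> e / (norm x + 1) * norm x"
          using M[of n m] mn by (intro mult_right_mono) auto
        also have "\<dots> < e" using \<open>0 < e\<close> by (simp add: field_simps add_pos_nonneg)
        finally show "dist (?Y m x) (?Y n x) < e" by (simp add: dist_norm)
      qed
    qed
    then obtain l where "l \<in> E" "(\<lambda>m. ?Y m x) \<longlonglongrightarrow> l"
      using complete_E[unfolded complete_def, rule_format, of "\<lambda>m. ?Y m x"] sqrt_iter_in[OF x] by blast
    then show ?thesis by (auto simp: D_def limI)
  qed
  have Y_le: "norm (?Y m x) \<le> norm x" if "x \<in> E" for x m
    using nrm_sqrt_iter[OF that, of m] mult_right_mono[of "sqrt_coeff m" 1 "norm x"]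
      sqrt_coeff_bounds[of m] by simp
  have D_le: "norm (D x) \<le> norm x" if "x \<in> E" for x
    by (rule LIMSEQ_le_const2[OF tendsto_norm[OF conjunct1[OF lim[OF that]]]]) (use Y_le[OF that] in auto)
  have Y_sa: "selfadjoint (?Y m)" for m
  proof (induction m)
    case 0
    show ?case by (rule adjoint_pairI[where K=0 and K'=0]) auto
  next
    case (Suc m)
    show ?case
      using adjoint_pair_scaleR[OF adjoint_pair_add[OF f adjoint_pair_compose[OF Suc Suc]], of "1/2"]
      by simp
  qed
  have D_sa: "ip (D x) y = ip x (D y)" if "x \<in> E" "y \<in> E" for x y
  proof (rule LIMSEQ_unique)
    have b: "norm (ip u v - ip u' v') \<le> norm (u - u') * norm v + norm u' * norm (v - v')"
      if "u \<in> E" "v \<in> E" "u' \<in> E" "v' \<in> E" for u v u' v'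
    proof -
      have "ip u v - ip u' v' = ip (u - u') v + ip u' (v - v')"
        using that by (simp add: ip_diff_left ip_diff_right)
      then show ?thesis
        using norm_triangle_ineq[of "ip (u - u') v" "ip u' (v - v')"] norm_ip[of "u - u'" v] norm_ip[of u' "v - v'"] that
        by simp
    qed
    have 1: "(\<lambda>m. norm (?Y m z - D z)) \<longlonglongrightarrow> 0" if "z \<in> E" for z
      using tendsto_norm_zero[OF LIM_zero[OF conjunct1[OF lim[OF that]]]] .
    have "(\<lambda>m. norm (?Y m x - D x) * norm y) \<longlonglongrightarrow> 0"
      using tendsto_mult_left_zero[OF 1[OF that(1)]] .
    then show "(\<lambda>m. ip (?Y m x) y) \<longlonglongrightarrow> ip (D x) y"
      by (rule tendsto_norm_diff_bound[rotated])
        (use b[OF sqrt_iter_in[OF that(1)] that(2) conjunct2[OF lim[OF that(1)]] that(2)] in simp)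
    have "(\<lambda>m. norm x * norm (?Y m y - D y)) \<longlonglongrightarrow> 0"
      using tendsto_mult_right_zero[OF 1[OF that(2)]] .
    then have "(\<lambda>m. ip x (?Y m y)) \<longlonglongrightarrow> ip x (D y)"
      by (rule tendsto_norm_diff_bound[rotated])
        (use b[OF that(1) sqrt_iter_in[OF that(2)] that(1) conjunct2[OF lim[OF that(2)]]] in simp)
    then show "(\<lambda>m. ip (?Y m x) y) \<longlonglongrightarrow> ip x (D y)"
      using adjoint_pairD(3)[OF Y_sa that] by simp
  qed
  have D: "selfadjoint D"
    by (rule adjoint_pairI[where K=1 and K'=1]) (use lim D_sa D_le in auto)
  have DD: "D (D x) = 2 *\<^sub>R D x - f x" if x: "x \<in> E" for x
  proof -
    have "(\<lambda>m. ?Y m (?Y m x)) \<longlonglongrightarrow> D (D x)"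
    proof -
      \<comment> \<open>All iterates are contractions, so the inner and the outer limit can be taken
        together.\<close>
      have "norm (?Y m (?Y m x) - D (D x)) \<le> norm (?Y m x - D x) + norm (?Y m (D x) - D (D x))" for m
      proof -
        have eq: "?Y m (?Y m x) - D (D x) = ?Y m (?Y m x - D x) + (?Y m (D x) - D (D x))"
          using sqrt_iter_diff[OF sqrt_iter_in[OF x], of "D x"] lim[OF x] by simp
        have "norm (?Y m (?Y m x - D x)) \<le> norm (?Y m x - D x)"
          using Y_le[of "?Y m x - D x" m] lim[OF x] sqrt_iter_in[OF x] by simp
        then show ?thesis
          unfolding eq using norm_triangle_ineq[of "?Y m (?Y m x - D x)" "?Y m (D x) - D (D x)"]
          by linarith
      qed
      moreover have "(\<lambda>m. norm (?Y m x - D x) + norm (?Y m (D x) - D (D x))) \<longlonglongrightarrow> 0"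
        using tendsto_add[OF tendsto_norm_zero[OF LIM_zero[OF conjunct1[OF lim[OF x]]]]
            tendsto_norm_zero[OF LIM_zero[OF conjunct1[OF lim[of "D x"]]]]] lim[OF x] by simp
      ultimately show ?thesis by (rule tendsto_norm_diff_bound)
    qed
    then have "(\<lambda>m. ?Y (Suc m) x) \<longlonglongrightarrow> (1/2) *\<^sub>R (f x + D (D x))"
      unfolding sqrt_iter.simps by (intro tendsto_intros)
    moreover have "(\<lambda>m. ?Y (Suc m) x) \<longlonglongrightarrow> D x"
      using lim[OF x] LIMSEQ_Suc by blast
    ultimately have "D x = (1/2) *\<^sub>R (f x + D (D x))" by (rule LIMSEQ_unique[rotated])
    then have "2 *\<^sub>R D x = 2 *\<^sub>R (1/2) *\<^sub>R (f x + D (D x))" by (rule arg_cong)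
    then show ?thesis by simp
  qed
  have comm: "commuting g D" if g: "adjoint_pair g g'" "commuting g f" for g g'
    unfolding commuting_def
  proof
    fix x assume x: "x \<in> E"
    obtain K where K: "0 < K" "\<And>x. x \<in> E \<Longrightarrow> norm (g x) \<le> K * norm x"
      using adjoint_pair_bound[OF g(1)] by metis
    have 1: "(\<lambda>m. ?Y m (g x)) \<longlonglongrightarrow> D (g x)"
      using lim adjoint_pairD[OF g(1)] x by blast
    have "norm (?Y m (g x) - g (D x)) \<le> K * norm (?Y m x - D x)" for m
    proof -
      have "?Y m (g x) = g (?Y m x)"
        using sqrt_iter_commute[OF adjoint_pair_rlinear[OF g(1)] _ x, of m] g(2) by (simp add: commuting_def)
      then show ?thesis
        using K(2)[of "?Y m x - D x"] lim[OF x] sqrt_iter_in[OF x] by (simp add: adjoint_pair_linear[OF g(1)])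
    qed
    moreover have "(\<lambda>m. K * norm (?Y m x - D x)) \<longlonglongrightarrow> 0"
      using tendsto_mult_right_zero[OF tendsto_norm_zero[OF LIM_zero[OF conjunct1[OF lim[OF x]]]]] .
    ultimately have "(\<lambda>m. ?Y m (g x)) \<longlonglongrightarrow> g (D x)" by (rule tendsto_norm_diff_bound)
    with 1 show "g (D x) = D (g x)" by (rule LIMSEQ_unique[rotated])
  qed
  have rate: "norm (D x - ?Y m x) \<le> (1 - sqrt_coeff m) * norm x" if x: "x \<in> E" for x m
  proof (rule LIMSEQ_le)
    show "(\<lambda>k. norm (?Y k x - ?Y m x)) \<longlonglongrightarrow> norm (D x - ?Y m x)"
      using lim[OF x] by (intro tendsto_intros) auto
    show "(\<lambda>k. (sqrt_coeff k - sqrt_coeff m) * norm x) \<longlonglongrightarrow> (1 - sqrt_coeff m) * norm x"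
      by (intro tendsto_intros sqrt_coeff_tendsto)
    show "\<exists>N. \<forall>k\<ge>N. norm (?Y k x - ?Y m x) \<le> (sqrt_coeff k - sqrt_coeff m) * norm x"
      by (rule exI[of _ m]) (intro allI impI nrm_sqrt_iter_diff[OF x])
  qed
  show thesis
    by (rule that[OF D D_le DD comm conjunct1[OF lim] rate])
qed

end

lemma norm_divideR_le:
  fixes y :: "'a::real_normed_vector"
  shows "0 < t \<Longrightarrow> norm y \<le> t * n \<Longrightarrow> norm ((1 / t) *\<^sub>R y) \<le> n"
  by (simp add: divide_le_eq mult.commute)

section \<open>Positive operators, their square roots, and the positivity of an adjoint times its
  operator\<close>

context hilbert_module
begin

text \<open>With this notion the positive operators visibly form a cone, and scaling by 1 / t leads
  straight to the square root iteration. The difficult part becomes that squares, and products of an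
  adjoint with its operator, are positive.\<close>

definition positive_operator :: "('e \<Rightarrow> 'e) \<Rightarrow> bool"
  where "positive_operator f \<longleftrightarrow> selfadjoint f \<and> (\<exists>t\<ge>0. \<forall>x\<in>E. norm (t *\<^sub>R x - f x) \<le> t * norm x)"

lemma positive_operator_selfadjoint: "positive_operator f \<Longrightarrow> selfadjoint f"
  by (simp add: positive_operator_def)

lemma positive_operatorE:
  assumes "positive_operator f"
  obtains t where "0 < t" "0 \<le> t" "t0 \<le> t" "\<And>x. x \<in> E \<Longrightarrow> norm (t *\<^sub>R x - f x) \<le> t * norm x"
proof -
  obtain s where s: "0 \<le> s" "\<And>x. x \<in> E \<Longrightarrow> norm (s *\<^sub>R x - f x) \<le> s * norm x"
    using assms unfolding positive_operator_def by blast
  define t where "t = s + (\<bar>t0\<bar> + 1)"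
  have "norm (t *\<^sub>R x - f x) \<le> t * norm x" if "x \<in> E" for x
  proof -
    have eq: "t *\<^sub>R x - f x = (s *\<^sub>R x - f x) + (\<bar>t0\<bar> + 1) *\<^sub>R x"
      by (simp add: t_def algebra_simps)
    have "norm ((\<bar>t0\<bar> + 1) *\<^sub>R x) = (\<bar>t0\<bar> + 1) * norm x" by simp
    then show ?thesis
      using norm_triangle_ineq[of "s *\<^sub>R x - f x" "(\<bar>t0\<bar> + 1) *\<^sub>R x"] s(2)[OF that]
      unfolding eq by (simp add: t_def distrib_right)
  qed
  moreover have "0 < t" "t0 \<le> t" using s(1) by (auto simp: t_def)
  ultimately show thesis using that[of t] by simp
qed

lemma positive_operator_cong:
  assumes "positive_operator f" "\<And>x. x \<in> E \<Longrightarrow> f x = g x"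
  shows "positive_operator g"
  using assms adjoint_pair_cong[of f f g g] unfolding positive_operator_def by simp

lemma positive_operator_add:
  assumes "positive_operator f" "positive_operator g"
  shows "positive_operator (\<lambda>x. f x + g x)"
proof -
  obtain s where s: "0 \<le> s" "\<And>x. x \<in> E \<Longrightarrow> norm (s *\<^sub>R x - f x) \<le> s * norm x"
    using assms(1) unfolding positive_operator_def by blast
  obtain t where t: "0 \<le> t" "\<And>x. x \<in> E \<Longrightarrow> norm (t *\<^sub>R x - g x) \<le> t * norm x"
    using assms(2) unfolding positive_operator_def by blast
  have "norm ((s + t) *\<^sub>R x - (f x + g x)) \<le> (s + t) * norm x" if "x \<in> E" for x
    using norm_triangle_mono[OF s(2)[OF that] t(2)[OF that]] by (simp add: algebra_simps)
  moreover have "selfadjoint (\<lambda>x. f x + g x)"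
    using assms by (intro adjoint_pair_add) (simp_all add: positive_operator_selfadjoint)
  moreover have "0 \<le> s + t" using s t by simp
  ultimately show ?thesis unfolding positive_operator_def by blast
qed

lemma positive_operator_scaleR:
  assumes "positive_operator f" "0 \<le> r"
  shows "positive_operator (\<lambda>x. r *\<^sub>R f x)"
proof -
  obtain s where s: "0 \<le> s" "\<And>x. x \<in> E \<Longrightarrow> norm (s *\<^sub>R x - f x) \<le> s * norm x"
    using assms(1) unfolding positive_operator_def by blast
  have "norm ((r * s) *\<^sub>R x - r *\<^sub>R f x) \<le> (r * s) * norm x" if "x \<in> E" for x
  proof -
    have "(r * s) *\<^sub>R x - r *\<^sub>R f x = r *\<^sub>R (s *\<^sub>R x - f x)" by (simp add: algebra_simps)
    then show ?thesis using s(2)[OF that] assms(2) by (simp add: mult.assoc mult_left_mono)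
  qed
  moreover have "selfadjoint (\<lambda>x. r *\<^sub>R f x)"
    using assms by (intro adjoint_pair_scaleR) (simp_all add: positive_operator_selfadjoint)
  moreover have "0 \<le> r * s" using s assms by simp
  ultimately show ?thesis unfolding positive_operator_def by blast
qed

lemma positive_operator_complement:
  assumes "selfadjoint f" "0 \<le> K" "\<And>x. x \<in> E \<Longrightarrow> norm (f x) \<le> K * norm x"
  shows "positive_operator (\<lambda>x. K *\<^sub>R x - f x)"
  unfolding positive_operator_def
  using assms adjoint_pair_diff[OF adjoint_pair_scaleR[OF adjoint_pair_id] assms(1)]
  by (auto intro!: exI[of _ K])

text \<open>f = 1 - g / t is a contraction, so \<open>sqrt_of_complement\<close> yields D = 1 - (g /
  t)^(1/2); then R = t^(1/2) (1 - D). It is positive because D is a contraction.\<close>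

lemma positive_operator_sqrt:
  assumes "positive_operator g"
  obtains R where "positive_operator R" "\<And>x. x \<in> E \<Longrightarrow> R (R x) = g x"
    "\<And>h h'. adjoint_pair h h' \<Longrightarrow> commuting h g \<Longrightarrow> commuting h R"
proof -
  note g = positive_operator_selfadjoint[OF assms]
  obtain t where t: "0 < t" "\<And>x. x \<in> E \<Longrightarrow> norm (t *\<^sub>R x - g x) \<le> t * norm x"
    using positive_operatorE[OF assms] by metis
  define f where "f x = x - (1 / t) *\<^sub>R g x" for x
  have f: "selfadjoint f"
    unfolding f_def by (intro adjoint_pair_diff adjoint_pair_id adjoint_pair_scaleR g)
  have contr: "norm (f x) \<le> norm x" if "x \<in> E" for x
  proof -
    have eq: "f x = (1 / t) *\<^sub>R (t *\<^sub>R x - g x)" using t(1) by (simp add: f_def algebra_simps)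
    show ?thesis unfolding eq by (rule norm_divideR_le[OF t(1) t(2)[OF that]])
  qed
  obtain D where D: "selfadjoint D" "\<And>x. x \<in> E \<Longrightarrow> norm (D x) \<le> norm x"
    "\<And>x. x \<in> E \<Longrightarrow> D (D x) = 2 *\<^sub>R D x - f x"
    "\<And>h h'. adjoint_pair h h' \<Longrightarrow> commuting h f \<Longrightarrow> commuting h D"
    using sqrt_of_complement[OF f contr] by metis
  define R where "R x = sqrt t *\<^sub>R (1 *\<^sub>R x - D x)" for x
  note lin = adjoint_pair_linear[OF D(1)] adjoint_pairD[OF D(1)]
  have "positive_operator R"
    unfolding R_def using D t(1)
    by (intro positive_operator_scaleR positive_operator_complement) auto
  moreover have "R (R x) = g x" if "x \<in> E" for x
  proof -
    have "R (R x) = t *\<^sub>R (x - D x - D (x - D x))"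
      using t(1) that by (simp add: R_def lin algebra_simps)
    also have "\<dots> = t *\<^sub>R (x - f x)" using that by (simp add: lin D(3) scaleR_2)
    also have "\<dots> = g x" using t(1) by (simp add: f_def)
    finally show ?thesis .
  qed
  moreover have "commuting h R" if h: "adjoint_pair h h'" "commuting h g" for h h'
  proof -
    have "commuting h f"
      using h(2) by (simp add: commuting_def f_def adjoint_pair_linear[OF h(1)] adjoint_pairD[OF g])
    then have "commuting h D" using D(4) h(1) by blast
    then show ?thesis
      by (simp add: commuting_def R_def adjoint_pair_linear[OF h(1)] adjoint_pairD[OF D(1)])
  qed
  ultimately show thesis using that by blast
qed

text \<open>Seminorms for which q(x)^2 depends on x through \<open>ip x x\<close> alone are
  invariant under unitaries. Allowing any such q, not only the norm, makes the bounds below apply to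
  C*-seminorms and to the norm of a representation.\<close>

definition cstar_compatible :: "('e \<Rightarrow> real) \<Rightarrow> bool"
  where "cstar_compatible q \<longleftrightarrow> (\<forall>x\<in>E. 0 \<le> q x) \<and> (\<forall>x\<in>E. \<forall>y\<in>E. q (x + y) \<le> q x + q y) \<and>
    (\<forall>c. \<forall>x\<in>E. q (c *\<^sub>C x) = cmod c * q x) \<and> (\<exists>P. \<forall>x\<in>E. (q x)\<^sup>2 = P (ip x x))"

lemma cstar_compatible_norm: "cstar_compatible norm"
  unfolding cstar_compatible_def
  by (auto simp: norm_scaleC norm_triangle_ineq norm_ip_self intro!: exI[of _ norm])

text \<open>\<open>v \<plusminus> \<i> r\<close> are unitary, and \<open>r\<close> is a convex combination of scalar multiples of them.\<close>

lemma unitary_part_bound: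
  assumes r: "selfadjoint r" and v: "selfadjoint v" and comm: "commuting r v"
    and sum: "\<And>x. x \<in> E \<Longrightarrow> r (r x) + v (v x) = x"
    and q: "cstar_compatible q" and x: "x \<in> E"
  shows "q (r x) \<le> q x"
proof -
  obtain P where P: "\<And>x. x \<in> E \<Longrightarrow> (q x)\<^sup>2 = P (ip x x)"
    using q unfolding cstar_compatible_def by blast
  have q_nonneg: "0 \<le> q x" and q_add: "y \<in> E \<Longrightarrow> q (x + y) \<le> q x + q y"
    and q_scale: "q (c *\<^sub>C x) = cmod c * q x" if "x \<in> E" for x y c
    using q that unfolding cstar_compatible_def by blast+
  define U where "U x = v x + \<i> *\<^sub>C r x" for x
  define W where "W x = v x + cnj \<i> *\<^sub>C r x" for x
  have UW: "adjoint_pair U W"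
    unfolding U_def W_def by (intro adjoint_pair_add v adjoint_pair_scaleC r)
  note lin = adjoint_pair_linear[OF v] adjoint_pair_linear[OF r] adjoint_pairD[OF v] adjoint_pairD[OF r]
  have rv: "r (v x) = v (r x)" using comm x by (simp add: commuting_def)
  have WU: "W (U x) = x" "U (W x) = x"
    using sum[OF x] x
    by (simp_all add: U_def W_def lin scaleC_add_right scaleC_scaleC rv scaleC_minus_right
        add_ac flip: scaleC_add_left)
  have "(q (U x))\<^sup>2 = (q x)\<^sup>2" "(q (W x))\<^sup>2 = (q x)\<^sup>2"
    using x WU by (simp_all add: P adjoint_pairD[OF UW])
  then have qUW: "q (U x) = q x" "q (W x) = q x"
    using x by (auto simp: q_nonneg adjoint_pairD[OF UW] intro: power2_eq_imp_eq)
  have "r x = (- \<i> / 2) *\<^sub>C U x + (\<i> / 2) *\<^sub>C W x"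
  proof -
    have "(- \<i> / 2) *\<^sub>C U x + (\<i> / 2) *\<^sub>C W x
        = ((- \<i> / 2) + \<i> / 2) *\<^sub>C v x + ((- \<i> / 2) * \<i> + (\<i> / 2) * cnj \<i>) *\<^sub>C r x"
      unfolding U_def W_def scaleC_add_right scaleC_scaleC scaleC_add_left by (simp only: add_ac)
    then show ?thesis by simp
  qed
  then have "q (r x) \<le> q ((- \<i> / 2) *\<^sub>C U x) + q ((\<i> / 2) *\<^sub>C W x)"
    using q_add x adjoint_pairD[OF UW] by simp
  also have "\<dots> = q x" using x qUW by (simp add: q_scale adjoint_pairD[OF UW] norm_divide)
  finally show ?thesis .
qed

text \<open>r = p^(1/2) and v = (1 - p)^(1/2) commute and satisfy r^2 + v^2 = 1, so r is a
  q-contraction by \<open>unitary_part_bound\<close>, and p = r r.\<close>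

lemma positive_operator_bound:
  assumes p: "positive_operator p" and p': "positive_operator (\<lambda>x. x - p x)"
    and q: "cstar_compatible q" and x: "x \<in> E"
  shows "q (p x) \<le> q x"
proof -
  obtain r where r: "positive_operator r" "\<And>x. x \<in> E \<Longrightarrow> r (r x) = p x"
    "\<And>h h'. adjoint_pair h h' \<Longrightarrow> commuting h p \<Longrightarrow> commuting h r"
    using positive_operator_sqrt[OF p] by metis
  obtain v where v: "positive_operator v" "\<And>x. x \<in> E \<Longrightarrow> v (v x) = x - p x"
    "\<And>h h'. adjoint_pair h h' \<Longrightarrow> commuting h (\<lambda>x. x - p x) \<Longrightarrow> commuting h v"
    using positive_operator_sqrt[OF p'] by metis
  note rs = positive_operator_selfadjoint[OF r(1)] and vs = positive_operator_selfadjoint[OF v(1)]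
    and ps = positive_operator_selfadjoint[OF p]
  have "commuting r p"
    using rs by (simp add: commuting_def adjoint_pairD flip: r(2))
  then have "commuting r (\<lambda>x. x - p x)"
    by (simp add: commuting_def adjoint_pair_linear[OF rs] adjoint_pairD[OF ps])
  then have "commuting r v" using v(3) rs by blast
  then have "q (r x) \<le> q x" if "x \<in> E" for x
    using unitary_part_bound[OF rs vs _ _ q that] r(2) v(2) by simp
  from this[of "r x"] this[of x] show ?thesis
    using x r(2) adjoint_pairD[OF rs] by simp
qed

lemma contraction_square_complement:
  assumes h: "selfadjoint h" and contr: "\<And>x. x \<in> E \<Longrightarrow> norm (h x) \<le> norm x"
  obtains v where "selfadjoint v" "\<And>x. x \<in> E \<Longrightarrow> h (h x) + v (v x) = x" "commuting h v"
proof -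
  have "norm (h (h x)) \<le> norm x" if "x \<in> E" for x
    using contr[OF that] contr[of "h x"] that adjoint_pairD[OF h] by simp
  then obtain D where D: "selfadjoint D" "\<And>x. x \<in> E \<Longrightarrow> D (D x) = 2 *\<^sub>R D x - h (h x)"
    "\<And>g g'. adjoint_pair g g' \<Longrightarrow> commuting g (\<lambda>x. h (h x)) \<Longrightarrow> commuting g D"
    using sqrt_of_complement[OF adjoint_pair_compose[OF h h]] by metis
  have "commuting h D" using D(3)[OF h] by (simp add: commuting_def)
  then have "commuting h (\<lambda>x. x - D x)"
    by (simp add: commuting_def adjoint_pair_linear[OF h] adjoint_pairD[OF D(1)])
  moreover have "h (h x) + (x - D x - D (x - D x)) = x" if "x \<in> E" for x
    using that by (simp add: adjoint_pair_linear[OF D(1)] adjoint_pairD[OF D(1)] D(2) scaleR_2)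
  ultimately show thesis
    using that[of "\<lambda>x. x - D x"] adjoint_pair_diff[OF adjoint_pair_id D(1)] by blast
qed

text \<open>h is the imaginary part of the unitary v + i h with v = (1 - h^2)^(1/2), so
  contractivity in the norm passes to q. This is the source of the automatic contractivity of
  representations and C*-seminorms.\<close>

lemma selfadjoint_contraction_compatible:
  assumes "selfadjoint h" "\<And>x. x \<in> E \<Longrightarrow> norm (h x) \<le> norm x" "cstar_compatible q" "x \<in> E"
  shows "q (h x) \<le> q x"
proof -
  obtain v where "selfadjoint v" "\<And>x. x \<in> E \<Longrightarrow> h (h x) + v (v x) = x" "commuting h v"
    using contraction_square_complement[OF assms(1,2)] by blast
  then show ?thesis using unitary_part_bound[OF assms(1)] assms(3,4) by blast
qed

text \<open>Scale h to a contraction k and put v = (1 - k^2)^(1/2). As the real part of a unitary, v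
  is a contraction, so ||1 - k^2|| = ||v^2|| \<le> 1, which is the defining estimate for
  k^2.\<close>

lemma positive_operator_square:
  assumes h: "selfadjoint h"
  shows "positive_operator (\<lambda>x. h (h x))"
proof -
  obtain K where K: "0 < K" "\<And>x. x \<in> E \<Longrightarrow> norm (h x) \<le> K * norm x"
    using adjoint_pair_bound[OF h] by metis
  define k where "k x = (1 / K) *\<^sub>R h x" for x
  have k: "selfadjoint k" unfolding k_def by (intro adjoint_pair_scaleR h)
  have "norm (k x) \<le> norm x" if "x \<in> E" for x
    using K(1) K(2)[OF that] by (simp add: k_def field_simps)
  then obtain v where v: "selfadjoint v" "\<And>x. x \<in> E \<Longrightarrow> k (k x) + v (v x) = x" "commuting k v"
    using contraction_square_complement[OF k] by blast
  have vk: "commuting v k" and "\<And>x. x \<in> E \<Longrightarrow> v (v x) + k (k x) = x"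
    using v by (simp_all add: commuting_def add.commute)
  then have v_le: "norm (v x) \<le> norm x" if "x \<in> E" for x
    using unitary_part_bound[OF v(1) k _ _ cstar_compatible_norm that] by blast
  have "norm (1 *\<^sub>R x - k (k x)) \<le> 1 * norm x" if "x \<in> E" for x
  proof -
    have "1 *\<^sub>R x - k (k x) = v (v x)" using v(2)[OF that] by (simp add: algebra_simps)
    then show ?thesis using v_le[of "v x"] v_le[OF that] that adjoint_pairD[OF v(1)] by simp
  qed
  then have "positive_operator (\<lambda>x. k (k x))"
    using adjoint_pair_compose[OF k k] unfolding positive_operator_def by (auto intro!: exI[of _ 1])
  from positive_operator_scaleR[OF this, of "K\<^sup>2"] show ?thesis
    by (rule positive_operator_cong)
      (use K(1) in \<open>simp_all add: k_def adjoint_pair_linear[OF h] adjoint_pairD[OF h] power2_eq_square\<close>)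
qed

text \<open>Powers of \<open>1 - c\<^sup>* c\<close> grow at most linearly, so the C*-identity makes it a contraction.\<close>

lemma positive_operator_flip:
  assumes c: "adjoint_pair c d" and pos: "positive_operator (\<lambda>x. c (d x))"
  shows "positive_operator (\<lambda>x. d (c x))"
proof -
  obtain t where t: "0 < t" "\<And>x. x \<in> E \<Longrightarrow> norm (t *\<^sub>R x - c (d x)) \<le> t * norm x"
    using positive_operatorE[OF pos] by metis
  define s where "s = 1 / t"
  have s: "0 < s" using t(1) by (simp add: s_def)
  obtain K where K: "0 < K" "\<And>x. x \<in> E \<Longrightarrow> norm (c x) \<le> K * norm x" "\<And>x. x \<in> E \<Longrightarrow> norm (d x) \<le> K * norm x"
    using adjoint_pair_bound[OF c] by metis
  define f where "f x = x - s *\<^sub>R d (c x)" for x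
  define F where "F x = x - s *\<^sub>R c (d x)" for x
  note lin = adjoint_pair_linear[OF c] adjoint_pair_linear[OF adjoint_pair_sym[OF c]] adjoint_pairD[OF c]
  have f: "selfadjoint f" and F: "selfadjoint F"
    unfolding f_def F_def
    by (rule adjoint_pair_diff[OF adjoint_pair_id adjoint_pair_scaleR[OF
          adjoint_pair_compose[OF adjoint_pair_sym[OF c] c]]])
      (rule adjoint_pair_diff[OF adjoint_pair_id adjoint_pair_scaleR[OF
          adjoint_pair_compose[OF c adjoint_pair_sym[OF c]]]])
  have F_le: "norm (F x) \<le> norm x" if "x \<in> E" for x
  proof -
    have eq: "F x = s *\<^sub>R (t *\<^sub>R x - c (d x))" using t(1) by (simp add: F_def s_def algebra_simps)
    show ?thesis unfolding eq s_def by (rule norm_divideR_le[OF t(1) t(2)[OF that]])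
  qed
  note fp = adjoint_pairD(1)[OF selfadjoint_power[OF f]] and Fp = adjoint_pairD(1)[OF selfadjoint_power[OF F]]
  have Fm_le: "norm ((F ^^ m) x) \<le> norm x" if "x \<in> E" for x m
  proof (induction m)
    case (Suc m)
    then show ?case using F_le[OF Fp[OF that, of m]] by simp
  qed simp
  \<comment> \<open>With f = 1 - s d c and F = 1 - s c d, the relation f d = d F gives f^(m+1) = f^m
    - s d F^m c. As F is a contraction, each step adds at most s K^2 ||x||.\<close>
  have fd: "f (d x) = d (F x)" if "x \<in> E" for x
    using that by (simp add: f_def F_def lin)
  have fmd: "(f ^^ m) (d x) = d ((F ^^ m) x)" if "x \<in> E" for x m
    by (induction m) (simp_all add: fd Fp that)
  have fm_le: "norm ((f ^^ m) x) \<le> (1 + real m * (s * K * K)) * norm x" if x: "x \<in> E" for x m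
  proof (induction m)
    case (Suc m)
    have "(f ^^ Suc m) x = (f ^^ m) (x - s *\<^sub>R d (c x))"
      by (simp only: funpow_Suc_right o_def f_def[of x])
    also have "\<dots> = (f ^^ m) x - s *\<^sub>R d ((F ^^ m) (c x))"
      using x by (simp add: adjoint_pair_linear[OF selfadjoint_power[OF f]] lin fmd)
    finally have eq: "(f ^^ Suc m) x = (f ^^ m) x - s *\<^sub>R d ((F ^^ m) (c x))" .
    have "norm (d ((F ^^ m) (c x))) \<le> K * norm ((F ^^ m) (c x))"
      using K(3) Fp x by (simp add: lin)
    also have "\<dots> \<le> K * norm (c x)" using Fm_le[of "c x" m] K(1) x by (simp add: lin)
    also have "\<dots> \<le> K * (K * norm x)" using K(1) K(2)[OF x] by simp
    finally have "norm (s *\<^sub>R d ((F ^^ m) (c x))) \<le> s * (K * (K * norm x))"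
      using s by simp
    then show ?case
      unfolding eq using Suc norm_triangle_ineq4[of "(f ^^ m) x" "s *\<^sub>R d ((F ^^ m) (c x))"]
      by (simp add: algebra_simps)
  qed simp
  have "norm (f x) \<le> norm x" if x: "x \<in> E" for x
  proof -
    define a where "a k = norm ((f ^^ (2 ^ k)) x)" for k :: nat
    \<comment> \<open>\<open>norm_square_le\<close> for f^(2^k) is the Cauchy-Schwarz step; the
      linear growth of the powers enters with ratio r = 1.\<close>
    have "a 0 \<le> norm x * 1"
    proof (rule iterated_cauchy_schwarz)
      show "0 \<le> (1 + s * K * K) * norm x" using s K(1) by simp
      show "(a k)\<^sup>2 \<le> norm x * a (Suc k)" for k
        using norm_square_le[OF selfadjoint_power[OF f] x, of "2 ^ k"]
        by (simp add: a_def mult_2 funpow_add)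
      fix k :: nat
      have "1 + real (2 ^ k) * (s * K * K) \<le> (1 + s * K * K) * 2 ^ k"
        by (simp add: algebra_simps)
      then have "(1 + real (2 ^ k) * (s * K * K)) * norm x \<le> (1 + s * K * K) * 2 ^ k * norm x"
        by (intro mult_right_mono) auto
      with fm_le[OF x, of "2 ^ k"] show "a k \<le> (1 + s * K * K) * norm x * 2 ^ k * 1 ^ (2 ^ k)"
        by (simp add: a_def mult_ac)
    qed (auto simp: a_def)
    then show ?thesis by (simp add: a_def)
  qed
  then have "norm (t *\<^sub>R x - d (c x)) \<le> t * norm x" if "x \<in> E" for x
  proof -
    have "t *\<^sub>R x - d (c x) = t *\<^sub>R f x" using t(1) by (simp add: f_def s_def algebra_simps)
    then show ?thesis using \<open>\<And>x. x \<in> E \<Longrightarrow> norm (f x) \<le> norm x\<close>[OF that] t(1) by simp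
  qed
  moreover have "selfadjoint (\<lambda>x. d (c x))"
    using adjoint_pair_compose[OF adjoint_pair_sym[OF c] c] .
  ultimately show ?thesis using t(1) unfolding positive_operator_def by (auto intro!: exI[of _ t])
qed

text \<open>Then r z lies between 0 and 1 for every r \<ge> 0, whence r ||z x|| \<le> ||x||.\<close>

lemma positive_operator_antisym:
  assumes z: "positive_operator z" and mz: "positive_operator (\<lambda>x. - z x)" and x: "x \<in> E"
  shows "z x = 0"
proof (rule ccontr)
  assume nz: "z x \<noteq> 0"
  have sc: "r * norm (z x) \<le> norm x" if "0 \<le> r" for r
  proof -
    \<comment> \<open>The identity is written as \<open>1 *\<^sub>R x - 0 *\<^sub>R x\<close> to
      match \<open>positive_operator_complement\<close>.\<close>
    have "positive_operator (\<lambda>x. (1 *\<^sub>R x - 0 *\<^sub>R x) + r *\<^sub>R (- z x))"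
      by (intro positive_operator_add positive_operator_complement positive_operator_scaleR mz
          adjoint_pair_scaleR adjoint_pair_id that) auto
    then have "positive_operator (\<lambda>x. x - r *\<^sub>R z x)" by simp
    with positive_operator_scaleR[OF z that] have "norm (r *\<^sub>R z x) \<le> norm x"
      by (rule positive_operator_bound[OF _ _ cstar_compatible_norm x])
    then show ?thesis using that by simp
  qed
  have "(norm x + 1) / norm (z x) * norm (z x) \<le> norm x" by (rule sc) (simp add: add_nonneg_nonneg)
  then show False using nz by simp
qed

text \<open>With \<open>R = |g|\<close> and \<open>z = |g| - g\<close> one has \<open>z g z = - z R z\<close>.\<close>

lemma absolute_value_operator:
  assumes g: "selfadjoint g"
  obtains R z r where "positive_operator R" "selfadjoint z" "selfadjoint r"
    "\<And>x. x \<in> E \<Longrightarrow> z x = R x - g x" "\<And>x. x \<in> E \<Longrightarrow> r (r x) = R x"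
    "\<And>x. x \<in> E \<Longrightarrow> R (z x) = - g (z x)" "\<And>x. x \<in> E \<Longrightarrow> r (z x) = z (r x)"
    "\<And>x. x \<in> E \<Longrightarrow> g (z x) = z (g x)"
    "\<forall>x\<in>E. z (r x) = 0 \<Longrightarrow> \<forall>x\<in>E. z x = 0"
proof -
  obtain R where R: "positive_operator R" "\<And>x. x \<in> E \<Longrightarrow> R (R x) = g (g x)"
    "\<And>h h'. adjoint_pair h h' \<Longrightarrow> commuting h (\<lambda>x. g (g x)) \<Longrightarrow> commuting h R"
    using positive_operator_sqrt[OF positive_operator_square[OF g]] by metis
  obtain r where r: "positive_operator r" "\<And>x. x \<in> E \<Longrightarrow> r (r x) = R x"
    "\<And>h h'. adjoint_pair h h' \<Longrightarrow> commuting h R \<Longrightarrow> commuting h r"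
    using positive_operator_sqrt[OF R(1)] by metis
  define z where "z x = R x - g x" for x
  note Rs = positive_operator_selfadjoint[OF R(1)] and rs = positive_operator_selfadjoint[OF r(1)]
  have z: "selfadjoint z" unfolding z_def by (intro adjoint_pair_diff Rs g)
  note lin = adjoint_pair_linear[OF g] adjoint_pair_linear[OF Rs] adjoint_pair_linear[OF rs]
    adjoint_pairD(1)[OF g] adjoint_pairD(1)[OF Rs] adjoint_pairD(1)[OF rs]
  have gR: "commuting g R" using R(3)[OF g] by (simp add: commuting_def)
  then have gr: "commuting g r" using r(3) g by blast
  have "commuting R r" using r(3)[OF Rs] by (simp add: commuting_def)
  with gr have rz: "r (z x) = z (r x)" if "x \<in> E" for x
    using that by (simp add: z_def commuting_def lin)
  \<comment> \<open>R z = R^2 - R g = g^2 - g R = - g (R - g), because R^2 = g^2 and R commutes with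
    g.\<close>
  have Rz: "R (z x) = - g (z x)" and gz: "g (z x) = z (g x)" if "x \<in> E" for x
    using that gR by (simp_all add: z_def commuting_def lin R(2))
  \<comment> \<open>z r = 0 makes R z = r z r vanish, hence also g z = - R z, and z^2 = R z - g z =
    0.\<close>
  have "z x = 0" if 0: "\<And>x. x \<in> E \<Longrightarrow> z (r x) = 0" and x: "x \<in> E" for x
  proof (rule selfadjoint_square_0[OF z _ x])
    fix x assume x: "x \<in> E"
    have "R (z x) = r (r (z x))" using r(2) x adjoint_pairD[OF z] by simp
    also have "\<dots> = r (z (r x))" using rz x by simp
    also have "\<dots> = 0" using 0 x by (simp add: lin)
    finally have "R (z x) = 0" .
    with Rz[OF x] show "z (z x) = 0" by (simp add: z_def[of "z x"])
  qed
  with rz Rz gz show thesis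
    by (intro that[OF R(1) z rs]) (auto simp: z_def r(2))
qed

text \<open>The square of the self-adjoint operator z r is z R z = - z g z. So both z g z and its
  negative are positive, and antisymmetry forces (z r)^2 = 0.\<close>

lemma positive_operator_of_compression:
  assumes g: "selfadjoint g" and "selfadjoint z" "selfadjoint r"
    and zr: "\<And>x. x \<in> E \<Longrightarrow> r (r x) = R x"
    "\<And>x. x \<in> E \<Longrightarrow> R (z x) = - g (z x)" "\<And>x. x \<in> E \<Longrightarrow> r (z x) = z (r x)"
    and pos: "positive_operator (\<lambda>x. z (g (z x)))" and x: "x \<in> E"
  shows "z (r x) = 0"
proof -
  note D = adjoint_pairD(1)[OF g] adjoint_pairD(1)[OF assms(2)] adjoint_pairD(1)[OF assms(3)]
  have w: "selfadjoint (\<lambda>x. z (r x))"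
    by (rule adjoint_pair_cong[OF adjoint_pair_compose[OF assms(2,3)]]) (simp_all add: zr(3))
  have eq: "z (r (z (r x))) = - z (g (z x))" if "x \<in> E" for x
  proof -
    have "z (r (z (r x))) = z (r (r (z x)))" using that zr(3) D by simp
    also have "\<dots> = z (- g (z x))" using that zr(1,2) D by simp
    finally show ?thesis using that D adjoint_pair_linear[OF assms(2)] by simp
  qed
  have "positive_operator (\<lambda>x. - z (g (z x)))"
    by (rule positive_operator_cong[OF positive_operator_square[OF w]]) (simp add: eq)
  from positive_operator_antisym[OF pos this] have "z (r (z (r y))) = 0" if "y \<in> E" for y
    using eq that by simp
  from selfadjoint_square_0[OF w this x] show ?thesis .
qed

text \<open>It suffices that the negative part of g = b a vanishes. With z = |g| - g and c = a z,
  the operator d c = z g z is minus a square. Since c d + d c is half the sum of the squares of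
  \<open>s\<close> and \<open>u\<close>, c d is a sum of positive operators;
  \<open>positive_operator_flip\<close> makes d c positive too, and the compression lemma gives z r
  = 0, hence z = 0.\<close>

theorem positive_operator_adjoint_self:
  assumes a: "adjoint_pair a b"
  shows "positive_operator (\<lambda>x. b (a x))"
proof -
  define g where "g x = b (a x)" for x
  have g: "selfadjoint g"
    unfolding g_def by (rule adjoint_pair_compose[OF adjoint_pair_sym[OF a] a])
  obtain R z r where Rzr: "positive_operator R" "selfadjoint z" "selfadjoint r"
    "\<And>x. x \<in> E \<Longrightarrow> z x = R x - g x" "\<And>x. x \<in> E \<Longrightarrow> r (r x) = R x"
    "\<And>x. x \<in> E \<Longrightarrow> R (z x) = - g (z x)" "\<And>x. x \<in> E \<Longrightarrow> r (z x) = z (r x)"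
    "\<And>x. x \<in> E \<Longrightarrow> g (z x) = z (g x)"
    "\<forall>x\<in>E. z (r x) = 0 \<Longrightarrow> \<forall>x\<in>E. z x = 0"
    by (rule absolute_value_operator[OF g], rule that; assumption)
  define c where "c x = a (z x)" for x
  define d where "d x = z (b x)" for x
  have cd: "adjoint_pair c d" unfolding c_def d_def by (rule adjoint_pair_compose[OF a Rzr(2)])
  note lin = adjoint_pair_linear[OF cd] adjoint_pair_linear[OF adjoint_pair_sym[OF cd]] adjoint_pairD(1,2)[OF cd]
    adjoint_pair_linear[OF Rzr(2)] adjoint_pair_linear[OF Rzr(3)] adjoint_pairD(1)[OF Rzr(2)]
    adjoint_pairD(1)[OF Rzr(3)] adjoint_pairD(1)[OF g]
  \<comment> \<open>Up to the factors 2 and -2, \<open>s\<close> and \<open>u\<close> are the real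
    and the imaginary part of c.\<close>
  define s where "s x = c x + d x" for x
  define u where "u x = \<i> *\<^sub>C c x + cnj \<i> *\<^sub>C d x" for x
  have s: "selfadjoint s"
    by (rule adjoint_pair_cong[OF adjoint_pair_add[OF cd adjoint_pair_sym[OF cd]]]) (simp_all add: s_def add.commute)
  have u: "selfadjoint u"
    by (rule adjoint_pair_cong[OF adjoint_pair_add[OF adjoint_pair_scaleC[OF cd, of \<i>]
          adjoint_pair_scaleC[OF adjoint_pair_sym[OF cd], of "cnj \<i>"]]]) (simp_all add: u_def add.commute)
  have w: "selfadjoint (\<lambda>x. z (r x))"
    by (rule adjoint_pair_cong[OF adjoint_pair_compose[OF Rzr(2,3)]]) (simp_all add: Rzr(7))
  have dc: "d (c x) = - z (r (z (r x)))" if "x \<in> E" for x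
  proof -
    have "z (r (z (r x))) = z (r (r (z x)))" using that Rzr(7) lin by simp
    also have "\<dots> = z (- g (z x))" using that Rzr(5,6) lin by simp
    finally show ?thesis using that lin by (simp add: c_def d_def g_def)
  qed
  have "s (s x) + u (u x) = 2 *\<^sub>R (c (d x) + d (c x))" if "x \<in> E" for x
    using that by (simp add: s_def u_def lin scaleC_add_right scaleC_scaleC scaleC_minus_right scaleR_2)
  then have "(1 / 2) *\<^sub>R (s (s x) + u (u x)) + z (r (z (r x))) = c (d x)" if "x \<in> E" for x
    using that dc[OF that] by simp
  moreover have "positive_operator (\<lambda>x. (1 / 2) *\<^sub>R (s (s x) + u (u x)) + z (r (z (r x))))"
    by (intro positive_operator_add positive_operator_scaleR positive_operator_square s u w) simp
  ultimately have "positive_operator (\<lambda>x. c (d x))"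
    by (rule positive_operator_cong[rotated]) simp_all
  from positive_operator_flip[OF cd this] have "positive_operator (\<lambda>x. z (g (z x)))"
    by (simp add: c_def d_def g_def)
  from positive_operator_of_compression[OF g Rzr(2,3,5-7) this] have "z (r x) = 0" if "x \<in> E" for x
    using that by blast
  with Rzr(9) have "z x = 0" if "x \<in> E" for x using that by blast
  with Rzr(4) have "R x = g x" if "x \<in> E" for x using that by simp
  from positive_operator_cong[OF Rzr(1) this] show ?thesis by (simp add: g_def)
qed

lemma positive_operator_conj:
  assumes g: "positive_operator g" and a: "adjoint_pair a b"
  shows "positive_operator (\<lambda>x. b (g (a x)))"
proof -
  obtain R where R: "positive_operator R" "\<And>x. x \<in> E \<Longrightarrow> R (R x) = g x"
    using positive_operator_sqrt[OF g] by metis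
  note Rs = positive_operator_selfadjoint[OF R(1)]
  from positive_operator_adjoint_self[OF adjoint_pair_compose[OF Rs a]]
  show ?thesis by (rule positive_operator_cong) (simp add: R(2) adjoint_pairD[OF a])
qed

text \<open>Divide by some L > K and use that operators between 0 and 1 are contractions; then let L
  tend to K. L is strictly larger so that the division makes sense for K = 0.\<close>

lemma positive_operator_monotone:
  assumes p: "positive_operator p" and pq: "positive_operator (\<lambda>x. g x - p x)"
    and K: "\<And>x. x \<in> E \<Longrightarrow> norm (g x) \<le> K * norm x" "0 \<le> K" and x: "x \<in> E"
  shows "norm (p x) \<le> K * norm x"
proof -
  have g: "selfadjoint g"
    by (rule adjoint_pair_cong[OF adjoint_pair_add[OF positive_operator_selfadjoint[OF pq]
            positive_operator_selfadjoint[OF p]]]) simp_all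
  have le: "norm (p x) \<le> L * norm x" if L: "K < L" for L
  proof -
    have L0: "0 < L" using L K by simp
    have "norm (g y) \<le> L * norm y" if "y \<in> E" for y
      using K(1)[OF that] L by (meson less_imp_le mult_right_mono norm_ge_zero order_trans)
    then have "positive_operator (\<lambda>x. (L *\<^sub>R x - g x) + (g x - p x))"
      using L0 by (intro positive_operator_add pq positive_operator_complement g) auto
    from positive_operator_scaleR[OF this, of "1 / L"] L0
    have "positive_operator (\<lambda>x. x - (1 / L) *\<^sub>R p x)" by (simp add: scaleR_diff_right)
    with positive_operator_scaleR[OF p, of "1 / L"] L0 have "norm ((1 / L) *\<^sub>R p x) \<le> norm x"
      by (intro positive_operator_bound[OF _ _ cstar_compatible_norm x]) auto
    then show ?thesis using L0 by (simp add: field_simps)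
  qed
  show ?thesis
  proof (rule field_le_epsilon)
    fix e :: real assume e: "0 < e"
    have "norm (p x) \<le> (K + e / (norm x + 1)) * norm x"
      using e by (intro le) (simp add: add_nonneg_pos)
    also have "\<dots> \<le> K * norm x + e"
      using e by (simp add: algebra_simps divide_simps add_nonneg_pos) (simp add: add_pos_nonneg mult_left_mono)
    finally show "norm (p x) \<le> K * norm x + e" .
  qed
qed

end

section \<open>Powers of 1 - s for s between 0 and 1\<close>

context hilbert_module
begin

lemma positive_operator_id: "positive_operator (\<lambda>x. x)"
  using positive_operator_square[OF adjoint_pair_id] .

lemma positive_operator_power:
  assumes "positive_operator f"
  shows "positive_operator (f ^^ k)"
proof -
  have "positive_operator (f ^^ k) \<and> positive_operator (f ^^ Suc k)"
  proof (induction k)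
    case 0
    then show ?case using assms positive_operator_id by (simp add: id_def)
  next
    case (Suc k)
    have "positive_operator (\<lambda>x. f ((f ^^ k) (f x)))"
      by (rule positive_operator_conj[OF conjunct1[OF Suc] positive_operator_selfadjoint[OF assms]])
    then have "positive_operator (f ^^ Suc (Suc k))" by (simp add: funpow_swap1 o_def)
    with Suc show ?case by blast
  qed
  then show ?thesis ..
qed

text \<open>The operator form of k s (1 - s)^k \<le> 1 - (1 - s)^k \<le> 1. The first inequality is
  \<open>pos3\<close>, by induction: passing from k to k + 1 adds (k + 1) (1 - s)^k s^2 to the
  difference. The decay of order 1 / k of s (1 - s)^k replaces functional calculus in the
  construction of approximate units and factorizations.\<close>

lemma complement_powers:
  assumes s: "positive_operator s" and f: "positive_operator (\<lambda>x. x - s x)" (is "positive_operator ?f")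
  shows complement_power_complement: "positive_operator (\<lambda>x. x - (?f ^^ k) x)"
    and complement_power_decay: "x \<in> E \<Longrightarrow> real k * norm ((?f ^^ k) (s x)) \<le> norm x"
proof -
  note ss = positive_operator_selfadjoint[OF s] and fs = positive_operator_selfadjoint[OF f]
  note fk = selfadjoint_power[OF fs] and pfk = positive_operator_power[OF f]
  obtain r where r: "positive_operator r" "\<And>x. x \<in> E \<Longrightarrow> r (r x) = s x"
    using positive_operator_sqrt[OF s] by metis
  note rs = positive_operator_selfadjoint[OF r(1)]
  have r_f: "r (?f x) = ?f (r x)" if "x \<in> E" for x
    using that by (simp add: adjoint_pair_linear[OF rs] adjoint_pairD[OF rs] flip: r(2))
  have r_fk: "r ((?f ^^ k) x) = (?f ^^ k) (r x)" if "x \<in> E" for x k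
  proof (induction k)
    case (Suc k)
    then show ?case using r_f[of "(?f ^^ k) x"] adjoint_pairD(1)[OF fk] that by simp
  qed simp
  have s_fk: "s ((?f ^^ k) x) = (?f ^^ k) (s x)" if "x \<in> E" for x k
    using that by (simp add: r_fk adjoint_pairD[OF fk] adjoint_pairD[OF rs] flip: r(2))
  \<comment> \<open>(1 - s)^k s = r (1 - s)^k r is a conjugate of a positive operator; likewise (1 -
    s)^k s^2 = s (1 - s)^k s.\<close>
  have pos1: "positive_operator (\<lambda>x. (?f ^^ k) (s x))" for k
    by (rule positive_operator_cong[OF positive_operator_conj[OF pfk rs]])
      (simp add: r_fk adjoint_pairD[OF rs] r(2))
  have pos2: "positive_operator (\<lambda>x. (?f ^^ k) (s (s x)))" for k
    by (rule positive_operator_cong[OF positive_operator_conj[OF pfk ss]])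
      (simp add: s_fk adjoint_pairD[OF ss])
  have pos3: "positive_operator (\<lambda>x. x - (?f ^^ k) x - real k *\<^sub>R (?f ^^ k) (s x))" for k
  proof (induction k)
    case 0
    then show ?case using positive_operator_scaleR[OF positive_operator_id, of 0] by simp
  next
    case (Suc k)
    have S: "(?f ^^ Suc k) x = (?f ^^ k) x - (?f ^^ k) (s x)" if "x \<in> E" for x
      by (simp only: funpow_Suc_right o_def adjoint_pair_linear(5)[OF fk that adjoint_pairD(1)[OF ss that]])
    from positive_operator_add[OF Suc positive_operator_scaleR[OF pos2[of k], of "real (Suc k)"]]
    show ?case
      by (rule positive_operator_cong)
        (simp_all add: S adjoint_pairD[OF ss] algebra_simps del: funpow.simps)
  qed
  have "positive_operator (\<lambda>x. (x - (?f ^^ k) x - real k *\<^sub>R (?f ^^ k) (s x)) + real k *\<^sub>R (?f ^^ k) (s x))"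
    by (intro positive_operator_add pos3 positive_operator_scaleR pos1) simp
  then show "positive_operator (\<lambda>x. x - (?f ^^ k) x)" by simp
  show "real k * norm ((?f ^^ k) (s x)) \<le> norm x" if x: "x \<in> E"
  proof -
    have "positive_operator (\<lambda>x. (x - (?f ^^ k) x - real k *\<^sub>R (?f ^^ k) (s x)) + (?f ^^ k) x)"
      by (intro positive_operator_add pos3 pfk)
    then have "positive_operator (\<lambda>x. x - real k *\<^sub>R (?f ^^ k) (s x))" by simp
    from positive_operator_bound[OF positive_operator_scaleR[OF pos1] this cstar_compatible_norm x]
    show ?thesis by simp
  qed
qed

end

section \<open>C*-algebras on a carrier\<close>

text \<open>A carrier set and explicit operations are needed because the unit fibre of a Fell bundle
  is a C*-algebra without being a type; class instances are the case of the carrier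
  \<open>UNIV\<close>.\<close>

locale cstar_carrier =
  fixes A :: "'a::complex_normed_vector set" and mul :: "'a \<Rightarrow> 'a \<Rightarrow> 'a" (infixl \<open>\<odot>\<close> 70) and st :: "'a \<Rightarrow> 'a"
  assumes csubspace_A: "csubspace A" and complete_A: "complete A"
    and mul_closed [simp]: "x \<in> A \<Longrightarrow> y \<in> A \<Longrightarrow> x \<odot> y \<in> A"
    and mul_linear_left: "y \<in> A \<Longrightarrow> clinear_on A (\<lambda>x. x \<odot> y)"
    and mul_linear_right: "x \<in> A \<Longrightarrow> clinear_on A (\<lambda>y. x \<odot> y)"
    and mul_assoc: "x \<in> A \<Longrightarrow> y \<in> A \<Longrightarrow> z \<in> A \<Longrightarrow> x \<odot> y \<odot> z = x \<odot> (y \<odot> z)"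
    and norm_mul: "x \<in> A \<Longrightarrow> y \<in> A \<Longrightarrow> norm (x \<odot> y) \<le> norm x * norm y"
    and st_closed [simp]: "x \<in> A \<Longrightarrow> st x \<in> A"
    and st_add: "x \<in> A \<Longrightarrow> y \<in> A \<Longrightarrow> st (x + y) = st x + st y"
    and st_scaleC: "x \<in> A \<Longrightarrow> st (c *\<^sub>C x) = cnj c *\<^sub>C st x"
    and st_mul: "x \<in> A \<Longrightarrow> y \<in> A \<Longrightarrow> st (x \<odot> y) = st y \<odot> st x"
    and st_st [simp]: "x \<in> A \<Longrightarrow> st (st x) = x"
    and norm_st [simp]: "x \<in> A \<Longrightarrow> norm (st x) = norm x"
    and norm_st_mul: "x \<in> A \<Longrightarrow> norm (st x \<odot> x) = (norm x)\<^sup>2"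
begin

lemmas mul_bilinear =
  clinear_on_add[OF mul_linear_left] clinear_on_scaleC[OF mul_linear_left]
  clinear_on_scaleR[OF mul_linear_left] clinear_on_uminus[OF mul_linear_left]
  clinear_on_diff[OF mul_linear_left csubspace_A] clinear_on_0[OF mul_linear_left csubspace_A]
  clinear_on_add[OF mul_linear_right] clinear_on_scaleC[OF mul_linear_right]
  clinear_on_scaleR[OF mul_linear_right] clinear_on_uminus[OF mul_linear_right]
  clinear_on_diff[OF mul_linear_right csubspace_A] clinear_on_0[OF mul_linear_right csubspace_A]

sublocale hilbert_module A "\<lambda>x y. st x \<odot> y"
proof
  show "csubspace A" "complete A" by (rule csubspace_A complete_A)+
  show "norm (st x \<odot> y) \<le> norm x * norm y" if "x \<in> A" "y \<in> A" for x y
    using norm_mul[of "st x" y] that by simp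
qed (simp_all add: st_add st_scaleC norm_st_mul mul_bilinear csubspaceD[OF csubspace_A])

lemma st_scaleR: "x \<in> A \<Longrightarrow> st (r *\<^sub>R x) = r *\<^sub>R st x"
  by (simp add: scaleR_scaleC st_scaleC)

lemma st_diff: "x \<in> A \<Longrightarrow> y \<in> A \<Longrightarrow> st (x - y) = st x - st y"
  using st_add[of x "- y"] st_scaleR[of y "- 1"] by simp

lemma adjoint_pair_mul: "a \<in> A \<Longrightarrow> adjoint_pair (\<lambda>x. a \<odot> x) (\<lambda>x. st a \<odot> x)"
  by (rule adjoint_pairI[where K="norm a" and K'="norm a"])
    (auto simp: st_mul mul_assoc intro: norm_mul order_trans[OF norm_mul])

lemma mul_faithful:
  assumes "a \<in> A" "b \<in> A" "\<And>x. x \<in> A \<Longrightarrow> a \<odot> x = b \<odot> x"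
  shows "a = b"
proof -
  have "norm (st (st (a - b)) \<odot> st (a - b)) = 0"
    using assms by (simp add: mul_bilinear)
  then show ?thesis using norm_st_mul[of "st (a - b)"] assms(1,2) by simp
qed

lemma norm_le_mul_bound:
  assumes a: "a \<in> A" and "0 \<le> K" and K: "\<And>x. x \<in> A \<Longrightarrow> norm (a \<odot> x) \<le> K * norm x"
  shows "norm a \<le> K"
proof (cases "a = 0")
  case False
  have "(norm a)\<^sup>2 \<le> K * norm a"
    using K[of "st a"] norm_st_mul[of "st a"] a by simp
  then show ?thesis using False by (simp add: power2_eq_square)
qed (use assms in simp)

definition positive :: "'a \<Rightarrow> bool"
  where "positive a \<longleftrightarrow> a \<in> A \<and> positive_operator (\<lambda>x. a \<odot> x)"

lemma positive_in: "positive a \<Longrightarrow> a \<in> A"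
  by (simp add: positive_def)

lemma selfadjoint_st:
  assumes a: "a \<in> A" and s: "selfadjoint (\<lambda>x. a \<odot> x)"
  shows "st a = a"
proof (rule mul_faithful)
  fix y assume y: "y \<in> A"
  show "st a \<odot> y = a \<odot> y"
  proof (rule ip_ext)
    fix z assume z: "z \<in> A"
    have "st (st a \<odot> y) \<odot> z = st y \<odot> (a \<odot> z)" using a y z by (simp add: st_mul mul_assoc)
    also have "\<dots> = st (a \<odot> y) \<odot> z" using adjoint_pairD(3)[OF s y z] by simp
    finally show "st (st a \<odot> y) \<odot> z = st (a \<odot> y) \<odot> z" .
  qed (use a y in simp_all)
qed (use a in simp_all)

lemma positive_st: "positive a \<Longrightarrow> st a = a"
  using selfadjoint_st positive_operator_selfadjoint unfolding positive_def by blast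

lemma selfadjoint_mul: "a \<in> A \<Longrightarrow> st a = a \<Longrightarrow> selfadjoint (\<lambda>x. a \<odot> x)"
  using adjoint_pair_mul[of a] by simp

lemma positive_add: "positive a \<Longrightarrow> positive b \<Longrightarrow> positive (a + b)"
  unfolding positive_def
  by (auto intro: positive_operator_cong[OF positive_operator_add] simp: mul_bilinear)

lemma positive_scaleR: "positive a \<Longrightarrow> 0 \<le> r \<Longrightarrow> positive (r *\<^sub>R a)"
  unfolding positive_def
  by (auto intro: positive_operator_cong[OF positive_operator_scaleR] simp: mul_bilinear)

lemma positive_0: "positive 0"
  unfolding positive_def
  by (auto intro: positive_operator_cong[OF positive_operator_scaleR[OF positive_operator_id, of 0]]
      simp: mul_bilinear)

lemma positive_sum: "(\<And>i. i \<in> I \<Longrightarrow> positive (f i)) \<Longrightarrow> positive (sum f I)"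
  by (induction I rule: infinite_finite_induct) (auto intro: positive_0 positive_add)

lemma positive_st_mul: "a \<in> A \<Longrightarrow> positive (st a \<odot> a)"
  unfolding positive_def
  using positive_operator_adjoint_self[OF adjoint_pair_mul, of a]
  by (auto intro: positive_operator_cong simp: mul_assoc)

text \<open>Turns inequalities between operators into inequalities between elements: x^* g x = (R
  x)^* (R x) with R the root of g.\<close>

lemma positive_operator_ip:
  assumes "positive_operator g" "x \<in> A"
  shows "positive (st x \<odot> g x)"
proof -
  obtain R where R: "positive_operator R" "\<And>x. x \<in> A \<Longrightarrow> R (R x) = g x"
    using positive_operator_sqrt[OF assms(1)] by metis
  note Rs = adjoint_pairD[OF positive_operator_selfadjoint[OF R(1)]]
  have "st x \<odot> g x = st (R x) \<odot> R x"
    using Rs(3)[of x "R x"] Rs(1)[OF assms(2)] R(2)[OF assms(2)] assms(2) by simp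
  then show ?thesis using positive_st_mul Rs(1)[OF assms(2)] by simp
qed

lemma positive_norm_mono:
  assumes a: "positive a" and ba: "positive (b - a)"
  shows "norm a \<le> norm b"
proof -
  note aA = positive_in[OF a]
  have bA: "b \<in> A" using positive_in[OF positive_add[OF ba a]] by simp
  have "positive_operator (\<lambda>x. b \<odot> x - a \<odot> x)"
    using ba unfolding positive_def
    by (auto intro: positive_operator_cong simp: mul_bilinear aA bA)
  with a have "norm (a \<odot> x) \<le> norm b * norm x" if "x \<in> A" for x
    unfolding positive_def
    by (intro positive_operator_monotone[of "\<lambda>x. a \<odot> x" "\<lambda>x. b \<odot> x", OF _ _ norm_mul[OF bA] norm_ge_zero that]) simp_all
  from norm_le_mul_bound[OF aA norm_ge_zero this] show ?thesis .
qed

text \<open>Any t \<ge> ||a|| witnesses positivity, since t - a lies between 0 and t. A bounded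
  sequence therefore has a common witness, which makes the positive cone closed
  (\<open>positive_limit\<close>).\<close>

lemma positive_mul_norm_le:
  assumes a: "positive a" and t: "norm a \<le> t" and x: "x \<in> A"
  shows "norm (t *\<^sub>R x - a \<odot> x) \<le> t * norm x"
proof -
  note aA = positive_in[OF a]
  have t0: "0 \<le> t" using t norm_ge_zero order_trans by blast
  have sa: "selfadjoint (\<lambda>x. a \<odot> x)" by (rule selfadjoint_mul[OF aA positive_st[OF a]])
  have le: "norm (a \<odot> x) \<le> t * norm x" if "x \<in> A" for x
    using norm_mul[OF aA that] mult_right_mono[OF t, of "norm x"] by simp
  have 1: "positive_operator (\<lambda>x. t *\<^sub>R x - a \<odot> x)"
    using positive_operator_complement[OF sa t0 le] by simp
  have "positive_operator (\<lambda>x. t *\<^sub>R x - (t *\<^sub>R x - a \<odot> x))"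
    using a unfolding positive_def by simp
  then show ?thesis
    using positive_operator_monotone[OF 1, of "\<lambda>x. t *\<^sub>R x" t x] t0 x by simp
qed

lemma positive_limit:
  assumes pos: "\<And>k. positive (a k)" and lim: "a \<longlonglongrightarrow> l"
  shows "positive l"
proof -
  have lA: "l \<in> A"
    using complete_imp_closed[OF complete_A] lim positive_in[OF pos] closed_sequentially by blast
  have ak: "a k \<in> A" for k using positive_in[OF pos] .
  have lim0: "(\<lambda>k. norm (a k - l)) \<longlonglongrightarrow> 0" by (rule tendsto_norm_zero[OF LIM_zero[OF lim]])
  have "st l = l"
  proof (rule LIMSEQ_unique[OF _ lim])
    show "a \<longlonglongrightarrow> st l"
    proof (rule tendsto_norm_diff_bound[OF _ lim0])
      show "norm (a k - st l) \<le> norm (a k - l)" for k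
        using norm_st[of "a k - l"] positive_st[OF pos, of k] by (simp add: st_diff ak lA)
    qed
  qed
  then have sa: "selfadjoint (\<lambda>x. l \<odot> x)" by (rule selfadjoint_mul[OF lA])
  obtain t where t: "\<And>k. norm (a k) \<le> t"
    using convergent_imp_Bseq[OF convergentI[OF lim]] unfolding Bseq_def by blast
  have t0: "0 \<le> t" using t[of 0] norm_ge_zero order_trans by blast
  have "norm (t *\<^sub>R x - l \<odot> x) \<le> t * norm x" if x: "x \<in> A" for x
  proof (rule LIMSEQ_le_const2)
    have "(\<lambda>k. a k \<odot> x) \<longlonglongrightarrow> l \<odot> x"
    proof (rule tendsto_norm_diff_bound)
      show "norm (a k \<odot> x - l \<odot> x) \<le> norm (a k - l) * norm x" for k
        using norm_mul[of "a k - l" x] by (simp add: ak lA x mul_bilinear)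
      show "(\<lambda>k. norm (a k - l) * norm x) \<longlonglongrightarrow> 0" by (rule tendsto_mult_left_zero[OF lim0])
    qed
    then show "(\<lambda>k. norm (t *\<^sub>R x - a k \<odot> x)) \<longlonglongrightarrow> norm (t *\<^sub>R x - l \<odot> x)"
      by (intro tendsto_intros)
    show "\<exists>N. \<forall>k\<ge>N. norm (t *\<^sub>R x - a k \<odot> x) \<le> t * norm x"
      using positive_mul_norm_le[OF pos t x] by blast
  qed
  then show ?thesis using sa t0 lA unfolding positive_def positive_operator_def by blast
qed

text \<open>The operator root must be shown to be a left multiplication. The iterates for f = 1 - a1
  are \<open>sqrt_coeff m\<close> minus left multiplication by elements \<open>e m\<close>; by the
  uniform rate these form a Cauchy sequence, and in the limit 1 - D is left multiplication by
  l.\<close>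

lemma positive_sqrt:
  assumes a: "positive a"
  obtains r where "positive r" "r \<odot> r = a"
    "\<And>b. b \<in> A \<Longrightarrow> b \<odot> a = a \<odot> b \<Longrightarrow> b \<odot> r = r \<odot> b"
proof -
  note aA = positive_in[OF a]
  define t where "t = norm a + 1"
  have t: "0 < t" "norm a \<le> t" by (simp_all add: t_def add_nonneg_pos)
  define a1 where "a1 = (1 / t) *\<^sub>R a"
  have a1: "a1 \<in> A" "st a1 = a1" "positive a1"
    using aA positive_st[OF a] positive_scaleR[OF a] t(1) by (simp_all add: a1_def st_scaleR)
  have "norm a1 \<le> 1" using t by (simp add: a1_def)
  define f where "f x = x - a1 \<odot> x" for x
  have f: "selfadjoint f"
    unfolding f_def by (intro adjoint_pair_diff adjoint_pair_id selfadjoint_mul a1)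
  have contr: "norm (f x) \<le> norm x" if "x \<in> A" for x
    using positive_mul_norm_le[OF a1(3) \<open>norm a1 \<le> 1\<close> that] by (simp add: f_def)
  obtain D where D: "selfadjoint D" "\<And>x. x \<in> A \<Longrightarrow> norm (D x) \<le> norm x"
    "\<And>x. x \<in> A \<Longrightarrow> D (D x) = 2 *\<^sub>R D x - f x"
    "\<And>h h'. adjoint_pair h h' \<Longrightarrow> commuting h f \<Longrightarrow> commuting h D"
    "\<And>x. x \<in> A \<Longrightarrow> (\<lambda>m. sqrt_iter f m x) \<longlonglongrightarrow> D x"
    "\<And>x m. x \<in> A \<Longrightarrow> norm (D x - sqrt_iter f m x) \<le> (1 - sqrt_coeff m) * norm x"
    using sqrt_of_complement[OF f contr] by metis
  \<comment> \<open>Substituting c - e for Y and 1 - a1 for f in (f + Y^2) / 2 leaves (1 + c^2) / 2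
    minus this expression, where c is \<open>sqrt_coeff m\<close>.\<close>
  define e where "e = rec_nat 0 (\<lambda>m e. (1 / 2) *\<^sub>R (a1 + (2 * sqrt_coeff m) *\<^sub>R e - e \<odot> e))"
  have e_simps: "e 0 = 0" "e (Suc m) = (1 / 2) *\<^sub>R (a1 + (2 * sqrt_coeff m) *\<^sub>R e m - e m \<odot> e m)" for m
    by (simp_all add: e_def)
  have eA: "e m \<in> A" for m
    by (induction m) (simp_all add: e_simps a1)
  have iter: "sqrt_iter f m x = sqrt_coeff m *\<^sub>R x - e m \<odot> x" if "x \<in> A" for m x
    using that
  proof (induction m arbitrary: x)
    case 0
    then show ?case by (simp add: e_simps mul_bilinear)
  next
    case (Suc m)
    let ?c = "sqrt_coeff m" and ?y = "e m \<odot> x"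
    have "sqrt_iter f m (sqrt_iter f m x) = (?c * ?c) *\<^sub>R x - ?c *\<^sub>R ?y - (?c *\<^sub>R ?y - e m \<odot> ?y)"
      using Suc.prems Suc.IH[of "?c *\<^sub>R x - ?y"] by (simp add: Suc.IH eA mul_bilinear scaleR_diff_right)
    then have "sqrt_iter f (Suc m) x = (1 / 2) *\<^sub>R (x + (?c * ?c) *\<^sub>R x)
        - (1 / 2) *\<^sub>R (a1 \<odot> x + (?c *\<^sub>R ?y + ?c *\<^sub>R ?y) - e m \<odot> ?y)"
      by (simp add: f_def flip: scaleR_diff_right)
    also have "?c *\<^sub>R ?y + ?c *\<^sub>R ?y = (2 * ?c) *\<^sub>R ?y"
      by (simp flip: scaleR_add_left)
    also have "(1 / 2) *\<^sub>R (x + (?c * ?c) *\<^sub>R x) = sqrt_coeff (Suc m) *\<^sub>R x"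
      by (simp add: power2_eq_square add_divide_distrib scaleR_add_left scaleR_add_right)
    finally show ?case
      using Suc.prems by (simp add: e_simps eA a1 mul_bilinear mul_assoc)
  qed
  have e_diff: "norm (e m - e k) \<le> 2 * (1 - sqrt_coeff m) + 2 * (1 - sqrt_coeff k)" for m k
  proof (rule norm_le_mul_bound)
    fix x assume x: "x \<in> A"
    \<comment> \<open>Both \<open>e m\<close> and \<open>e k\<close> are compared with 1 - D; each
      of the four terms is at most 1 - \<open>sqrt_coeff\<close> times the norm of x.\<close>
    have eq: "(e m - e k) \<odot> x = ((D x - sqrt_iter f m x) - (D x - sqrt_iter f k x))
        + ((1 - sqrt_coeff k) *\<^sub>R x - (1 - sqrt_coeff m) *\<^sub>R x)"
      using x by (simp add: iter eA mul_bilinear algebra_simps)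
    have n: "norm ((1 - sqrt_coeff i) *\<^sub>R x) = (1 - sqrt_coeff i) * norm x" for i
      using sqrt_coeff_bounds[of i] by simp
    show "norm ((e m - e k) \<odot> x) \<le> (2 * (1 - sqrt_coeff m) + 2 * (1 - sqrt_coeff k)) * norm x"
      unfolding eq using D(6)[OF x, of m] D(6)[OF x, of k] n[of m] n[of k]
        norm_triangle_ineq[of "(D x - sqrt_iter f m x) - (D x - sqrt_iter f k x)" "(1 - sqrt_coeff k) *\<^sub>R x - (1 - sqrt_coeff m) *\<^sub>R x"]
        norm_triangle_ineq4[of "D x - sqrt_iter f m x" "D x - sqrt_iter f k x"]
        norm_triangle_ineq4[of "(1 - sqrt_coeff k) *\<^sub>R x" "(1 - sqrt_coeff m) *\<^sub>R x"]
      by (simp add: algebra_simps)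
  qed (use eA sqrt_coeff_bounds[of m] sqrt_coeff_bounds[of k] in simp_all)
  have "Cauchy e"
  proof (rule metric_CauchyI)
    fix d :: real assume "0 < d"
    then have "0 < d / 8" by simp
    from LIMSEQ_D[OF sqrt_coeff_tendsto this]
    obtain N where N': "\<forall>m\<ge>N. norm (sqrt_coeff m - 1) < d / 8" by blast
    have N: "1 - sqrt_coeff m < d / 8" if "N \<le> m" for m
      using N'[rule_format, OF that] abs_ge_minus_self[of "sqrt_coeff m - 1"] unfolding real_norm_def by linarith
    have "dist (e m) (e k) < d" if "N \<le> m" "N \<le> k" for m k
    proof -
      have "2 * (1 - sqrt_coeff m) + 2 * (1 - sqrt_coeff k) < 2 * (d / 8) + 2 * (d / 8)"
        using N[OF that(1)] N[OF that(2)] by (intro add_strict_mono mult_strict_left_mono) auto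
      also have "\<dots> \<le> d" using \<open>0 < d\<close> by simp
      finally show ?thesis unfolding dist_norm using e_diff[of m k] by (rule le_less_trans[rotated])
    qed
    then show "\<exists>N. \<forall>m\<ge>N. \<forall>n\<ge>N. dist (e m) (e n) < d" by blast
  qed
  then obtain l where l: "l \<in> A" "e \<longlonglongrightarrow> l"
    using complete_A[unfolded complete_def, rule_format, of e] eA by blast
  have Dl: "D x = x - l \<odot> x" if x: "x \<in> A" for x
  proof (rule LIMSEQ_unique[OF D(5)[OF x]])
    have "(\<lambda>m. e m \<odot> x) \<longlonglongrightarrow> l \<odot> x"
    proof (rule tendsto_norm_diff_bound)
      show "norm (e k \<odot> x - l \<odot> x) \<le> norm (e k - l) * norm x" for k
        using norm_mul[of "e k - l" x] by (simp add: eA l(1) x mul_bilinear)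
      show "(\<lambda>k. norm (e k - l) * norm x) \<longlonglongrightarrow> 0"
        by (rule tendsto_mult_left_zero[OF tendsto_norm_zero[OF LIM_zero[OF l(2)]]])
    qed
    from tendsto_diff[OF tendsto_scaleR[OF sqrt_coeff_tendsto tendsto_const] this]
    show "(\<lambda>m. sqrt_iter f m x) \<longlonglongrightarrow> x - l \<odot> x"
      by (simp add: iter[OF x])
  qed
  define r where "r = sqrt t *\<^sub>R l"
  have rA: "r \<in> A" using l by (simp add: r_def)
  have rx: "r \<odot> x = sqrt t *\<^sub>R (1 *\<^sub>R x - D x)" if "x \<in> A" for x
    using that l(1) by (simp add: r_def mul_bilinear Dl)
  have "positive_operator (\<lambda>x. sqrt t *\<^sub>R (1 *\<^sub>R x - D x))"
    using D t(1) by (intro positive_operator_scaleR positive_operator_complement) auto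
  then have "positive r"
    unfolding positive_def using rA by (auto intro: positive_operator_cong simp: rx)
  moreover have "r \<odot> r = a"
  proof (rule mul_faithful)
    fix x assume x: "x \<in> A"
    note lin = adjoint_pair_linear[OF D(1)] adjoint_pairD(1)[OF D(1)]
    have "r \<odot> r \<odot> x = r \<odot> (r \<odot> x)" using x rA by (simp add: mul_assoc)
    also have "\<dots> = t *\<^sub>R (x - D x - D (x - D x))"
      using x t(1) rA unfolding rx[OF x] by (subst rx) (simp_all add: lin algebra_simps)
    also have "\<dots> = t *\<^sub>R (x - f x)" using x by (simp add: lin D(3) scaleR_2)
    also have "\<dots> = a \<odot> x" using t(1) x aA by (simp add: f_def a1_def mul_bilinear)
    finally show "r \<odot> r \<odot> x = a \<odot> x" .
  qed (use rA aA in simp_all)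
  moreover have "b \<odot> r = r \<odot> b" if b: "b \<in> A" "b \<odot> a = a \<odot> b" for b
  proof (rule mul_faithful)
    note lin = adjoint_pair_linear[OF D(1)] adjoint_pairD(1)[OF D(1)]
    have "b \<odot> (a \<odot> x) = a \<odot> (b \<odot> x)" if "x \<in> A" for x
      using b aA that by (simp flip: mul_assoc)
    then have "commuting (\<lambda>x. b \<odot> x) f"
      using b(1) aA by (simp add: commuting_def f_def a1_def mul_bilinear)
    then have "commuting (\<lambda>x. b \<odot> x) D" using D(4) adjoint_pair_mul[OF b(1)] by blast
    then have "b \<odot> (r \<odot> x) = r \<odot> (b \<odot> x)" if "x \<in> A" for x
      unfolding rx[OF that] rx[OF mul_closed[OF b(1) that]]
      using that b(1) by (simp add: commuting_def mul_bilinear lin)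
    then show "b \<odot> r \<odot> x = r \<odot> b \<odot> x" if "x \<in> A" for x
      using that b(1) rA by (simp add: mul_assoc)
  qed (use rA b in simp_all)
  ultimately show thesis using that by blast
qed

text \<open>For ||x|| \<le> 1 the element h = x^* x acts as a self-adjoint contraction, so q(h)^2 =
  q(h h) \<le> q(h) and q(h) \<le> 1. This is the automatic contractivity of *-homomorphisms, stated
  for seminorms.\<close>

lemma cstar_compatible_contractive:
  assumes q: "cstar_compatible q" and sq: "\<And>x. x \<in> A \<Longrightarrow> (q x)\<^sup>2 = q (st x \<odot> x)" and a: "a \<in> A"
  shows "q a \<le> norm a"
proof -
  have q0: "x \<in> A \<Longrightarrow> 0 \<le> q x" and qs: "x \<in> A \<Longrightarrow> q (r *\<^sub>R x) = \<bar>r\<bar> * q x" for x r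
    using q unfolding cstar_compatible_def by (auto simp: scaleR_scaleC)
  have 1: "q x \<le> 1" if x: "x \<in> A" "norm x \<le> 1" for x
  proof -
    define h where "h = st x \<odot> x"
    have h: "h \<in> A" "st h = h" using x by (simp_all add: h_def st_mul)
    have nh: "norm h \<le> 1" using norm_st_mul[OF x(1)] x(2) by (simp add: h_def power_le_one)
    have "norm (h \<odot> y) \<le> norm y" if "y \<in> A" for y
      using norm_mul[OF h(1) that] mult_right_mono[OF nh, of "norm y"] by simp
    from selfadjoint_contraction_compatible[OF selfadjoint_mul[OF h] this q h(1)]
    have "(q h)\<^sup>2 \<le> q h" using sq[OF h(1)] h(2) by simp
    then have "q h \<le> 1" using q0[OF h(1)] by (cases "q h = 0") (simp_all add: power2_eq_square)
    then have "(q x)\<^sup>2 \<le> 1\<^sup>2" using sq[OF x(1)] by (simp add: h_def)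
    then show ?thesis by (rule power2_le_imp_le) simp
  qed
  show ?thesis
  proof (cases "a = 0")
    case True
    then show ?thesis using qs[of 0 0] by simp
  next
    case False
    then show ?thesis using 1[of "(1 / norm a) *\<^sub>R a"] a by (simp add: qs field_simps)
  qed
qed

lemma norm_le_of_bounded_gram:
  assumes a: "a \<in> A" and pos: "positive_operator (\<lambda>x. x - st a \<odot> (a \<odot> x))"
  shows "norm a \<le> 1"
proof -
  have "positive_operator (\<lambda>x. st a \<odot> (a \<odot> x))"
    using positive_operator_adjoint_self[OF adjoint_pair_mul[OF a]] .
  from positive_operator_bound[OF this pos cstar_compatible_norm]
  have "norm (st a \<odot> a \<odot> x) \<le> 1 * norm x" if "x \<in> A" for x
    using that a by (simp add: mul_assoc)
  from norm_le_mul_bound[OF _ _ this] have "norm (st a \<odot> a) \<le> 1" using a by simp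
  then have "(norm a)\<^sup>2 \<le> 1\<^sup>2" using norm_st_mul[OF a] by simp
  then show ?thesis by (rule power2_le_imp_le) simp
qed

end

sublocale fell_bundle \<subseteq> unit_fibre: cstar_carrier "fibre B 0" "fmult B 0 0" "fstar B 0"
proof
  fix x y z :: 'b and c :: complex
  show "csubspace (fibre B 0)" "complete (fibre B 0)" by (rule fibre_csubspace fibre_complete)+
  assume x: "x \<in> fibre B 0"
  show "fstar B 0 x \<in> fibre B 0" using fstar_closed[OF x] by simp
  show "fstar B 0 (c *\<^sub>C x) = cnj c *\<^sub>C fstar B 0 x" by (rule fstar_scaleC[OF x])
  show "fstar B 0 (fstar B 0 x) = x" using fstar_fstar[OF x] by simp
  show "norm (fstar B 0 x) = norm x" by (rule norm_fstar[OF x])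
  show "norm (fmult B 0 0 (fstar B 0 x) x) = (norm x)\<^sup>2" using norm_fstar_fmult[OF x] by simp
  show "clinear_on (fibre B 0) (\<lambda>y. fmult B 0 0 x y)" by (rule fmult_linear_right[OF x])
  show "clinear_on (fibre B 0) (\<lambda>y. fmult B 0 0 y x)" by (rule fmult_linear_left[OF x])
  assume y: "y \<in> fibre B 0"
  show "fmult B 0 0 x y \<in> fibre B 0" using fmult_closed[OF x y] by simp
  show "norm (fmult B 0 0 x y) \<le> norm x * norm y" by (rule norm_fmult[OF x y])
  show "fstar B 0 (x + y) = fstar B 0 x + fstar B 0 y" by (rule fstar_add[OF x y])
  show "fstar B 0 (fmult B 0 0 x y) = fmult B 0 0 (fstar B 0 y) (fstar B 0 x)"
    using fstar_fmult[OF x y] by simp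
  assume z: "z \<in> fibre B 0"
  show "fmult B 0 0 (fmult B 0 0 x y) z = fmult B 0 0 x (fmult B 0 0 y z)"
    using fmult_assoc[OF x y z] by simp
qed

lemma norm_adj [simp]: "norm (adj (x::'a::cstar_algebra)) = norm x"
proof -
  have le: "norm y \<le> norm (adj y)" for y :: 'a
    using norm_mult_ineq[of "adj y" y] cstar_identity[of y]
    by (cases "y = 0") (simp_all add: power2_eq_square)
  show ?thesis using le[of x] le[of "adj x"] by (simp add: adj_adj)
qed

interpretation cstar: cstar_carrier UNIV "(*)" "adj :: 'a::cstar_algebra \<Rightarrow> 'a"
  by unfold_locales
    (auto simp: clinear_on_def mult_scaleC_left mult_scaleC_right distrib_left distrib_right mult.assoc
      norm_mult_ineq adj_add adj_scaleC adj_mult adj_adj cstar_identity complete_UNIV)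

section \<open>Operators on Hilbert spaces\<close>

lemma cinner_add_right: "cinner z (x + y) = cinner z x + cinner z (y::'h::complex_hilbert)"
  by (subst (1 2 3) cinner_commute) (simp add: cinner_add_left)

lemma cinner_scaleC_right: "cinner x (c *\<^sub>C y) = cnj c * cinner x (y::'h::complex_hilbert)"
  by (subst (1 2) cinner_commute) (simp add: cinner_scaleC_left)

lemma cinner_scaleR_left: "cinner (r *\<^sub>R x) y = complex_of_real r * cinner x (y::'h::complex_hilbert)"
  and cinner_scaleR_right: "cinner x (r *\<^sub>R y) = complex_of_real r * cinner x (y::'h::complex_hilbert)"
  by (simp_all add: scaleR_scaleC cinner_scaleC_left cinner_scaleC_right)

lemma cinner_uminus_left: "cinner (- x) y = - cinner x (y::'h::complex_hilbert)"
  and cinner_uminus_right: "cinner x (- y) = - cinner x (y::'h::complex_hilbert)"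
  using cinner_scaleC_left[of "- 1" x y] cinner_scaleC_right[of x "- 1" y] by simp_all

lemma cinner_diff_left: "cinner (x - y) z = cinner x z - cinner y (z::'h::complex_hilbert)"
  and cinner_diff_right: "cinner z (x - y) = cinner z x - cinner z (y::'h::complex_hilbert)"
  using cinner_add_left[of x "- y" z] cinner_add_right[of z x "- y"]
  by (simp_all add: cinner_uminus_left cinner_uminus_right)

lemma cinner_0_left [simp]: "cinner 0 (x::'h::complex_hilbert) = 0"
  and cinner_0_right [simp]: "cinner (x::'h::complex_hilbert) 0 = 0"
  using cinner_diff_left[of x x x] cinner_diff_right[of x x x] by simp_all

lemma cinner_sum_left: "cinner (\<Sum>i\<in>I. f i) (x::'h::complex_hilbert) = (\<Sum>i\<in>I. cinner (f i) x)"
  and cinner_sum_right: "cinner (x::'h::complex_hilbert) (\<Sum>i\<in>I. f i) = (\<Sum>i\<in>I. cinner x (f i))"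
  by (induction I rule: infinite_finite_induct) (simp_all add: cinner_add_left cinner_add_right)

lemma cinner_ext_right: "(\<And>z. cinner z x = cinner z y) \<Longrightarrow> x = (y::'h::complex_hilbert)"
  using cinner_self[of "x - y"] by (simp add: cinner_diff_right)

lemma cinner_Cauchy_Schwarz: "cmod (cinner x y) \<le> norm x * norm (y::'h::complex_hilbert)"
proof (cases "y = 0")
  case False
  define c where "c = cinner x y"
  define z where "z = (norm y)\<^sup>2 *\<^sub>R x - c *\<^sub>C y"
  have yx: "cinner y x = cnj c" unfolding c_def by (rule cinner_commute)
  have "complex_of_real ((norm z)\<^sup>2)
      = complex_of_real ((norm y)\<^sup>2 * ((norm y)\<^sup>2 * (norm x)\<^sup>2 - (cmod c)\<^sup>2))"
    unfolding cinner_self[symmetric] z_def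
    by (simp add: cinner_diff_left cinner_diff_right cinner_scaleR_left cinner_scaleR_right
        cinner_scaleC_left cinner_scaleC_right cinner_self[of x] cinner_self[of y] yx c_def[symmetric] complex_norm_square
        algebra_simps del: of_real_power) (simp flip: of_real_mult power_add)
  then have "0 \<le> (norm y)\<^sup>2 * ((norm y)\<^sup>2 * (norm x)\<^sup>2 - (cmod c)\<^sup>2)"
    by (metis of_real_eq_iff zero_le_power2)
  then have "(cmod c)\<^sup>2 \<le> (norm x * norm y)\<^sup>2"
    using False by (simp add: zero_le_mult_iff power_mult_distrib mult.commute)
  then show ?thesis unfolding c_def by (rule power2_le_imp_le) simp
qed simp

lemma adjoint_operator_norms:
  fixes S T :: "'h::complex_hilbert \<Rightarrow>\<^sub>L 'h"
  assumes adj: "\<And>\<xi> \<eta>. cinner (T \<xi>) \<eta> = cinner \<xi> (S \<eta>)"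
  shows "norm S = norm T" and "norm (S o\<^sub>L T) = (norm T)\<^sup>2"
proof -
  have le: "norm S' \<le> norm T'"
    if "\<And>\<xi> \<eta>. cinner (T' \<xi>) \<eta> = cinner \<xi> (S' \<eta>)" for S' T' :: "'h \<Rightarrow>\<^sub>L 'h"
  proof (rule norm_blinfun_bound)
    fix \<eta>
    have "complex_of_real ((norm (S' \<eta>))\<^sup>2) = cinner (T' (S' \<eta>)) \<eta>"
      by (simp only: that cinner_self)
    then have "(norm (S' \<eta>))\<^sup>2 = cmod (cinner (T' (S' \<eta>)) \<eta>)"
      by (metis norm_of_real abs_of_nonneg zero_le_power2)
    also have "\<dots> \<le> norm (T' (S' \<eta>)) * norm \<eta>" by (rule cinner_Cauchy_Schwarz)
    also have "\<dots> \<le> norm T' * norm (S' \<eta>) * norm \<eta>"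
      by (intro mult_right_mono norm_blinfun) simp
    finally have "norm (S' \<eta>) * norm (S' \<eta>) \<le> norm (S' \<eta>) * (norm T' * norm \<eta>)"
      by (simp add: power2_eq_square mult_ac)
    then show "norm (S' \<eta>) \<le> norm T' * norm \<eta>"
      by (cases "norm (S' \<eta>) = 0") (simp_all add: mult_le_cancel_left)
  qed simp
  have "cinner (S \<xi>) \<eta> = cinner \<xi> (T \<eta>)" for \<xi> \<eta>
    by (subst cinner_commute) (simp add: adj[symmetric] flip: cinner_commute)
  then show ST: "norm S = norm T" using le[of T S] le[of S T] adj by (simp add: antisym)
  have "norm T \<le> sqrt (norm (S o\<^sub>L T))"
  proof (rule norm_blinfun_bound)
    fix \<xi>
    have "complex_of_real ((norm (T \<xi>))\<^sup>2) = cinner \<xi> ((S o\<^sub>L T) \<xi>)"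
      by (simp add: adj[symmetric] cinner_self)
    then have "(norm (T \<xi>))\<^sup>2 = cmod (cinner \<xi> ((S o\<^sub>L T) \<xi>))"
      by (metis norm_of_real abs_of_nonneg zero_le_power2)
    also have "\<dots> \<le> norm \<xi> * norm ((S o\<^sub>L T) \<xi>)" by (rule cinner_Cauchy_Schwarz)
    also have "\<dots> \<le> norm \<xi> * (norm (S o\<^sub>L T) * norm \<xi>)"
      by (intro mult_left_mono norm_blinfun) simp
    also have "\<dots> = (sqrt (norm (S o\<^sub>L T)) * norm \<xi>)\<^sup>2"
      by (simp add: power_mult_distrib) (simp add: power2_eq_square)
    finally show "norm (T \<xi>) \<le> sqrt (norm (S o\<^sub>L T)) * norm \<xi>"
      by (rule power2_le_imp_le) simp
  qed simp
  then have "(norm T)\<^sup>2 \<le> norm (S o\<^sub>L T)"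
    by (metis norm_ge_zero power_mono real_sqrt_pow2)
  moreover have "norm (S o\<^sub>L T) \<le> norm T * norm T"
    using norm_blinfun_compose[of S T] ST by simp
  ultimately show "norm (S o\<^sub>L T) = (norm T)\<^sup>2" by (simp add: power2_eq_square)
qed

section \<open>Faithful representations are isometric\<close>

locale fell_representation = fell_bundle B
  for B :: "('g::group_add, 'b::complex_normed_vector) bundle_data" +
  fixes \<pi> :: "'g \<Rightarrow> 'b \<Rightarrow> ('h::complex_hilbert \<Rightarrow>\<^sub>L 'h)"
  assumes representation: "representation B \<pi>"
begin

lemma rep_linear: "clinear_on (fibre B g) (\<pi> g)"
  and rep_bounded_ops: "x \<in> fibre B g \<Longrightarrow> \<pi> g x \<in> bounded_ops"
  and rep_mult: "x \<in> fibre B g \<Longrightarrow> y \<in> fibre B h \<Longrightarrow> \<pi> g x o\<^sub>L \<pi> h y = \<pi> (g + h) (fmult B g h x y)"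
  and rep_adjoint: "x \<in> fibre B g \<Longrightarrow> cinner (\<pi> g x \<xi>) \<eta> = cinner \<xi> (\<pi> (- g) (fstar B g x) \<eta>)"
  using representation unfolding representation_def by blast+

lemmas rep_simps = clinear_on_add[OF rep_linear] clinear_on_scaleC[OF rep_linear]
  clinear_on_scaleR[OF rep_linear] clinear_on_0[OF rep_linear fibre_csubspace]
  clinear_on_diff[OF rep_linear fibre_csubspace] clinear_on_uminus[OF rep_linear]

lemma rep_mult_apply:
  "x \<in> fibre B g \<Longrightarrow> y \<in> fibre B h \<Longrightarrow> \<pi> (g + h) (fmult B g h x y) \<xi> = \<pi> g x (\<pi> h y \<xi>)"
  by (simp flip: rep_mult)

lemma norm_rep_square:
  "x \<in> fibre B g \<Longrightarrow> (norm (\<pi> g x))\<^sup>2 = norm (\<pi> 0 (fmult B (- g) g (fstar B g x) x))"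
  using adjoint_operator_norms(2)[OF rep_adjoint[of x g]] rep_mult[OF fstar_closed, of x g x g] by simp

lemma norm_rep_unit_fibre_le:
  assumes "x \<in> fibre B 0"
  shows "norm (\<pi> 0 x) \<le> norm x"
proof (rule unit_fibre.cstar_compatible_contractive[where q = "\<lambda>x. norm (\<pi> 0 x)", OF _ _ assms])
  show sq: "(norm (\<pi> 0 x))\<^sup>2 = norm (\<pi> 0 (fmult B 0 0 (fstar B 0 x) x))" if "x \<in> fibre B 0" for x
    using norm_rep_square[OF that] by simp
  show "unit_fibre.cstar_compatible (\<lambda>x. norm (\<pi> 0 x))"
    unfolding unit_fibre.cstar_compatible_def
    by (auto simp: rep_simps norm_scaleC norm_triangle_ineq sq intro!: exI[of _ "\<lambda>y. norm (\<pi> 0 y)"])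
qed

end

locale faithful_fell_representation = fell_representation B \<pi>
  for B :: "('g::group_add, 'b::complex_normed_vector) bundle_data"
    and \<pi> :: "'g \<Rightarrow> 'b \<Rightarrow> ('h::complex_hilbert \<Rightarrow>\<^sub>L 'h)" +
  assumes faithful: "inj_on (\<pi> 0) (fibre B 0)"
begin

lemma rep_unit_fibre_eq_0: "x \<in> fibre B 0 \<Longrightarrow> \<pi> 0 x = 0 \<Longrightarrow> x = 0"
  using faithful rep_simps(4)[of 0] unit_fibre.E_0 unfolding inj_on_def by metis

text \<open>For \<open>g = 1 - a\<^sup>* a\<close> and \<open>z = |g| - g\<close> we have \<open>(|g| + g) z = 0\<close>, a sum of two
  operators that \<open>\<pi>\<close> maps to positive ones.  So \<open>|g| z = 0\<close>, and \<open>g = |g|\<close>.\<close>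

lemma norm_rep_unit_fibre_le_1:
  assumes a: "a \<in> fibre B 0" and le: "norm (\<pi> 0 a) \<le> 1"
  shows "norm a \<le> 1"
proof (rule unit_fibre.norm_le_of_bounded_gram[OF a])
  let ?m = "fmult B 0 0" and ?s = "fstar B 0"
  define g where "g x = x - ?m (?s a) (?m a x)" for x
  have g: "unit_fibre.selfadjoint g"
    unfolding g_def using unit_fibre.adjoint_pair_mul[OF a]
    by (intro unit_fibre.adjoint_pair_diff unit_fibre.adjoint_pair_id)
      (rule unit_fibre.adjoint_pair_compose[OF unit_fibre.adjoint_pair_sym])
  obtain R z r where R: "unit_fibre.positive_operator R" and z: "unit_fibre.selfadjoint z"
    and r: "unit_fibre.selfadjoint r" and zx: "\<And>x. x \<in> fibre B 0 \<Longrightarrow> z x = R x - g x"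
    and rr: "\<And>x. x \<in> fibre B 0 \<Longrightarrow> r (r x) = R x"
    and Rz: "\<And>x. x \<in> fibre B 0 \<Longrightarrow> R (z x) = - g (z x)"
    and rz: "\<And>x. x \<in> fibre B 0 \<Longrightarrow> r (z x) = z (r x)"
    and gz: "\<And>x. x \<in> fibre B 0 \<Longrightarrow> g (z x) = z (g x)"
    and zero: "\<forall>x\<in>fibre B 0. z (r x) = 0 \<Longrightarrow> \<forall>x\<in>fibre B 0. z x = 0"
    by (rule unit_fibre.absolute_value_operator[OF g], rule that; assumption)
  note D = unit_fibre.adjoint_pairD(1)[OF g] unit_fibre.adjoint_pairD(1)[OF z] unit_fibre.adjoint_pairD(1)[OF r]
  have "z (r x) = 0" if x: "x \<in> fibre B 0" for x
  proof -
    \<comment> \<open>\<open>R\<close>, \<open>r\<close> and \<open>g\<close> are operators on the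
      fibre, to which \<pi> does not apply. Hence \<pi> is evaluated at the elements
      \<open>w\<close>, \<open>r w\<close> and \<open>g w\<close>, and adjointness of
      \<open>r\<close> supplies w^* r(r w) = (r w)^* (r w).\<close>
    define w where "w = z x"
    have w: "w \<in> fibre B 0" and rw: "r w \<in> fibre B 0" using x D by (simp_all add: w_def)
    have unit: "cinner (\<pi> 0 u \<xi>) (\<pi> 0 v \<xi>) = cinner (\<pi> 0 (?m (?s v) u) \<xi>) \<xi>"
      if "u \<in> fibre B 0" "v \<in> fibre B 0" for u v \<xi>
      using that rep_adjoint[of "?s v" 0 "\<pi> 0 u \<xi>" \<xi>] rep_mult_apply[of "?s v" 0 u 0 \<xi>] by simp
    have "\<pi> 0 (r w) = 0"
    proof (rule blinfun_eqI)
      fix \<xi>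
      have "cinner (\<pi> 0 (r (r w)) \<xi>) (\<pi> 0 w \<xi>) = cinner (\<pi> 0 (r w) \<xi>) (\<pi> 0 (r w) \<xi>)"
        using unit_fibre.adjoint_pairD(3)[OF r w rw] D w rw by (simp add: unit)
      then have 1: "cinner (\<pi> 0 (r (r w)) \<xi>) (\<pi> 0 w \<xi>) = complex_of_real ((norm (\<pi> 0 (r w) \<xi>))\<^sup>2)"
        by (simp add: cinner_self)
      have "\<pi> 0 (?m (?s a) (?m a w)) \<xi> = \<pi> 0 (?s a) (\<pi> 0 a (\<pi> 0 w \<xi>))"
        using rep_mult_apply[of "?s a" 0 "?m a w" 0 \<xi>] rep_mult_apply[of a 0 w 0 \<xi>] a w by simp
      then have "cinner (\<pi> 0 (g w) \<xi>) (\<pi> 0 w \<xi>)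
          = cinner (\<pi> 0 w \<xi>) (\<pi> 0 w \<xi>) - cinner (\<pi> 0 a (\<pi> 0 w \<xi>)) (\<pi> 0 a (\<pi> 0 w \<xi>))"
        using a w rep_adjoint[of "?s a" 0 "\<pi> 0 a (\<pi> 0 w \<xi>)" "\<pi> 0 w \<xi>"]
        by (simp add: g_def rep_simps blinfun.diff_left cinner_diff_left)
      then have 2: "cinner (\<pi> 0 (g w) \<xi>) (\<pi> 0 w \<xi>)
          = complex_of_real ((norm (\<pi> 0 w \<xi>))\<^sup>2 - (norm (\<pi> 0 a (\<pi> 0 w \<xi>)))\<^sup>2)"
        by (simp add: cinner_self)
      have "norm (\<pi> 0 a (\<pi> 0 w \<xi>)) \<le> norm (\<pi> 0 w \<xi>)"
        using norm_blinfun[of "\<pi> 0 a" "\<pi> 0 w \<xi>"] mult_right_mono[OF le, of "norm (\<pi> 0 w \<xi>)"] by simp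
      then have 3: "(norm (\<pi> 0 a (\<pi> 0 w \<xi>)))\<^sup>2 \<le> (norm (\<pi> 0 w \<xi>))\<^sup>2" by (rule power_mono) simp
      have "r (r w) = - g w" using rr[OF w] Rz[OF x] by (simp add: w_def)
      then have "cinner (\<pi> 0 (r (r w)) \<xi>) (\<pi> 0 w \<xi>) = - cinner (\<pi> 0 (g w) \<xi>) (\<pi> 0 w \<xi>)"
        using D w by (simp add: rep_simps blinfun.minus_left cinner_uminus_left)
      with 1 2 have "complex_of_real ((norm (\<pi> 0 (r w) \<xi>))\<^sup>2)
          = complex_of_real (- ((norm (\<pi> 0 w \<xi>))\<^sup>2 - (norm (\<pi> 0 a (\<pi> 0 w \<xi>)))\<^sup>2))"
        by simp
      then have "(norm (\<pi> 0 (r w) \<xi>))\<^sup>2 = - ((norm (\<pi> 0 w \<xi>))\<^sup>2 - (norm (\<pi> 0 a (\<pi> 0 w \<xi>)))\<^sup>2)"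
        by (simp only: of_real_eq_iff)
      with 3 have "(norm (\<pi> 0 (r w) \<xi>))\<^sup>2 \<le> 0" by linarith
      then show "\<pi> 0 (r w) \<xi> = blinfun_apply 0 \<xi>" by simp
    qed
    then have "r w = 0" using rep_unit_fibre_eq_0 rw by blast
    then show ?thesis using rz[OF x] by (simp add: w_def)
  qed
  with zero have "R x = g x" if "x \<in> fibre B 0" for x using that zx by simp
  from unit_fibre.positive_operator_cong[OF R this]
  show "unit_fibre.positive_operator (\<lambda>x. x - ?m (?s a) (?m a x))" by (simp add: g_def)
qed

lemma norm_rep_unit_fibre:
  assumes a: "a \<in> fibre B 0"
  shows "norm (\<pi> 0 a) = norm a"
proof (rule antisym[OF norm_rep_unit_fibre_le[OF a]])
  show "norm a \<le> norm (\<pi> 0 a)"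
  proof (cases "a = 0")
    case False
    define k where "k = norm (\<pi> 0 a)"
    have k: "0 < k" using False rep_unit_fibre_eq_0[OF a] by (auto simp: k_def)
    have "norm ((1 / k) *\<^sub>R a) \<le> 1"
      using k a by (intro norm_rep_unit_fibre_le_1) (simp_all add: rep_simps k_def[symmetric])
    then show ?thesis using k by (simp add: k_def[symmetric] field_simps)
  qed simp
qed

lemma norm_rep:
  assumes x: "x \<in> fibre B g"
  shows "norm (\<pi> g x) = norm x"
proof -
  have "fmult B (- g) g (fstar B g x) x \<in> fibre B 0"
    using fmult_closed[OF fstar_closed[OF x] x] by simp
  then have "(norm (\<pi> g x))\<^sup>2 = (norm x)\<^sup>2"
    using norm_rep_square[OF x] norm_fstar_fmult[OF x] norm_rep_unit_fibre by simp
  then show ?thesis by (simp add: power2_eq_iff_nonneg)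
qed

lemma inj_on_rep: "inj_on (\<pi> g) (fibre B g)"
proof (rule inj_onI)
  fix x y assume xy: "x \<in> fibre B g" "y \<in> fibre B g" "\<pi> g x = \<pi> g y"
  then have "norm (x - y) = norm (\<pi> g (x - y))"
    using norm_rep[of "x - y" g] csubspace_diff[OF fibre_csubspace] by simp
  then show "x = y" using xy by (simp add: rep_simps)
qed

text \<open>An isometric image of a complete space is complete. It lets limits of matrix polynomials
  be pulled back to the bundle.\<close>

lemma closed_rep_image: "closed (\<pi> g ` fibre B g)"
proof (rule complete_imp_closed)
  show "complete (\<pi> g ` fibre B g)"
    unfolding complete_def
  proof (intro allI impI)
    fix T assume T: "(\<forall>n. T n \<in> \<pi> g ` fibre B g) \<and> Cauchy T"
    then have "\<forall>n. \<exists>x. x \<in> fibre B g \<and> T n = \<pi> g x" by (simp add: image_iff Bex_def)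
    from choice[OF this] obtain x where x: "\<And>n. x n \<in> fibre B g" "\<And>n. T n = \<pi> g (x n)" by blast
    have "dist (T m) (T n) = dist (x m) (x n)" for m n
      using x norm_rep[of "x m - x n" g] csubspace_diff[OF fibre_csubspace, of "x m" g "x n"]
      by (simp add: dist_norm rep_simps)
    with T have "Cauchy x" by (simp add: Cauchy_def)
    then obtain l where l: "l \<in> fibre B g" "x \<longlonglongrightarrow> l"
      using fibre_complete[of g, unfolded complete_def, rule_format, of x] x by blast
    have "T \<longlonglongrightarrow> \<pi> g l"
    proof (rule tendsto_norm_diff_bound)
      show "norm (T n - \<pi> g l) \<le> norm (x n - l)" for n
        using x l norm_rep[of "x n - l" g] csubspace_diff[OF fibre_csubspace, of "x n" g l]
        by (simp add: rep_simps)
      show "(\<lambda>n. norm (x n - l)) \<longlonglongrightarrow> 0" by (rule tendsto_norm_zero[OF LIM_zero[OF l(2)]])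
    qed
    then show "\<exists>l\<in>\<pi> g ` fibre B g. T \<longlonglongrightarrow> l" using l by blast
  qed
qed

end

section \<open>Square roots of matrices\<close>

text \<open>The entries of \<open>sqrt_coeff m - Y\<^sub>m\<close>, where \<open>Y\<^sub>m\<close> is the \<open>m\<close>-th iterate of
  \<^const>\<open>sqrt_iter\<close> at \<open>1 - X\<close>.\<close>

primrec matrix_sqrt_iter ::
    "('x::real_normed_vector \<Rightarrow> 'x \<Rightarrow> 'x) \<Rightarrow> nat \<Rightarrow> (nat \<Rightarrow> nat \<Rightarrow> 'x) \<Rightarrow> nat \<Rightarrow> nat \<Rightarrow> nat \<Rightarrow> 'x"
  where "matrix_sqrt_iter m n X 0 = (\<lambda>i j. 0)"
  | "matrix_sqrt_iter m n X (Suc k) = (\<lambda>i j. (1 / 2) *\<^sub>R (X i j + (2 * sqrt_coeff k) *\<^sub>R matrix_sqrt_iter m n X k i j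
      - (\<Sum>l<n. m (matrix_sqrt_iter m n X k i l) (matrix_sqrt_iter m n X k l j))))"

text \<open>Used for operator matrices on H^n and for matrices over a C*-algebra A acting on A^n;
  hence multiplication, action and tuple norm are parameters. Convergence is stated entrywise for
  explicit polynomials without constant term, so that entries confined to closed subspaces
  compatible with the multiplication stay there in the limit.\<close>

lemma matrix_sqrt:
  fixes m :: "'x::banach \<Rightarrow> 'x \<Rightarrow> 'x" and act :: "'x \<Rightarrow> 'v::real_normed_vector \<Rightarrow> 'v"
    and nrm :: "(nat \<Rightarrow> 'v) \<Rightarrow> real" and X :: "nat \<Rightarrow> nat \<Rightarrow> 'x"
  assumes m: "bounded_bilinear m" and act: "bounded_bilinear act"
    and act_m: "\<And>x y v. act (m x y) v = act x (act y v)"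
    and norm_act: "\<And>x K. 0 \<le> K \<Longrightarrow> (\<And>v. norm (act x v) \<le> K * norm v) \<Longrightarrow> norm x \<le> K"
    and nrm_add: "\<And>u v. nrm (\<lambda>i. u i + v i) \<le> nrm u + nrm v"
    and nrm_scale: "\<And>c u. nrm (\<lambda>i. c *\<^sub>R u i) = \<bar>c\<bar> * nrm u"
    and nrm_unit: "\<And>j v. j < n \<Longrightarrow> nrm (\<lambda>i. if i = j then v else 0) \<le> norm v"
    and nrm_coord: "\<And>i u. i < n \<Longrightarrow> norm (u i) \<le> nrm u"
    and contr: "\<And>u. nrm (\<lambda>i. u i - (\<Sum>j<n. act (X i j) (u j))) \<le> nrm u"
  obtains R where "\<And>i j. i < n \<Longrightarrow> j < n \<Longrightarrow> (\<lambda>k. matrix_sqrt_iter m n X k i j) \<longlonglongrightarrow> R i j"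
    and "\<And>i j. i < n \<Longrightarrow> j < n \<Longrightarrow> (\<Sum>k<n. m (R i k) (R k j)) = X i j"
proof -
  interpret m: bounded_bilinear m by (rule m)
  interpret act: bounded_bilinear act by (rule act)
  let ?e = "matrix_sqrt_iter m n X"
  define f where "f u = (\<lambda>i. u i - (\<Sum>j<n. act (X i j) (u j)))" for u :: "nat \<Rightarrow> 'v"
  interpret contraction UNIV nrm f
  proof
    show "nrm (x + y) \<le> nrm x + nrm y" for x y
      using nrm_add[of x y] by (simp add: plus_fun_def)
    show "nrm (c *\<^sub>R x) = \<bar>c\<bar> * nrm x" for c x
      using nrm_scale[of c x] by (simp add: scaleR_fun_def)
    show "rlinear_on UNIV f"
      by (auto simp: rlinear_on_def f_def fun_eq_iff act.add_right act.scaleR_right sum.distrib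
          scaleR_fun_def scaleR_sum_right scaleR_diff_right)
    show "nrm (f x) \<le> nrm x" for x using contr[of x] by (simp add: f_def)
  qed simp
  have iter: "sqrt_iter f k u i = sqrt_coeff k *\<^sub>R u i - (\<Sum>j<n. act (?e k i j) (u j))" if "i < n" for k u i
    using that
  proof (induction k arbitrary: u i)
    case 0
    then show ?case by (simp add: act.zero_left)
  next
    case (Suc k)
    let ?c = "sqrt_coeff k" and ?v = "\<lambda>i. \<Sum>j<n. act (?e k i j) (u j)"
    have "(\<Sum>j<n. act (?e k i j) (?v j)) = (\<Sum>j<n. \<Sum>l<n. act (m (?e k i j) (?e k j l)) (u l))"
      by (simp add: act_m act.sum_right)
    also have "\<dots> = (\<Sum>l<n. act (\<Sum>j<n. m (?e k i j) (?e k j l)) (u l))"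
      by (subst sum.swap) (simp add: act.sum_left)
    finally have ee: "(\<Sum>j<n. act (?e k i j) (?v j)) = (\<Sum>l<n. act (\<Sum>j<n. m (?e k i j) (?e k j l)) (u l))" .
    have "sqrt_iter f k (sqrt_iter f k u) i
        = ?c *\<^sub>R (?c *\<^sub>R u i - ?v i) - (\<Sum>j<n. act (?e k i j) (?c *\<^sub>R u j - ?v j))"
      using Suc.prems by (simp add: Suc.IH)
    also have "\<dots> = (?c * ?c) *\<^sub>R u i - (2 * ?c) *\<^sub>R ?v i + (\<Sum>j<n. act (?e k i j) (?v j))"
      by (simp add: act.diff_right act.scaleR_right sum_subtractf scaleR_diff_right scaleR_2
          flip: scaleR_sum_right scaleR_scaleR)
    finally have "sqrt_iter f (Suc k) u i = (1 / 2) *\<^sub>R (u i + (?c * ?c) *\<^sub>R u i)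
        - (1 / 2) *\<^sub>R ((\<Sum>j<n. act (X i j) (u j)) + (2 * ?c) *\<^sub>R ?v i - (\<Sum>j<n. act (?e k i j) (?v j)))"
      by (simp add: f_def scaleR_fun_def flip: scaleR_diff_right)
    also have "(1 / 2) *\<^sub>R (u i + (?c * ?c) *\<^sub>R u i) = sqrt_coeff (Suc k) *\<^sub>R u i"
      by (simp add: power2_eq_square add_divide_distrib scaleR_add_left scaleR_add_right)
    finally show ?case
      unfolding ee
      by (simp add: act.diff_left act.add_left act.scaleR_left sum_subtractf sum.distrib
          flip: scaleR_sum_right)
  qed
  have diff: "norm (?e k i j - ?e l i j) \<le> 2 * (sqrt_coeff l - sqrt_coeff k)" if ij: "i < n" "j < n" and kl: "k \<le> l" for i j k l
  proof (rule norm_act)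
    have d: "0 \<le> sqrt_coeff l - sqrt_coeff k" using sqrt_coeff_mono kl by (simp add: incseq_def)
    then show "0 \<le> 2 * (sqrt_coeff l - sqrt_coeff k)" by simp
    fix v
    \<comment> \<open>Column j is probed by the tuple with \<open>v\<close> in place j; the entry at
      i, j applied to \<open>v\<close> is then expressed by a coordinate of the iterates, for which
      the majorant estimate holds.\<close>
    define u where "u = (\<lambda>i. if i = j then v else (0::'v))"
    have e: "act (?e k i j) v = sqrt_coeff k *\<^sub>R u i - sqrt_iter f k u i" for k
    proof -
      have "(\<Sum>j<n. act (?e k i j) (u j)) = (\<Sum>j'<n. if j' = j then act (?e k i j') v else 0)"
        by (rule sum.cong) (auto simp: u_def act.zero_right)
      then show ?thesis using ij by (simp add: iter)
    qed
    have nu: "nrm u \<le> norm v" unfolding u_def by (rule nrm_unit[OF ij(2)])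
    have "act (?e k i j - ?e l i j) v
        = (sqrt_coeff k - sqrt_coeff l) *\<^sub>R u i + (sqrt_iter f l u - sqrt_iter f k u) i"
      unfolding act.diff_left e by (simp add: algebra_simps)
    also have "norm \<dots> \<le> (sqrt_coeff l - sqrt_coeff k) * norm (u i) + norm ((sqrt_iter f l u - sqrt_iter f k u) i)"
      using norm_triangle_ineq[of "(sqrt_coeff k - sqrt_coeff l) *\<^sub>R u i"] d by simp
    also have "norm ((sqrt_iter f l u - sqrt_iter f k u) i) \<le> (sqrt_coeff l - sqrt_coeff k) * nrm u"
      using nrm_coord[OF ij(1)] nrm_sqrt_iter_diff[OF UNIV_I kl, of u] by (rule order_trans)
    also have "(sqrt_coeff l - sqrt_coeff k) * norm (u i) \<le> (sqrt_coeff l - sqrt_coeff k) * norm v"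
      using d by (intro mult_left_mono) (auto simp: u_def)
    also have "(sqrt_coeff l - sqrt_coeff k) * nrm u \<le> (sqrt_coeff l - sqrt_coeff k) * norm v"
      using d nu by (intro mult_left_mono) auto
    finally show "norm (act (?e k i j - ?e l i j) v) \<le> 2 * (sqrt_coeff l - sqrt_coeff k) * norm v"
      by (simp add: algebra_simps)
  qed
  have conv: "convergent (\<lambda>k. ?e k i j)" if ij: "i < n" "j < n" for i j
  proof (rule Cauchy_convergent, rule CauchyI')
    fix d :: real assume "0 < d"
    then have "0 < d / 2" by simp
    from CauchyD[OF sqrt_coeff_Cauchy this]
    obtain N where N: "\<forall>k\<ge>N. \<forall>l\<ge>N. norm (sqrt_coeff k - sqrt_coeff l) < d / 2" by blast
    show "\<exists>M. \<forall>k\<ge>M. \<forall>l>k. dist (?e k i j) (?e l i j) < d"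
    proof (rule exI[of _ N], intro allI impI)
      fix k l assume kl: "N \<le> k" "k < l"
      then have "norm (sqrt_coeff l - sqrt_coeff k) < d / 2" using N by simp
      then have "sqrt_coeff l - sqrt_coeff k < d / 2"
        using abs_ge_self[of "sqrt_coeff l - sqrt_coeff k"] unfolding real_norm_def by linarith
      then have "2 * (sqrt_coeff l - sqrt_coeff k) < d" by (simp add: field_simps)
      then show "dist (?e k i j) (?e l i j) < d"
        using diff[OF ij less_imp_le[OF kl(2)]] unfolding dist_norm by linarith
    qed
  qed
  define R where "R i j = lim (\<lambda>k. ?e k i j)" for i j
  have lim: "(\<lambda>k. ?e k i j) \<longlonglongrightarrow> R i j" if "i < n" "j < n" for i j
    using conv[OF that] by (simp add: R_def convergent_LIMSEQ_iff)
  have "(\<Sum>k<n. m (R i k) (R k j)) = X i j" if ij: "i < n" "j < n" for i j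
  proof -
    have "(\<lambda>k. ?e (Suc k) i j) \<longlonglongrightarrow> (1 / 2) *\<^sub>R (X i j + (2 * 1) *\<^sub>R R i j - (\<Sum>l<n. m (R i l) (R l j)))"
      unfolding matrix_sqrt_iter.simps
      by (intro tendsto_intros sqrt_coeff_tendsto lim ij m.tendsto) auto
    with LIMSEQ_Suc[OF lim[OF ij]]
    have "R i j = (1 / 2) *\<^sub>R (X i j + (2 * 1) *\<^sub>R R i j - (\<Sum>l<n. m (R i l) (R l j)))"
      by (rule LIMSEQ_unique)
    then have "2 *\<^sub>R R i j = 2 *\<^sub>R (1 / 2) *\<^sub>R (X i j + (2 * 1) *\<^sub>R R i j - (\<Sum>l<n. m (R i l) (R l j)))"
      by (rule arg_cong)
    then show ?thesis by simp
  qed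
  with lim show thesis using that by blast
qed

section \<open>Positive operator matrices\<close>

lemma L2_set_scale: "L2_set (\<lambda>i. norm (c *\<^sub>R u i)) I = \<bar>c\<bar> * L2_set (\<lambda>i. norm (u i :: 'a::real_normed_vector)) I"
  by (simp add: L2_set_right_distrib)

lemma of_real_L2_set_cinner:
  "complex_of_real ((L2_set (\<lambda>i. norm (u i)) I)\<^sup>2) = (\<Sum>i\<in>I. cinner (u i) (u i :: 'h::complex_hilbert))"
  by (simp add: L2_set_def sum_nonneg cinner_self)

context
  fixes n :: nat and T :: "nat \<Rightarrow> nat \<Rightarrow> ('h::complex_hilbert \<Rightarrow>\<^sub>L 'h)"
  assumes bounded: "\<And>i j. i < n \<Longrightarrow> j < n \<Longrightarrow> T i j \<in> bounded_ops"
    and pos: "positive_operator_matrix n T"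
begin

definition form :: "(nat \<Rightarrow> 'h) \<Rightarrow> (nat \<Rightarrow> 'h) \<Rightarrow> complex"
  where "form u v = (\<Sum>i<n. cinner (\<Sum>j<n. T i j (u j)) (v i))"

lemma T_scaleC: "i < n \<Longrightarrow> j < n \<Longrightarrow> T i j (c *\<^sub>C x) = c *\<^sub>C T i j x"
  using bounded[of i j] by (simp add: bounded_ops_def clinear_on_def)

lemma form_simps:
  "form (\<lambda>i. u i + u' i) v = form u v + form u' v"
  "form u (\<lambda>i. v i + v' i) = form u v + form u v'"
  "form (\<lambda>i. c *\<^sub>C u i) v = c * form u v"
  "form u (\<lambda>i. c *\<^sub>C v i) = cnj c * form u v"
  by (simp_all add: form_def blinfun.add_right sum.distrib cinner_add_left cinner_add_right T_scaleC
      cinner_sum_left cinner_scaleC_left cinner_scaleC_right sum_distrib_left)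

lemma form_real: "Im (form u u) = 0" and form_nonneg: "0 \<le> Re (form u u)"
proof -
  have "form u u \<in> \<real>\<^sub>\<ge>\<^sub>0" using pos unfolding positive_operator_matrix_def form_def by blast
  then show "Im (form u u) = 0" "0 \<le> Re (form u u)" by (simp_all add: complex_nonneg_Reals_iff)
qed

text \<open>\<open>positive_operator_matrix\<close> does not mention symmetry; over the complex
  numbers it follows by polarisation from the form being real at u + v and u + i v.\<close>

lemma form_hermitian: "form v u = cnj (form u v)"
proof -
  have "Im (form u v) + Im (form v u) = 0"
    using form_real[of "\<lambda>i. u i + v i"] form_real[of u] form_real[of v] by (simp add: form_simps)
  moreover have "Re (form v u) - Re (form u v) = 0"
    using form_real[of "\<lambda>i. u i + \<i> *\<^sub>C v i"] form_real[of u] form_real[of v]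
    by (simp add: form_simps)
  ultimately show ?thesis by (simp add: complex_eq_iff)
qed

lemma positive_operator_matrix_adjoint:
  assumes "i < n" "j < n"
  shows "cinner (T i j x) y = cinner x (T j i y)"
proof -
  have unit: "form (\<lambda>k. if k = b then u else 0) (\<lambda>k. if k = a then v else 0) = cinner (T a b u) v"
    if "a < n" "b < n" for a b u v
  proof -
    have "(\<Sum>j<n. T i j (if j = b then u else 0)) = (\<Sum>j<n. if j = b then T i b u else 0)" for i
      by (rule sum.cong) auto
    then have "form (\<lambda>k. if k = b then u else 0) (\<lambda>k. if k = a then v else 0)
        = (\<Sum>i<n. if i = a then cinner (T a b u) v else 0)"
      unfolding form_def using that by (intro sum.cong refl) simp
    then show ?thesis using that by simp
  qed
  show ?thesis
    using form_hermitian[of "\<lambda>k. if k = j then x else 0" "\<lambda>k. if k = i then y else 0"]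
      unit[OF assms, of x y] unit[OF assms(2,1), of y x] cinner_commute[of "T j i y" x] by simp
qed

text \<open>t exceeds a crude bound for the norm of T on H^n, so X = T / t is a positive
  contraction. Then ||X u||^2 \<le> <X u, u>, and expanding ||u - X u||^2 gives the claim.\<close>

lemma positive_operator_matrix_contraction:
  obtains t where "0 < t"
    "\<And>u. L2_set (\<lambda>i. norm (u i - (\<Sum>j<n. ((1 / t) *\<^sub>R T i j) (u j)))) {..<n} \<le> L2_set (\<lambda>i. norm (u i)) {..<n}"
proof -
  define K where "K = (\<Sum>i<n. \<Sum>j<n. norm (T i j))"
  define t where "t = K + 1"
  have K: "0 \<le> K" unfolding K_def by (intro sum_nonneg) simp
  then have t: "0 < t" "K \<le> t" by (simp_all add: t_def)
  let ?N = "\<lambda>u. L2_set (\<lambda>i. norm (u i)) {..<n}"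
  define X where "X u = (\<lambda>i. \<Sum>j<n. ((1 / t) *\<^sub>R T i j) (u j))" for u
  have Xt: "X u i = (1 / t) *\<^sub>R (\<Sum>j<n. T i j (u j))" for u i
    by (simp add: X_def blinfun.scaleR_left scaleR_sum_right)
  have N_le: "norm (u i) \<le> ?N u" if "i < n" for u :: "nat \<Rightarrow> 'h" and i
    using member_le_L2_set[of "{..<n}" i "\<lambda>i. norm (u i)"] that by simp
  have NX: "?N (X u) \<le> ?N u" for u
  proof -
    have "norm (\<Sum>j<n. T i j (u j)) \<le> (\<Sum>j<n. norm (T i j)) * ?N u" for i
      unfolding sum_distrib_right
      by (intro sum_norm_le order_trans[OF norm_blinfun] mult_left_mono N_le) auto
    then have "(\<Sum>i<n. norm (\<Sum>j<n. T i j (u j))) \<le> K * ?N u"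
      unfolding K_def by (subst sum_distrib_right) (rule sum_mono)
    then have "?N (\<lambda>i. \<Sum>j<n. T i j (u j)) \<le> K * ?N u"
      using L2_set_le_sum[of "{..<n}" "\<lambda>i. norm (\<Sum>j<n. T i j (u j))"] by auto
    also have "\<dots> \<le> t * ?N u" using t by (intro mult_right_mono) auto
    finally have "1 / t * ?N (\<lambda>i. \<Sum>j<n. T i j (u j)) \<le> ?N u"
      using t(1) by (simp add: field_simps)
    then show ?thesis unfolding Xt L2_set_scale using t(1) by simp
  qed
  have sq: "(\<Sum>i<n. cinner (u i) (u i)) = complex_of_real ((?N u)\<^sup>2)" for u :: "nat \<Rightarrow> 'h"
    by (rule of_real_L2_set_cinner[symmetric])
  have fX: "(\<Sum>i<n. cinner (X u i) (v i)) = form u v / t" for u v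
    by (simp add: Xt form_def cinner_scaleR_left sum_divide_distrib)
  have herm: "(\<Sum>i<n. cinner (u i) (X v i)) = (\<Sum>i<n. cinner (X u i) (v i))" for u v
  proof -
    have "(\<Sum>i<n. cinner (u i) (X v i)) = cnj (\<Sum>i<n. cinner (X v i) (u i))"
      by (simp flip: cinner_commute)
    then show ?thesis by (simp add: fX form_hermitian[of u v])
  qed
  \<comment> \<open>Positivity at w = u - X u gives 2 ||X u||^2 \<le> <X u, u> + <X X u, X u>, and
    contractivity bounds the last term by ||X u||^2.\<close>
  have re: "Re (\<Sum>i<n. cinner (X u i) (X u i)) \<le> Re (\<Sum>i<n. cinner (X u i) (u i))" for u
  proof -
    let ?w = "\<lambda>i. u i - X u i"
    have Xw: "X ?w i = X u i - X (X u) i" for i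
      by (simp add: X_def blinfun.diff_right sum_subtractf)
    have "0 \<le> Re (form ?w ?w / t)" using form_nonneg[of ?w] t(1) by simp
    then have "0 \<le> Re (\<Sum>i<n. cinner (X ?w i) (?w i))" by (simp only: fX)
    also have "(\<Sum>i<n. cinner (X ?w i) (?w i)) = (\<Sum>i<n. cinner (X u i) (u i)) - (\<Sum>i<n. cinner (X u i) (X u i))
        - ((\<Sum>i<n. cinner (X (X u) i) (u i)) - (\<Sum>i<n. cinner (X (X u) i) (X u i)))"
      by (simp add: Xw sum_subtractf cinner_diff_left cinner_diff_right)
    also have "(\<Sum>i<n. cinner (X (X u) i) (u i)) = (\<Sum>i<n. cinner (X u i) (X u i))"
      by (simp only: herm)
    finally have "2 * Re (\<Sum>i<n. cinner (X u i) (X u i))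
        \<le> Re (\<Sum>i<n. cinner (X u i) (u i)) + Re (\<Sum>i<n. cinner (X (X u) i) (X u i))" by simp
    moreover have "Re (\<Sum>i<n. cinner (X (X u) i) (X u i)) \<le> Re (\<Sum>i<n. cinner (X u i) (X u i))"
    proof -
      have "Re (\<Sum>i<n. cinner (X (X u) i) (X u i)) \<le> (\<Sum>i<n. norm (X (X u) i) * norm (X u i))"
        unfolding Re_sum
        by (intro sum_mono order_trans[OF complex_Re_le_cmod cinner_Cauchy_Schwarz])
      also have "\<dots> \<le> ?N (X (X u)) * ?N (X u)"
        using L2_set_mult_ineq[of "\<lambda>i. norm (X (X u) i)" "\<lambda>i. norm (X u i)" "{..<n}"] by simp
      also have "\<dots> \<le> ?N (X u) * ?N (X u)" by (intro mult_right_mono NX) simp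
      finally show ?thesis by (simp add: sq power2_eq_square)
    qed
    ultimately show ?thesis by linarith
  qed
  have "?N (\<lambda>i. u i - X u i) \<le> ?N u" for u
  proof (rule power2_le_imp_le)
    have "complex_of_real ((?N (\<lambda>i. u i - X u i))\<^sup>2) = (\<Sum>i<n. cinner (u i) (u i))
        - (\<Sum>i<n. cinner (X u i) (u i)) - (\<Sum>i<n. cinner (X u i) (u i)) + (\<Sum>i<n. cinner (X u i) (X u i))"
      unfolding of_real_L2_set_cinner
      by (simp add: cinner_diff_left cinner_diff_right sum_subtractf herm[of u u])
    then have "(?N (\<lambda>i. u i - X u i))\<^sup>2 = Re (\<Sum>i<n. cinner (u i) (u i))
        - Re (\<Sum>i<n. cinner (X u i) (u i)) - Re (\<Sum>i<n. cinner (X u i) (u i)) + Re (\<Sum>i<n. cinner (X u i) (X u i))"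
      by (metis Re_complex_of_real minus_complex.sel(1) plus_complex.sel(1))
    moreover have "0 \<le> Re (\<Sum>i<n. cinner (X u i) (u i))"
      unfolding fX using form_nonneg[of u] t(1) by simp
    moreover have "Re (\<Sum>i<n. cinner (u i) (u i)) = (?N u)\<^sup>2" by (simp only: sq Re_complex_of_real)
    ultimately show "(?N (\<lambda>i. u i - X u i))\<^sup>2 \<le> (?N u)\<^sup>2" using re[of u] by linarith
  qed simp
  then show thesis using that[OF t(1)] by (simp add: X_def)
qed

end

context faithful_fell_representation
begin

lemma subspace_rep_image: "subspace (\<pi> g ` fibre B g)"
  unfolding subspace_def
proof (intro conjI ballI allI)
  show "0 \<in> \<pi> g ` fibre B g"
    using rep_simps(4)[of g] csubspace_0[OF fibre_csubspace, of g] by (metis image_eqI)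
  fix x assume "x \<in> \<pi> g ` fibre B g"
  then obtain u where u: "u \<in> fibre B g" "x = \<pi> g u" by blast
  show "c *\<^sub>R x \<in> \<pi> g ` fibre B g" for c
    using imageI[OF csubspace_scaleR[OF fibre_csubspace u(1), of c], of "\<pi> g"] u by (simp add: rep_simps)
  fix y assume "y \<in> \<pi> g ` fibre B g"
  then obtain v where v: "v \<in> fibre B g" "y = \<pi> g v" by blast
  show "x + y \<in> \<pi> g ` fibre B g"
    using imageI[OF csubspace_add[OF fibre_csubspace u(1) v(1)], of "\<pi> g"] u v by (simp add: rep_simps)
qed

text \<open>The degrees d i j = - t i + t j satisfy d i k + d k j = d i j, so the matrices whose
  entry at i, j lies in the image of the fibre at d i j are closed under products. Every polynomial
  approximant of the root is such a matrix, and so is the limit because the images are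
  closed.\<close>

lemma positive_bundle_matrix_of_rep:
  assumes Q: "Q \<in> bundle_matrices B n t"
    and pos: "positive_operator_matrix n (\<lambda>i j. \<pi> (- t i + t j) (Q i j))"
  shows "positive_bundle_matrix B n t Q"
proof -
  define d where "d i j = - t i + t j" for i j
  have dd: "d i k + d k j = d i j" for i j k
    by (simp add: d_def add.assoc)
  have dm: "- d i j = d j i" for i j by (simp add: d_def minus_add)
  define T where "T i j = \<pi> (d i j) (Q i j)" for i j
  have Q': "Q i j \<in> fibre B (d i j)" if "i < n" "j < n" for i j
    using Q that by (simp add: bundle_matrices_def d_def)
  have T_bd: "T i j \<in> bounded_ops" if "i < n" "j < n" for i j
    using rep_bounded_ops[OF Q'[OF that]] by (simp add: T_def)
  have T_pos: "positive_operator_matrix n T"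
    using pos by (simp add: T_def[abs_def] d_def)
  obtain s where s: "0 < s" and
    contr: "\<And>u. L2_set (\<lambda>i. norm (u i - (\<Sum>j<n. ((1 / s) *\<^sub>R T i j) (u j)))) {..<n} \<le> L2_set (\<lambda>i. norm (u i)) {..<n}"
    by (rule positive_operator_matrix_contraction[OF T_bd T_pos], assumption, assumption)
       (rule that; assumption)
  define X where "X i j = (1 / s) *\<^sub>R T i j" for i j
  let ?N = "\<lambda>u. L2_set (\<lambda>i. norm (u i)) {..<n}"
  obtain R where R: "\<And>i j. i < n \<Longrightarrow> j < n \<Longrightarrow> (\<lambda>k. matrix_sqrt_iter (o\<^sub>L) n X k i j) \<longlonglongrightarrow> R i j"
    and RR: "\<And>i j. i < n \<Longrightarrow> j < n \<Longrightarrow> (\<Sum>k<n. R i k o\<^sub>L R k j) = X i j"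
  proof (rule matrix_sqrt[where m = "(o\<^sub>L)" and act = blinfun_apply and nrm = ?N and X = X and n = n])
    show "bounded_bilinear ((o\<^sub>L) :: ('h \<Rightarrow>\<^sub>L 'h) \<Rightarrow> ('h \<Rightarrow>\<^sub>L 'h) \<Rightarrow> _)"
      by (rule bounded_bilinear_blinfun_compose)
    show "bounded_bilinear (blinfun_apply :: ('h \<Rightarrow>\<^sub>L 'h) \<Rightarrow> _)" by (rule bounded_bilinear_blinfun_apply)
    show "norm x \<le> K" if "0 \<le> K" "\<And>v. norm (blinfun_apply x v) \<le> K * norm v" for x :: "'h \<Rightarrow>\<^sub>L 'h" and K
      using that by (rule norm_blinfun_bound)
    show "?N (\<lambda>i. u i + v i) \<le> ?N u + ?N v" for u v :: "nat \<Rightarrow> 'h"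
      using order_trans[OF L2_set_mono[of "{..<n}" "\<lambda>i. norm (u i + v i)" "\<lambda>i. norm (u i) + norm (v i)"] L2_set_triangle_ineq]
      by (simp add: norm_triangle_ineq)
    show "?N (\<lambda>i. if i = j then v else 0) \<le> norm v" for j and v :: 'h
    proof -
      have "?N (\<lambda>i. if i = j then v else 0) \<le> (\<Sum>i<n. norm (if i = j then v else 0))"
        by (rule L2_set_le_sum) simp
      also have "\<dots> = (\<Sum>i<n. if i = j then norm v else 0)" by (rule sum.cong) auto
      also have "\<dots> \<le> norm v" by simp
      finally show ?thesis .
    qed
    show "norm (u i) \<le> ?N u" if "i < n" for i and u :: "nat \<Rightarrow> 'h"
      using member_le_L2_set[of "{..<n}" i "\<lambda>i. norm (u i)"] that by simp
    show "?N (\<lambda>i. u i - (\<Sum>j<n. blinfun_apply (X i j) (u j))) \<le> ?N u" for u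
      unfolding X_def by (rule contr)
    show "?N (\<lambda>i. c *\<^sub>R u i) = \<bar>c\<bar> * ?N u" for c and u :: "nat \<Rightarrow> 'h"
      by (rule L2_set_scale)
  qed auto
  let ?e = "matrix_sqrt_iter (o\<^sub>L) n X"
  have e_im: "?e k i j \<in> \<pi> (d i j) ` fibre B (d i j)" if "i < n" "j < n" for k i j
    using that
  proof (induction k arbitrary: i j)
    case 0
    show ?case using subspace_0[OF subspace_rep_image] by simp
  next
    case (Suc k)
    define I where "I i j = \<pi> (d i j) ` fibre B (d i j)" for i j
    have I: "subspace (I i j)" for i j
      unfolding I_def by (rule subspace_rep_image)
    have "?e k i l o\<^sub>L ?e k l j \<in> I i j" if l: "l < n" for l
    proof -
      obtain x y where x: "x \<in> fibre B (d i l)" "?e k i l = \<pi> (d i l) x"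
        and y: "y \<in> fibre B (d l j)" "?e k l j = \<pi> (d l j) y"
        using Suc.IH[OF Suc.prems(1) l] Suc.IH[OF l Suc.prems(2)] by blast
      show ?thesis
        using rep_mult[OF x(1) y(1)] fmult_closed[OF x(1) y(1)] x(2) y(2) by (simp add: dd I_def)
    qed
    moreover have "?e k i j \<in> I i j" using Suc by (simp add: I_def)
    moreover have "X i j \<in> I i j"
      using Q'[OF Suc.prems] subspace_scale[OF I, of "T i j" i j] by (simp add: X_def T_def I_def)
    ultimately have "?e (Suc k) i j \<in> I i j"
      unfolding matrix_sqrt_iter.simps
      by (intro subspace_scale[OF I] subspace_diff[OF I] subspace_add[OF I] subspace_sum[OF I]) auto
    then show ?case by (simp add: I_def)
  qed
  have e_adj: "cinner (?e k i j \<xi>) \<eta> = cinner \<xi> (?e k j i \<eta>)" if "i < n" "j < n" for k i j \<xi> \<eta>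
    using that
  proof (induction k arbitrary: i j \<xi> \<eta>)
    case (Suc k)
    have "cinner (X i j \<xi>) \<eta> = cinner \<xi> (X j i \<eta>)"
      using positive_operator_matrix_adjoint[OF T_bd T_pos Suc.prems, of \<xi> \<eta>]
      by (simp add: X_def blinfun.scaleR_left cinner_scaleR_left cinner_scaleR_right)
    then show ?case
      using Suc.prems
      by (simp add: Suc.IH blinfun.scaleR_left blinfun.add_left blinfun.diff_left blinfun.sum_left
          cinner_scaleR_left cinner_scaleR_right cinner_add_left cinner_add_right cinner_diff_left
          cinner_diff_right cinner_sum_left cinner_sum_right)
  qed simp
  have R_im: "R i j \<in> \<pi> (d i j) ` fibre B (d i j)" if "i < n" "j < n" for i j
    using closed_sequentially[OF closed_rep_image _ R[OF that]] e_im[OF that] by blast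
  have R_adj: "cinner (R i j \<xi>) \<eta> = cinner \<xi> (R j i \<eta>)" if ij: "i < n" "j < n" for i j \<xi> \<eta>
  proof (rule LIMSEQ_unique)
    have bl: "bounded_linear (\<lambda>S. cinner (blinfun_apply S \<xi>) \<eta>)" "bounded_linear (\<lambda>S. cinner \<eta> (blinfun_apply S \<xi>))" for \<xi> \<eta> :: 'h
    proof -
      have "bounded_linear (\<lambda>x. cinner x \<eta>)"
        by (rule bounded_linear_intro[where K = "norm \<eta>"])
          (auto simp: cinner_add_left cinner_scaleR_left scaleR_conv_of_real cinner_Cauchy_Schwarz)
      from bounded_linear_compose[OF this, of "\<lambda>S. blinfun_apply S \<xi>"]
      show "bounded_linear (\<lambda>S. cinner (blinfun_apply S \<xi>) \<eta>)" using blinfun.bounded_linear_left by blast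
      have "bounded_linear (\<lambda>x. cinner \<eta> x)"
        by (rule bounded_linear_intro[where K = "norm \<eta>"])
          (auto simp: cinner_add_right cinner_scaleR_right scaleR_conv_of_real mult.commute[of "norm _" "norm \<eta>"]
            cinner_Cauchy_Schwarz)
      from bounded_linear_compose[OF this, of "\<lambda>S. blinfun_apply S \<xi>"]
      show "bounded_linear (\<lambda>S. cinner \<eta> (blinfun_apply S \<xi>))" using blinfun.bounded_linear_left by blast
    qed
    show "(\<lambda>k. cinner (?e k i j \<xi>) \<eta>) \<longlonglongrightarrow> cinner (R i j \<xi>) \<eta>"
      by (rule bounded_linear.tendsto[OF bl(1) R[OF ij]])
    show "(\<lambda>k. cinner (?e k i j \<xi>) \<eta>) \<longlonglongrightarrow> cinner \<xi> (R j i \<eta>)"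
      unfolding e_adj[OF ij] by (rule bounded_linear.tendsto[OF bl(2) R[OF ij(2,1)]])
  qed
  \<comment> \<open>The factor \<open>sqrt s\<close> undoes the scaling of T by 1 / s.\<close>
  define \<rho> where "\<rho> i j = (SOME x. x \<in> fibre B (d i j) \<and> \<pi> (d i j) x = sqrt s *\<^sub>R R i j)" for i j
  have \<rho>: "\<rho> i j \<in> fibre B (d i j) \<and> \<pi> (d i j) (\<rho> i j) = sqrt s *\<^sub>R R i j" if ij: "i < n" "j < n" for i j
  proof -
    obtain x where "x \<in> fibre B (d i j)" "R i j = \<pi> (d i j) x" using R_im[OF ij] by blast
    then have "sqrt s *\<^sub>R x \<in> fibre B (d i j) \<and> \<pi> (d i j) (sqrt s *\<^sub>R x) = sqrt s *\<^sub>R R i j"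
      using csubspace_scaleR[OF fibre_csubspace] by (simp add: rep_simps)
    then show ?thesis unfolding \<rho>_def by (rule someI)
  qed
  \<comment> \<open>R is self-adjoint and \<pi> injective on fibres, so the matrix \<rho> equals its
    own adjoint and Q = \<rho> \<rho> has the required form.\<close>
  have \<rho>_st: "fstar B (d i j) (\<rho> i j) = \<rho> j i" if ij: "i < n" "j < n" for i j
  proof (rule inj_onD[OF inj_on_rep[of "d j i"]])
    show "fstar B (d i j) (\<rho> i j) \<in> fibre B (d j i)" using fstar_closed[OF conjunct1[OF \<rho>[OF ij]]] unfolding dm .
    show "\<rho> j i \<in> fibre B (d j i)" using \<rho> ij by blast
    show "\<pi> (d j i) (fstar B (d i j) (\<rho> i j)) = \<pi> (d j i) (\<rho> j i)"
    proof (rule blinfun_eqI, rule cinner_ext_right)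
      fix \<xi> \<eta>
      have "cinner \<xi> (\<pi> (d j i) (fstar B (d i j) (\<rho> i j)) \<eta>) = cinner (\<pi> (d i j) (\<rho> i j) \<xi>) \<eta>"
        using rep_adjoint[OF conjunct1[OF \<rho>[OF ij]], of \<xi> \<eta>] unfolding dm by (rule sym)
      also have "\<dots> = cinner \<xi> (\<pi> (d j i) (\<rho> j i) \<eta>)"
        using \<rho>[OF ij] \<rho>[OF ij(2,1)] R_adj[OF ij]
        by (simp add: blinfun.scaleR_left cinner_scaleR_left cinner_scaleR_right)
      finally show "cinner \<xi> (\<pi> (d j i) (fstar B (d i j) (\<rho> i j)) \<eta>) = cinner \<xi> (\<pi> (d j i) (\<rho> j i) \<eta>)" .
    qed
  qed
  have "Q i j = bundle_matrix_mult B n t (bundle_matrix_star B t \<rho>) \<rho> i j" if ij: "i < n" "j < n" for i j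
  proof (rule inj_onD[OF inj_on_rep[of "d i j"]])
    have eq: "bundle_matrix_mult B n t (bundle_matrix_star B t \<rho>) \<rho> i j
        = (\<Sum>k<n. fmult B (d i k) (d k j) (\<rho> i k) (\<rho> k j))"
      unfolding bundle_matrix_mult_def bundle_matrix_star_def
      using \<rho>_st ij by (intro sum.cong refl) (simp add: d_def)
    have cl: "fmult B (d i k) (d k j) (\<rho> i k) (\<rho> k j) \<in> fibre B (d i j)" if "k < n" for k
      using fmult_closed[of "\<rho> i k" "d i k" "\<rho> k j" "d k j"] \<rho> ij that by (simp add: dd)
    show "Q i j \<in> fibre B (d i j)" by (rule Q'[OF ij])
    show "bundle_matrix_mult B n t (bundle_matrix_star B t \<rho>) \<rho> i j \<in> fibre B (d i j)"
      unfolding eq using cl by (intro csubspace_sum[OF fibre_csubspace]) auto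
    have "\<pi> (d i j) (bundle_matrix_mult B n t (bundle_matrix_star B t \<rho>) \<rho> i j)
        = (\<Sum>k<n. \<pi> (d i j) (fmult B (d i k) (d k j) (\<rho> i k) (\<rho> k j)))"
      unfolding eq using cl by (intro clinear_on_sum[OF rep_linear fibre_csubspace]) auto
    also have "\<dots> = (\<Sum>k<n. (sqrt s *\<^sub>R R i k) o\<^sub>L (sqrt s *\<^sub>R R k j))"
    proof (rule sum.cong[OF refl])
      fix k assume "k \<in> {..<n}"
      then have k: "k < n" by simp
      show "\<pi> (d i j) (fmult B (d i k) (d k j) (\<rho> i k) (\<rho> k j)) = (sqrt s *\<^sub>R R i k) o\<^sub>L (sqrt s *\<^sub>R R k j)"
        using rep_mult[of "\<rho> i k" "d i k" "\<rho> k j" "d k j"] \<rho>[OF ij(1) k] \<rho>[OF k ij(2)] by (simp add: dd)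
    qed
    also have "\<dots> = s *\<^sub>R (\<Sum>k<n. R i k o\<^sub>L R k j)"
      using s by (simp add: scaleR_sum_right bounded_bilinear.scaleR_left[OF bounded_bilinear_blinfun_compose]
          bounded_bilinear.scaleR_right[OF bounded_bilinear_blinfun_compose])
    also have "\<dots> = \<pi> (d i j) (Q i j)" using RR[OF ij] s by (simp add: X_def T_def)
    finally show "\<pi> (d i j) (Q i j) = \<pi> (d i j) (bundle_matrix_mult B n t (bundle_matrix_star B t \<rho>) \<rho> i j)" by simp
  qed
  moreover have "\<rho> \<in> bundle_matrices B n t" using \<rho> by (simp add: bundle_matrices_def d_def)
  ultimately show ?thesis unfolding positive_bundle_matrix_def by blast
qed

end

section \<open>The order of a C*-algebra\<close>

definition cstar_le :: "'a::cstar_algebra \<Rightarrow> 'a \<Rightarrow> bool" (infix \<open>\<preceq>\<close> 50)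
  where "a \<preceq> b \<longleftrightarrow> cstar.positive (b - a)"

lemma cstar_le_0 [simp]: "0 \<preceq> a \<longleftrightarrow> cstar.positive a"
  by (simp add: cstar_le_def)

lemma cstar_le_refl [simp]: "a \<preceq> a"
  by (simp add: cstar_le_def cstar.positive_0)

lemma cstar_le_trans [trans]: "a \<preceq> b \<Longrightarrow> b \<preceq> c \<Longrightarrow> a \<preceq> c"
  unfolding cstar_le_def using cstar.positive_add[of "b - a" "c - b"] by simp

lemma cstar_le_add: "a \<preceq> b \<Longrightarrow> c \<preceq> d \<Longrightarrow> a + c \<preceq> b + d"
  unfolding cstar_le_def using cstar.positive_add[of "b - a" "d - c"] by (simp add: algebra_simps)

lemma cstar_le_sum: "(\<And>i. i \<in> I \<Longrightarrow> f i \<preceq> g i) \<Longrightarrow> sum f I \<preceq> sum g I"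
  unfolding cstar_le_def sum_subtractf[symmetric] by (rule cstar.positive_sum)

lemma cstar_le_scaleR: "a \<preceq> b \<Longrightarrow> 0 \<le> r \<Longrightarrow> r *\<^sub>R a \<preceq> r *\<^sub>R b"
  unfolding cstar_le_def using cstar.positive_scaleR[of "b - a" r] by (simp add: scaleR_diff_right)

lemma cstar_positive_adj_mult: "cstar.positive (adj a * (a::'a::cstar_algebra))"
  by (rule cstar.positive_st_mul) simp

lemma cstar_norm_mono: "cstar.positive a \<Longrightarrow> a \<preceq> b \<Longrightarrow> norm a \<le> norm (b::'a::cstar_algebra)"
  unfolding cstar_le_def by (rule cstar.positive_norm_mono)

lemma cstar_le_norm_conj:
  fixes a z :: "'a::cstar_algebra"
  assumes "adj a = a" "norm a \<le> K"
  shows "adj z * a * z \<preceq> K *\<^sub>R (adj z * z)"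
proof -
  have K: "0 \<le> K" using assms(2) norm_ge_zero order_trans by blast
  have "norm (a * x) \<le> K * norm x" for x
    using norm_mult_ineq[of a x] mult_right_mono[OF assms(2), of "norm x"] by simp
  then have "cstar.positive_operator (\<lambda>x. K *\<^sub>R x - a * x)"
    by (intro cstar.positive_operator_complement K cstar.selfadjoint_mul assms) auto
  from cstar.positive_operator_ip[OF this, of z] show ?thesis
    by (simp add: cstar_le_def algebra_simps)
qed

text \<open>The element in the hypothesis is \<open>\<langle>\<xi> a - t \<eta>, \<xi> a - t \<eta>\<rangle>\<close> in a Hilbert module, where
  \<open>p = \<langle>\<xi>, \<xi>\<rangle>\<close>, \<open>a = \<langle>\<xi>, \<eta>\<rangle>\<close> and \<open>r = \<langle>\<eta>, \<eta>\<rangle>\<close>.\<close>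

lemma module_Cauchy_Schwarz:
  fixes p a r :: "'a::cstar_algebra"
  assumes p: "adj p = p" and r: "cstar.positive r"
    and pos: "\<And>t. cstar.positive (adj a * p * a - (2 * t) *\<^sub>R (adj a * a) + (t * t) *\<^sub>R r)"
  shows "(norm a)\<^sup>2 \<le> norm p * norm r"
proof -
  have le: "(norm a)\<^sup>2 \<le> t * norm r" if t: "norm p < t" for t
  proof -
    have t0: "0 < t" using t norm_ge_zero le_less_trans by blast
    have "adj a * p * a \<preceq> t *\<^sub>R (adj a * a)" using p t by (intro cstar_le_norm_conj) auto
    \<comment> \<open>Adding t a^* a - a^* p a to the hypothesis cancels a^* p a and leaves t (t r -
      a^* a).\<close>
    then have "cstar.positive ((t *\<^sub>R (adj a * a) - adj a * p * a) + (adj a * p * a - (2 * t) *\<^sub>R (adj a * a) + (t * t) *\<^sub>R r))"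
      unfolding cstar_le_def by (intro cstar.positive_add pos)
    moreover have "(t *\<^sub>R (adj a * a) - adj a * p * a) + (adj a * p * a - (2 * t) *\<^sub>R (adj a * a) + (t * t) *\<^sub>R r)
        = t *\<^sub>R (t *\<^sub>R r - adj a * a)"
      by (simp add: algebra_simps scaleR_2 flip: scaleR_scaleR)
    ultimately have "cstar.positive (t *\<^sub>R (t *\<^sub>R r - adj a * a))" by simp
    from cstar.positive_scaleR[OF this, of "1 / t"] t0
    have "adj a * a \<preceq> t *\<^sub>R r" by (simp add: cstar_le_def)
    from cstar_norm_mono[OF cstar_positive_adj_mult this] t0 show ?thesis
      by (simp add: cstar_identity)
  qed
  show ?thesis
  proof (rule field_le_epsilon)
    fix e :: real assume e: "0 < e"
    then have "(norm a)\<^sup>2 \<le> (norm p + e / (norm r + 1)) * norm r"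
      by (intro le) (simp add: add_nonneg_pos)
    also have "\<dots> = norm p * norm r + e * (norm r / (norm r + 1))" by (simp add: algebra_simps)
    also have "e * (norm r / (norm r + 1)) \<le> e * 1"
      using e by (intro mult_left_mono) (auto simp: divide_le_eq_1 add_nonneg_pos)
    finally show "(norm a)\<^sup>2 \<le> norm p * norm r + e" by simp
  qed
qed

section \<open>Positive matrices over a C*-algebra\<close>

lemma adj_linear [simp]:
  fixes x y :: "'a::cstar_algebra"
  shows "adj (x - y) = adj x - adj y" "adj (r *\<^sub>R x) = r *\<^sub>R adj x" "adj (- x) = - adj x"
    "adj (0::'a) = 0" "adj (sum f I) = (\<Sum>i\<in>I. adj (f i :: 'a))"
proof -
  show 1: "adj (x - y) = adj x - adj y" for x y :: 'a using cstar.st_diff[of x y] by simp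
  show "adj (r *\<^sub>R x) = r *\<^sub>R adj x" using cstar.st_scaleR[of x r] by simp
  show 0: "adj (0::'a) = 0" using 1[of 0 0] by simp
  show "adj (- x) = - adj x" using 1[of 0 x] 0 by simp
  show "adj (sum f I) = (\<Sum>i\<in>I. adj (f i :: 'a))"
    by (induction I rule: infinite_finite_induct) (simp_all add: 0 adj_add)
qed

context
  fixes n :: nat and X :: "nat \<Rightarrow> nat \<Rightarrow> 'a::cstar_algebra"
  assumes pos: "\<And>u. cstar.positive (\<Sum>i<n. \<Sum>j<n. adj (u i) * X i j * u j)"
begin

definition gram :: "(nat \<Rightarrow> 'a) \<Rightarrow> (nat \<Rightarrow> 'a) \<Rightarrow> 'a"
  where "gram u v = (\<Sum>i<n. \<Sum>j<n. adj (u i) * X i j * v j)"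

definition mip :: "(nat \<Rightarrow> 'a) \<Rightarrow> (nat \<Rightarrow> 'a) \<Rightarrow> 'a"
  where "mip u v = (\<Sum>i<n. adj (u i) * v i)"

lemma gram_simps:
  "gram (\<lambda>i. u i + u' i) v = gram u v + gram u' v"
  "gram u (\<lambda>i. v i + v' i) = gram u v + gram u v'"
  "gram (\<lambda>i. u i - u' i) v = gram u v - gram u' v"
  "gram u (\<lambda>i. v i - v' i) = gram u v - gram u v'"
  "gram (\<lambda>i. c *\<^sub>C u i) v = cnj c *\<^sub>C gram u v"
  "gram u (\<lambda>i. c *\<^sub>C v i) = c *\<^sub>C gram u v"
  by (simp_all add: gram_def adj_add distrib_left distrib_right left_diff_distrib right_diff_distrib
      sum.distrib sum_subtractf adj_scaleC mult_scaleC_left mult_scaleC_right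
      clinear_on_sum[of UNIV "\<lambda>x. _ *\<^sub>C x"] clinear_on_def scaleC_add_right scaleC_scaleC mult.commute)

text \<open>Polarisation with u + v gives the sum, and with u + i v the difference, of the
  identities for the pairs u, v and v, u.\<close>

lemma adj_gram: "adj (gram u v) = gram v u"
proof -
  have s: "adj (gram w w) = gram w w" for w
    using cstar.positive_st[OF pos[of w]] by (simp add: gram_def)
  have 1: "adj (gram u v) + adj (gram v u) = gram u v + gram v u"
    using s[of "\<lambda>i. u i + v i"] s[of u] s[of v] by (simp add: gram_simps adj_add algebra_simps)
  have "\<i> *\<^sub>C (adj (gram v u) - adj (gram u v)) = \<i> *\<^sub>C (gram u v - gram v u)"
    using s[of "\<lambda>i. u i + \<i> *\<^sub>C v i"] s[of u] s[of v]
    by (simp add: gram_simps adj_add adj_scaleC scaleC_diff_right scaleC_scaleC scaleC_add_right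
        scaleC_minus_left algebra_simps)
  then have "- \<i> *\<^sub>C \<i> *\<^sub>C (adj (gram v u) - adj (gram u v)) = - \<i> *\<^sub>C \<i> *\<^sub>C (gram u v - gram v u)"
    by (rule arg_cong)
  then have "adj (gram v u) - adj (gram u v) = gram u v - gram v u" by (simp add: scaleC_scaleC)
  then have "adj (gram v u) = gram u v + adj (gram u v) - gram v u" by (simp add: algebra_simps)
  with 1 have "adj (gram u v) + adj (gram u v) = gram v u + gram v u" by (simp add: algebra_simps)
  then have "2 *\<^sub>R adj (gram u v) = 2 *\<^sub>R gram v u" by (simp only: scaleR_2)
  then show ?thesis by simp
qed

text \<open>Without a unit the entries are visible only as b^* X a. For the defect d, the choice b =
  d a in b^* d a = 0 and the C*-identity give d a = 0 for all a, hence d = 0.\<close>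

lemma adj_entry:
  assumes ij: "i < n" "j < n"
  shows "adj (X i j) = X j i"
proof -
  have unit: "gram (\<lambda>k. if k = a then x else 0) (\<lambda>k. if k = b then y else 0) = adj x * X a b * y"
    if "a < n" "b < n" for a b x y
  proof -
    have "(\<Sum>j<n. z * X i j * (if j = b then y else 0)) = (\<Sum>j<n. if j = b then z * X i b * y else 0)" for i z
      by (rule sum.cong) auto
    then have "gram (\<lambda>k. if k = a then x else 0) (\<lambda>k. if k = b then y else 0)
        = (\<Sum>i<n. if i = a then adj x * X a b * y else 0)"
      unfolding gram_def using that by (intro sum.cong refl) simp
    then show ?thesis using that by simp
  qed
  define d where "d = adj (X i j) - X j i"
  have 0: "adj b * (d * a) = 0" for a b
    using adj_gram[of "\<lambda>k. if k = i then a else 0" "\<lambda>k. if k = j then b else 0"]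
      unit[OF ij, of a b] unit[OF ij(2,1), of b a]
    by (simp add: d_def adj_mult adj_adj left_diff_distrib right_diff_distrib mult.assoc)
  have "d * a = 0" for a
    using 0[of "d * a" a] cstar_identity[of "d * a"] by simp
  then show ?thesis using cstar_identity[of "adj d"] by (simp add: adj_adj d_def)
qed

lemma mip_Cauchy_Schwarz: "(norm (mip u v))\<^sup>2 \<le> norm (mip u u) * norm (mip v v)"
proof (rule module_Cauchy_Schwarz)
  show "adj (mip u u) = mip u u" by (simp add: mip_def adj_mult adj_adj)
  show "cstar.positive (mip v v)" unfolding mip_def by (intro cstar.positive_sum cstar_positive_adj_mult)
  fix t :: real
  let ?a = "mip u v"
  have s: "(\<Sum>i<n. adj (w i) * (u i * ?a)) = (\<Sum>i<n. adj (w i) * u i) * ?a" for w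
    by (simp add: sum_distrib_right mult.assoc)
  have av: "adj ?a = (\<Sum>i<n. adj (v i) * u i)" by (simp add: mip_def adj_mult adj_adj)
  have "(\<Sum>i<n. adj (u i * ?a - t *\<^sub>R v i) * (u i * ?a - t *\<^sub>R v i))
      = adj ?a * (\<Sum>i<n. adj (u i) * u i) * ?a - t *\<^sub>R (adj ?a * (\<Sum>i<n. adj (u i) * v i))
        - t *\<^sub>R ((\<Sum>i<n. adj (v i) * u i) * ?a) + (t * t) *\<^sub>R (\<Sum>i<n. adj (v i) * v i)"
    by (simp add: adj_mult left_diff_distrib right_diff_distrib sum_subtractf mult.assoc s
        scaleR_diff_right flip: scaleR_sum_right sum_distrib_left)
  also have "\<dots> = adj ?a * mip u u * ?a - (2 * t) *\<^sub>R (adj ?a * ?a) + (t * t) *\<^sub>R mip v v"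
    unfolding av[symmetric] mip_def[symmetric] by (simp add: scaleR_2 flip: scaleR_scaleR)
  finally show "cstar.positive (adj ?a * mip u u * ?a - (2 * t) *\<^sub>R (adj ?a * ?a) + (t * t) *\<^sub>R mip v v)"
    by (metis (no_types, lifting) cstar.positive_sum cstar_positive_adj_mult)
qed

definition mnorm :: "(nat \<Rightarrow> 'a) \<Rightarrow> real"
  where "mnorm u = sqrt (norm (mip u u))"

lemma mip_positive: "cstar.positive (mip u u)"
  unfolding mip_def by (intro cstar.positive_sum cstar_positive_adj_mult)

lemma mnorm_add: "mnorm (\<lambda>i. u i + v i) \<le> mnorm u + mnorm v"
proof -
  have cs: "norm (mip u v) \<le> mnorm u * mnorm v" for u v
    using real_sqrt_le_mono[OF mip_Cauchy_Schwarz[of u v]] by (simp add: mnorm_def real_sqrt_mult)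
  have sq: "norm (mip u u) = (mnorm u)\<^sup>2" for u by (simp add: mnorm_def)
  have eq: "mip (\<lambda>i. u i + v i) (\<lambda>i. u i + v i) = (mip u u + mip u v) + (mip v u + mip v v)"
    by (simp add: mip_def adj_add distrib_left distrib_right sum.distrib add_ac)
  have "norm (mip (\<lambda>i. u i + v i) (\<lambda>i. u i + v i)) \<le> (norm (mip u u) + norm (mip u v)) + (norm (mip v u) + norm (mip v v))"
    unfolding eq by (intro norm_triangle_mono order_refl)
  also have "\<dots> \<le> (mnorm u + mnorm v)\<^sup>2"
    using cs[of u v] cs[of v u] unfolding power2_sum sq mult.commute[of "mnorm v"] by linarith
  finally have "sqrt (norm (mip (\<lambda>i. u i + v i) (\<lambda>i. u i + v i))) \<le> sqrt ((mnorm u + mnorm v)\<^sup>2)"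
    by (rule real_sqrt_le_mono)
  also have "\<dots> = mnorm u + mnorm v" by (simp add: mnorm_def)
  finally show ?thesis by (simp add: mnorm_def)
qed

text \<open>Expanding (u i - X i j u j)^* (u i - X i j u j) \<ge> 0 bounds the two cross terms by (u
  i)^* (u i) plus ||X i j||^2 (u j)^* (u j). Summing over i and j yields n and the squared norms in
  C; adding 1 makes the constant positive.\<close>

lemma gram_le_mip:
  obtains C where "0 < C" "\<And>u. gram u u \<preceq> C *\<^sub>R mip u u"
proof
  define C where "C = real n + (\<Sum>i<n. \<Sum>j<n. (norm (X i j))\<^sup>2)"
  show "0 < C + 1" by (simp add: C_def add_nonneg_pos sum_nonneg)
  fix u
  have le: "adj (u i) * X i j * u j + adj (u j) * X j i * u i
      \<preceq> adj (u i) * u i + (norm (X i j))\<^sup>2 *\<^sub>R (adj (u j) * u j)" if "i < n" "j < n" for i j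
  proof -
    have "cstar.positive (adj (u i - X i j * u j) * (u i - X i j * u j))" by (rule cstar_positive_adj_mult)
    then have "adj (u i) * X i j * u j + adj (u j) * X j i * u i
        \<preceq> adj (u i) * u i + adj (u j) * (adj (X i j) * X i j) * u j"
      by (simp add: cstar_le_def adj_mult adj_entry[OF that] algebra_simps)
    also have "\<dots> \<preceq> adj (u i) * u i + (norm (X i j))\<^sup>2 *\<^sub>R (adj (u j) * u j)"
      by (intro cstar_le_add cstar_le_refl cstar_le_norm_conj) (simp_all add: adj_mult adj_adj cstar_identity)
    finally show ?thesis .
  qed
  have "2 *\<^sub>R gram u u = (\<Sum>i<n. \<Sum>j<n. adj (u i) * X i j * u j + adj (u j) * X j i * u i)"
    unfolding sum.distrib by (subst (2) sum.swap) (simp add: gram_def scaleR_2)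
  also have "\<dots> \<preceq> (\<Sum>i<n. \<Sum>j<n. adj (u i) * u i + (norm (X i j))\<^sup>2 *\<^sub>R (adj (u j) * u j))"
    by (intro cstar_le_sum le) auto
  also have "\<dots> \<preceq> (\<Sum>i<n. \<Sum>j<n. adj (u i) * u i + (norm (X i j))\<^sup>2 *\<^sub>R mip u u)"
  proof (intro cstar_le_sum cstar_le_add cstar_le_scaleR cstar_le_refl)
    fix j assume "j \<in> {..<n}"
    then have "mip u u = adj (u j) * u j + (\<Sum>i\<in>{..<n} - {j}. adj (u i) * u i)"
      unfolding mip_def by (intro sum.remove) auto
    then show "adj (u j) * u j \<preceq> mip u u"
      by (simp add: cstar_le_def cstar.positive_sum cstar_positive_adj_mult)
  qed simp
  also have "\<dots> = C *\<^sub>R mip u u"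
    by (simp add: C_def sum.distrib mip_def scaleR_add_left scaleR_conv_of_real[symmetric] sum_constant_scaleR
        flip: scaleR_sum_left scaleR_sum_right)
  also have "\<dots> \<preceq> (2 * (C + 1)) *\<^sub>R mip u u"
  proof -
    have "0 \<le> C" by (simp add: C_def sum_nonneg)
    moreover have "(2 * (C + 1)) *\<^sub>R mip u u - C *\<^sub>R mip u u = (C + 2) *\<^sub>R mip u u"
      unfolding scaleR_diff_left[symmetric] by (simp add: algebra_simps)
    ultimately show ?thesis unfolding cstar_le_def by (simp add: cstar.positive_scaleR mip_positive)
  qed
  finally have "(1 / 2) *\<^sub>R 2 *\<^sub>R gram u u \<preceq> (1 / 2) *\<^sub>R (2 * (C + 1)) *\<^sub>R mip u u"
    by (rule cstar_le_scaleR) simp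
  then show "gram u u \<preceq> (C + 1) *\<^sub>R mip u u" by (simp add: add_divide_distrib)
qed

text \<open>Same scheme as for operator matrices, with A^n as a Hilbert module over A in place of
  H^n: the form puts Y = X / C between 0 and 1, then Y^2 \<le> Y, and 1 - Y is a contraction for
  \<open>mnorm\<close>. So the matrix root exists.\<close>

lemma positive_matrix_of_form: "positive_matrix n X"
proof -
  obtain C where C: "0 < C" "\<And>u. gram u u \<preceq> C *\<^sub>R mip u u"
    by (rule gram_le_mip, rule that; assumption)
  define Y where "Y i j = (1 / C) *\<^sub>R X i j" for i j
  define app where "app u = (\<lambda>i. \<Sum>j<n. Y i j * u j)" for u
  have Y_adj: "adj (Y i j) = Y j i" if "i < n" "j < n" for i j
    using adj_entry[OF that] by (simp add: Y_def)
  have ip1: "mip u (app v) = (1 / C) *\<^sub>R gram u v" for u v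
    by (simp add: mip_def app_def gram_def Y_def sum_distrib_left scaleR_sum_right mult.assoc)
  have ip2: "mip (app u) v = mip u (app v)" for u v
  proof -
    have "mip (app u) v = adj (mip v (app u))" by (simp add: mip_def adj_mult adj_adj)
    then show ?thesis unfolding ip1 by (simp add: adj_gram)
  qed
  have pos1: "cstar.positive (gram u u)" for u using pos[of u] by (simp add: gram_def)
  have le1: "mip u (app u) \<preceq> mip u u" for u
    using cstar_le_scaleR[OF C(2)[of u], of "1 / C"] C(1) by (simp add: ip1)
  have mip_diff: "mip (\<lambda>i. u i - v i) w = mip u w - mip v w" "mip w (\<lambda>i. u i - v i) = mip w u - mip w v" for u v w
    by (simp_all add: mip_def left_diff_distrib right_diff_distrib sum_subtractf)
  have app_diff: "app (\<lambda>i. u i - v i) = (\<lambda>i. app u i - app v i)" for u v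
    by (simp add: app_def right_diff_distrib sum_subtractf)
  have le2: "mip (app u) (app u) \<preceq> mip u (app u)" for u
  proof -
    let ?w = "\<lambda>i. u i - app u i"
    have "cstar.positive (mip ?w (app ?w))"
      unfolding ip1 using C(1) pos1 by (intro cstar.positive_scaleR) auto
    also have "mip ?w (app ?w) = mip u (app u) - mip (app u) (app u) - (mip (app u) (app u) - mip (app u) (app (app u)))"
      unfolding app_diff mip_diff by (simp add: ip2)
    finally have "cstar.positive ((mip u (app u) - mip (app u) (app u) - (mip (app u) (app u) - mip (app u) (app (app u))))
        + (mip (app u) (app u) - mip (app u) (app (app u))))"
      using le1[of "app u"] unfolding cstar_le_def by (rule cstar.positive_add)
    then show ?thesis by (simp add: cstar_le_def)
  qed
  have contr: "mnorm (\<lambda>i. u i - app u i) \<le> mnorm u" for u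
  proof -
    have "cstar.positive ((mip u (app u) - mip (app u) (app u)) + mip u (app u))"
      using le2[of u] unfolding cstar_le_def
      by (intro cstar.positive_add) (use C(1) pos1 in \<open>simp_all add: ip1 cstar.positive_scaleR\<close>)
    then have "mip (\<lambda>i. u i - app u i) (\<lambda>i. u i - app u i) \<preceq> mip u u"
      unfolding cstar_le_def mip_diff by (simp add: ip2 algebra_simps)
    from cstar_norm_mono[OF mip_positive this] show ?thesis by (simp add: mnorm_def)
  qed
  obtain R where R: "\<And>i j. i < n \<Longrightarrow> j < n \<Longrightarrow> (\<lambda>k. matrix_sqrt_iter (*) n Y k i j) \<longlonglongrightarrow> R i j"
    and RR: "\<And>i j. i < n \<Longrightarrow> j < n \<Longrightarrow> (\<Sum>k<n. R i k * R k j) = Y i j"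
  proof (rule matrix_sqrt[where m = "(*)" and act = "(*)" and nrm = mnorm and X = Y and n = n])
    show "norm x \<le> K" if "0 \<le> K" "\<And>v. norm (x * v) \<le> K * norm v" for x :: 'a and K
      using cstar.norm_le_mul_bound[of x K] that by simp
    show "mnorm (\<lambda>i. c *\<^sub>R u i) = \<bar>c\<bar> * mnorm u" for c u
      by (simp add: mnorm_def mip_def real_sqrt_mult flip: scaleR_sum_right)
    show "mnorm (\<lambda>i. if i = j then v else 0) \<le> norm v" if "j < n" for j v
    proof -
      have "mip (\<lambda>i. if i = j then v else 0) (\<lambda>i. if i = j then v else 0) = (\<Sum>i<n. if i = j then adj v * v else 0)"
        unfolding mip_def by (rule sum.cong) auto
      then show ?thesis using that by (simp add: mnorm_def cstar_identity)
    qed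
    show "norm (u i) \<le> mnorm u" if i: "i < n" for i u
    proof -
      have "mip u u = adj (u i) * u i + (\<Sum>k\<in>{..<n} - {i}. adj (u k) * u k)"
        unfolding mip_def using i by (intro sum.remove) auto
      then have "adj (u i) * u i \<preceq> mip u u"
        by (simp add: cstar_le_def cstar.positive_sum cstar_positive_adj_mult)
      from cstar_norm_mono[OF cstar_positive_adj_mult this] show ?thesis
        unfolding mnorm_def cstar_identity by (rule real_le_rsqrt)
    qed
    show "mnorm (\<lambda>i. u i - (\<Sum>j<n. Y i j * u j)) \<le> mnorm u" for u
      using contr[of u] by (simp add: app_def)
  qed (auto simp: mult.assoc mnorm_add bounded_bilinear_mult)
  have e_adj: "adj (matrix_sqrt_iter (*) n Y k i j) = matrix_sqrt_iter (*) n Y k j i" if "i < n" "j < n" for k i j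
    using that
  proof (induction k arbitrary: i j)
    case (Suc k)
    then show ?case by (simp add: adj_add adj_mult Y_adj)
  qed simp
  have "bounded_linear (adj :: 'a \<Rightarrow> 'a)"
    by (rule bounded_linear_intro[where K = 1]) (simp_all add: adj_add)
  then have R_adj: "adj (R i j) = R j i" if "i < n" "j < n" for i j
    using bounded_linear.tendsto[of adj, OF _ R[OF that]] R[OF that(2,1)] LIMSEQ_unique
    unfolding e_adj[OF that] by blast
  show ?thesis
    unfolding positive_matrix_def
  proof (intro exI[of _ "\<lambda>i j. sqrt C *\<^sub>R R i j"] allI impI)
    fix i j assume ij: "i < n" "j < n"
    have "(\<Sum>k<n. adj (sqrt C *\<^sub>R R k i) * (sqrt C *\<^sub>R R k j)) = C *\<^sub>R (\<Sum>k<n. R i k * R k j)"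
      unfolding scaleR_sum_right using ij C(1) by (intro sum.cong refl) (simp add: R_adj)
    then show "X i j = (\<Sum>k<n. adj (sqrt C *\<^sub>R R k i) * (sqrt C *\<^sub>R R k j))"
      using RR[OF ij] C(1) by (simp add: Y_def)
  qed
qed

end

lemma positive_matrix_form:
  assumes "positive_matrix n X"
  shows "cstar.positive (\<Sum>i<n. \<Sum>j<n. adj (u i) * X i j * u j)"
proof -
  obtain N where N: "\<And>i j. i < n \<Longrightarrow> j < n \<Longrightarrow> X i j = (\<Sum>k<n. adj (N k i) * N k j)"
    using assms unfolding positive_matrix_def by blast
  have "(\<Sum>i<n. \<Sum>j<n. adj (u i) * X i j * u j) = (\<Sum>i<n. \<Sum>j<n. \<Sum>k<n. adj (N k i * u i) * (N k j * u j))"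
    by (intro sum.cong refl) (simp add: N adj_mult sum_distrib_left sum_distrib_right mult.assoc)
  also have "\<dots> = (\<Sum>i<n. \<Sum>k<n. \<Sum>j<n. adj (N k i * u i) * (N k j * u j))"
    by (intro sum.cong refl sum.swap)
  also have "\<dots> = (\<Sum>k<n. \<Sum>i<n. \<Sum>j<n. adj (N k i * u i) * (N k j * u j))"
    by (rule sum.swap)
  also have "\<dots> = (\<Sum>k<n. adj (\<Sum>i<n. N k i * u i) * (\<Sum>j<n. N k j * u j))"
    by (simp add: sum_distrib_left sum_distrib_right) (intro sum.cong refl sum.swap)
  finally have eq: "(\<Sum>i<n. \<Sum>j<n. adj (u i) * X i j * u j)
      = (\<Sum>k<n. adj (\<Sum>i<n. N k i * u i) * (\<Sum>j<n. N k j * u j))" .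
  show ?thesis unfolding eq by (intro cstar.positive_sum cstar_positive_adj_mult)
qed

section \<open>Approximate units and factorization in Fell bundles\<close>

context fell_bundle
begin

lemmas fibre_0 [simp] = csubspace_0[OF fibre_csubspace]
  and fibre_add [simp] = csubspace_add[OF fibre_csubspace]
  and fibre_diff [simp] = csubspace_diff[OF fibre_csubspace]
  and fibre_scaleR [simp] = csubspace_scaleR[OF fibre_csubspace]
  and fibre_scaleC [simp] = csubspace_scaleC[OF fibre_csubspace]
  and fibre_uminus [simp] = csubspace_uminus[OF fibre_csubspace]
  and fibre_sum = csubspace_sum[OF fibre_csubspace]

lemmas fmult_bilinear =
  clinear_on_add[OF fmult_linear_left] clinear_on_scaleC[OF fmult_linear_left]
  clinear_on_scaleR[OF fmult_linear_left] clinear_on_uminus[OF fmult_linear_left]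
  clinear_on_diff[OF fmult_linear_left fibre_csubspace] clinear_on_0[OF fmult_linear_left fibre_csubspace]
  clinear_on_add[OF fmult_linear_right] clinear_on_scaleC[OF fmult_linear_right]
  clinear_on_scaleR[OF fmult_linear_right] clinear_on_uminus[OF fmult_linear_right]
  clinear_on_diff[OF fmult_linear_right fibre_csubspace] clinear_on_0[OF fmult_linear_right fibre_csubspace]

lemma fstar_linear:
  assumes "x \<in> fibre B g"
  shows "fstar B g (r *\<^sub>R x) = r *\<^sub>R fstar B g x" "fstar B g (- x) = - fstar B g x"
    and "y \<in> fibre B g \<Longrightarrow> fstar B g (x - y) = fstar B g x - fstar B g y"
proof -
  show "fstar B g (r *\<^sub>R x) = r *\<^sub>R fstar B g x"
    using fstar_scaleC[OF assms, of "complex_of_real r"] by (simp add: scaleR_scaleC)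
  have u: "x \<in> fibre B g \<Longrightarrow> fstar B g (- x) = - fstar B g x" for x
    using fstar_scaleC[of x g "- 1"] by simp
  show "y \<in> fibre B g \<Longrightarrow> fstar B g (x - y) = fstar B g x - fstar B g y"
    using fstar_add[OF assms, of "- y"] u[of y] by simp
  show "fstar B g (- x) = - fstar B g x" by (rule u[OF assms])
qed

lemma fstar_zero [simp]: "fstar B g 0 = 0"
  using fstar_linear(1)[of 0 g 0] by simp

lemma fmult_zero [simp]: "x \<in> fibre B g \<Longrightarrow> fmult B g h x 0 = 0"
  "x \<in> fibre B h \<Longrightarrow> fmult B g h 0 x = 0"
  by (simp_all add: fmult_bilinear)

abbreviation umult :: "'b \<Rightarrow> 'b \<Rightarrow> 'b" (infixl \<open>\<odot>\<close> 70)
  where "umult \<equiv> fmult B 0 0"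

abbreviation lact :: "'g \<Rightarrow> 'b \<Rightarrow> 'b \<Rightarrow> 'b"
  where "lact g a b \<equiv> fmult B 0 g a b"

text \<open>The left inner product on the fibre at g: b times the adjoint of c, an element of the
  unit fibre.\<close>

abbreviation outer :: "'g \<Rightarrow> 'b \<Rightarrow> 'b \<Rightarrow> 'b"
  where "outer g b c \<equiv> fmult B g (- g) b (fstar B g c)"

lemma lact_closed [simp]: "a \<in> fibre B 0 \<Longrightarrow> b \<in> fibre B g \<Longrightarrow> lact g a b \<in> fibre B g"
  using fmult_closed[of a 0 b g] by simp

lemma lact_lact: "a \<in> fibre B 0 \<Longrightarrow> a' \<in> fibre B 0 \<Longrightarrow> b \<in> fibre B g \<Longrightarrow> lact g a (lact g a' b) = lact g (a \<odot> a') b"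
  using fmult_assoc[of a 0 a' 0 b g] by simp

lemma outer_closed [simp]: "b \<in> fibre B g \<Longrightarrow> c \<in> fibre B g \<Longrightarrow> outer g b c \<in> fibre B 0"
  using fmult_closed[of b g "fstar B g c" "- g"] fstar_closed[of c g] by simp

lemma outer_lact_left:
  "a \<in> fibre B 0 \<Longrightarrow> b \<in> fibre B g \<Longrightarrow> c \<in> fibre B g \<Longrightarrow> outer g (lact g a b) c = a \<odot> outer g b c"
  using fmult_assoc[of a 0 b g "fstar B g c" "- g"] fstar_closed[of c g] by simp

lemma outer_lact_right:
  assumes "a \<in> fibre B 0" "b \<in> fibre B g" "c \<in> fibre B g"
  shows "outer g b (lact g a c) = outer g b c \<odot> fstar B 0 a"
  using assms fstar_fmult[of a 0 c g] fmult_assoc[of b g "fstar B g c" "- g" "fstar B 0 a" 0] fstar_closed[of c g]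
  by simp

lemma norm_outer: "b \<in> fibre B g \<Longrightarrow> norm (outer g b b) = (norm b)\<^sup>2"
  using norm_fstar_fmult[OF fstar_closed, of b g] norm_fstar[of b g] fstar_fstar[of b g] by simp

lemma outer_linear:
  "b \<in> fibre B g \<Longrightarrow> b' \<in> fibre B g \<Longrightarrow> c \<in> fibre B g \<Longrightarrow> outer g (b - b') c = outer g b c - outer g b' c"
  "b \<in> fibre B g \<Longrightarrow> c \<in> fibre B g \<Longrightarrow> c' \<in> fibre B g \<Longrightarrow> outer g b (c - c') = outer g b c - outer g b c'"
  "b \<in> fibre B g \<Longrightarrow> c \<in> fibre B g \<Longrightarrow> outer g (r *\<^sub>R b) c = r *\<^sub>R outer g b c"
  "b \<in> fibre B g \<Longrightarrow> c \<in> fibre B g \<Longrightarrow> outer g b (r *\<^sub>R c) = r *\<^sub>R outer g b c"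
  by (simp_all add: fmult_bilinear fstar_linear fstar_closed)

lemma positive_inner: "b \<in> fibre B g \<Longrightarrow> unit_fibre.positive (fmult B (- g) g (fstar B g b) b)"
  using fstar_fmult_positive[of b g] unit_fibre.positive_st_mul by fastforce

lemma positive_outer: "b \<in> fibre B g \<Longrightarrow> unit_fibre.positive (outer g b b)"
  using positive_inner[OF fstar_closed, of b g] fstar_fstar[of b g] by simp

text \<open>The elements \<open>1 - (1 - s)\<^sup>k\<close> of the unit fibre.\<close>

primrec power_unit :: "'b \<Rightarrow> nat \<Rightarrow> 'b"
  where "power_unit s 0 = 0"
  | "power_unit s (Suc k) = power_unit s k + (s - s \<odot> power_unit s k)"

lemma power_unit_closed [simp]: "s \<in> fibre B 0 \<Longrightarrow> power_unit s k \<in> fibre B 0"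
  by (induction k) simp_all

lemma power_unit_apply:
  assumes "s \<in> fibre B 0" "x \<in> fibre B g"
  shows "((\<lambda>x. x - lact g s x) ^^ k) x = x - lact g (power_unit s k) x"
proof (induction k)
  case 0
  then show ?case using assms by simp
next
  case (Suc k)
  then show ?case using assms by (simp add: fmult_bilinear lact_lact)
qed

context
  fixes s assumes s: "unit_fibre.positive s" "norm s \<le> 1"
begin

lemma s_in [simp]: "s \<in> fibre B 0"
  by (rule unit_fibre.positive_in[OF s(1)])

lemma s_positive: "unit_fibre.positive_operator (\<lambda>x. s \<odot> x)"
  and s_complement_positive: "unit_fibre.positive_operator (\<lambda>x. x - s \<odot> x)"
proof -
  show 1: "unit_fibre.positive_operator (\<lambda>x. s \<odot> x)" using s(1) by (simp add: unit_fibre.positive_def)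
  have "norm (s \<odot> x) \<le> 1 * norm x" if "x \<in> fibre B 0" for x
    using norm_fmult[OF s_in that] mult_right_mono[OF s(2), of "norm x"] by simp
  from unit_fibre.positive_operator_complement[OF unit_fibre.positive_operator_selfadjoint[OF 1] _ this]
  show "unit_fibre.positive_operator (\<lambda>x. x - s \<odot> x)" by simp
qed

text \<open>By \<open>power_unit_apply\<close>, 1 - \<open>power_unit s k\<close> acts as the k-th
  power of 1 - s, so the estimates for powers of operators carry over to elements.\<close>

lemma power_unit_facts:
  shows "unit_fibre.positive (power_unit s k)"
    and power_unit_complement: "unit_fibre.positive_operator (\<lambda>x. x - power_unit s k \<odot> x)"
    and "norm (power_unit s k) \<le> 1"
    and power_unit_contr: "x \<in> fibre B 0 \<Longrightarrow> norm (x - power_unit s k \<odot> x) \<le> norm x"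
    and power_unit_decay: "x \<in> fibre B 0 \<Longrightarrow> real k * norm (s \<odot> x - power_unit s k \<odot> (s \<odot> x)) \<le> norm x"
proof -
  note P = power_unit_apply[OF s_in, of _ 0 k]
  have 1: "unit_fibre.positive_operator (\<lambda>x. power_unit s k \<odot> x)"
    by (rule unit_fibre.positive_operator_cong[OF
          unit_fibre.complement_power_complement[OF s_positive s_complement_positive, of k]]) (simp add: P)
  then show "unit_fibre.positive (power_unit s k)" by (simp add: unit_fibre.positive_def)
  show 2: "unit_fibre.positive_operator (\<lambda>x. x - power_unit s k \<odot> x)"
    by (rule unit_fibre.positive_operator_cong[OF
          unit_fibre.positive_operator_power[OF s_complement_positive, of k]]) (simp add: P)
  have "norm (power_unit s k \<odot> x) \<le> 1 * norm x" if "x \<in> fibre B 0" for x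
    using unit_fibre.positive_operator_bound[OF 1 2 unit_fibre.cstar_compatible_norm that] by simp
  from unit_fibre.norm_le_mul_bound[OF _ _ this] show "norm (power_unit s k) \<le> 1" by simp
  have "unit_fibre.positive_operator (\<lambda>x. x - (x - power_unit s k \<odot> x))" using 1 by simp
  from unit_fibre.positive_operator_bound[OF 2 this unit_fibre.cstar_compatible_norm]
  show "x \<in> fibre B 0 \<Longrightarrow> norm (x - power_unit s k \<odot> x) \<le> norm x" .
  show "x \<in> fibre B 0 \<Longrightarrow> real k * norm (s \<odot> x - power_unit s k \<odot> (s \<odot> x)) \<le> norm x"
    using unit_fibre.complement_power_decay[OF s_positive s_complement_positive, of x k] P[of "s \<odot> x"] by simp
qed

end

text \<open>With h the sum of the b i b i^* and s = h / T, take e = 1 - (1 - s)^k. For z = b i - e b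
  i one has z z^* = (1 - e) b i b i^* (1 - e) \<le> (1 - e) h (1 - e), whose norm is at most T / k
  by \<open>power_unit_decay\<close>. One e serves all indices because each b i b i^* lies below
  h.\<close>

lemma approximate_unit:
  fixes b :: "'i \<Rightarrow> 'b" and d :: "'i \<Rightarrow> 'g"
  assumes I: "finite I" and b: "\<And>i. i \<in> I \<Longrightarrow> b i \<in> fibre B (d i)" and \<epsilon>: "0 < \<epsilon>"
  obtains e where "e \<in> fibre B 0" "norm e \<le> 1" "fstar B 0 e = e"
    "\<And>i. i \<in> I \<Longrightarrow> norm (b i - lact (d i) e (b i)) < \<epsilon>"
proof -
  define y where "y i = outer (d i) (b i) (b i)" for i
  have y: "unit_fibre.positive (y i)" if "i \<in> I" for i
    using positive_outer[OF b[OF that]] by (simp add: y_def)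
  define h where "h = (\<Sum>i\<in>I. y i)"
  have h: "unit_fibre.positive h" unfolding h_def by (intro unit_fibre.positive_sum y)
  define T where "T = norm h + 1"
  have T: "0 < T" by (simp add: T_def add_nonneg_pos)
  define s where "s = (1 / T) *\<^sub>R h"
  have s: "unit_fibre.positive s" "norm s \<le> 1"
    using h T by (auto simp: s_def T_def unit_fibre.positive_scaleR)
  have hs: "h = T *\<^sub>R s" using T by (simp add: s_def)
  \<comment> \<open>T / k must fall below the square of \<epsilon>, since the estimate concerns z
    z^* rather than z.\<close>
  obtain k where k: "T / \<epsilon>\<^sup>2 < real k" using reals_Archimedean2 by blast
  have k0: "0 < real k" using k T \<epsilon> by (meson divide_pos_pos less_trans zero_less_power)
  define e where "e = power_unit s k"
  have e: "unit_fibre.positive e" "norm e \<le> 1"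
    unfolding e_def by (rule power_unit_facts[OF s])+
  have eA: "e \<in> fibre B 0" and sA: "s \<in> fibre B 0" and hA: "h \<in> fibre B 0"
    and est: "fstar B 0 e = e"
    using e(1) s(1) h unit_fibre.positive_in unit_fibre.positive_st by blast+
  have fsa: "unit_fibre.selfadjoint (\<lambda>x. x - e \<odot> x)"
    unfolding e_def by (rule unit_fibre.positive_operator_selfadjoint[OF power_unit_complement[OF s]])
  have fcontr: "x \<in> fibre B 0 \<Longrightarrow> norm (x - e \<odot> x) \<le> norm x" for x
    unfolding e_def by (rule power_unit_contr[OF s])
  have "norm (b i - lact (d i) e (b i)) < \<epsilon>" if i: "i \<in> I" for i
  proof -
    let ?g = "d i"
    define z where "z = b i - lact ?g e (b i)"
    define w where "w = outer ?g z z"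
    note bi = b[OF i] and yi = unit_fibre.positive_in[OF y[OF i]]
    have zA: "z \<in> fibre B ?g" using bi eA by (simp add: z_def)
    have wA: "w \<in> fibre B 0" using zA by (simp add: w_def)
    have w: "w = y i - y i \<odot> e - (e \<odot> y i - e \<odot> y i \<odot> e)"
      using bi eA yi
      by (simp add: w_def z_def y_def outer_linear outer_lact_left outer_lact_right est unit_fibre.mul_bilinear)
    have wx: "w \<odot> x = (y i \<odot> (x - e \<odot> x)) - e \<odot> (y i \<odot> (x - e \<odot> x))" if "x \<in> fibre B 0" for x
      using that eA yi unfolding w by (simp add: unit_fibre.mul_bilinear unit_fibre.mul_assoc)
    have yop: "unit_fibre.positive_operator (\<lambda>x. y i \<odot> x)"
      using y[OF i] by (simp add: unit_fibre.positive_def)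
    have wpos: "unit_fibre.positive_operator (\<lambda>x. w \<odot> x)"
      by (rule unit_fibre.positive_operator_cong[OF unit_fibre.positive_operator_conj[OF yop fsa]])
        (simp add: wx)
    have "h - y i = (\<Sum>j\<in>I - {i}. y j)"
      unfolding h_def using I i by (simp add: sum.remove[of I i])
    then have hy: "unit_fibre.positive (h - y i)"
      using unit_fibre.positive_sum[of "I - {i}" y] y by simp
    then have hyop: "unit_fibre.positive_operator (\<lambda>x. (h - y i) \<odot> x)"
      by (simp add: unit_fibre.positive_def)
    define H where "H x = (h \<odot> (x - e \<odot> x)) - e \<odot> (h \<odot> (x - e \<odot> x))" for x
    have "unit_fibre.positive_operator (\<lambda>x. H x - w \<odot> x)"
      by (rule unit_fibre.positive_operator_cong[OF unit_fibre.positive_operator_conj[OF hyop fsa]])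
        (use eA yi hA in \<open>simp add: H_def wx unit_fibre.mul_bilinear algebra_simps\<close>)
    moreover have "norm (H x) \<le> (T / real k) * norm x" if x: "x \<in> fibre B 0" for x
    proof -
      let ?x = "x - e \<odot> x"
      have "H x = T *\<^sub>R (s \<odot> ?x - e \<odot> (s \<odot> ?x))"
        using x eA sA by (simp add: H_def hs unit_fibre.mul_bilinear scaleR_diff_right)
      then have "real k * norm (H x) = T * (real k * norm (s \<odot> ?x - e \<odot> (s \<odot> ?x)))"
        using T by simp
      also have "\<dots> \<le> T * norm ?x"
        using power_unit_decay[OF s, of ?x k] x eA T by (intro mult_left_mono) (simp_all add: e_def)
      also have "\<dots> \<le> T * norm x" using fcontr[OF x] T by (intro mult_left_mono) auto
      finally show ?thesis using k0 by (simp add: field_simps)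
    qed
    ultimately have "norm (w \<odot> x) \<le> (T / real k) * norm x" if "x \<in> fibre B 0" for x
      using unit_fibre.positive_operator_monotone[OF wpos, of H "T / real k" x] that T k0 by simp
    from unit_fibre.norm_le_mul_bound[OF wA _ this] have "norm w \<le> T / real k" using T k0 by simp
    also have "\<dots> < \<epsilon>\<^sup>2" using k k0 \<epsilon> by (simp add: field_simps)
    finally have "(norm z)\<^sup>2 < \<epsilon>\<^sup>2" using norm_outer[OF zA] by (simp add: w_def)
    then show ?thesis using \<epsilon> unfolding z_def by (simp add: power_less_imp_less_base)
  qed
  with e(2) eA est show thesis using that by blast
qed

text \<open>With \<open>b b\<^sup>* = \<sigma>\<^sup>4\<close> the cofactor is \<open>y = \<Sum>\<^sub>j (1 - \<sigma>)\<^sup>j b\<close>; the partial sums are Cauchy because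
  multiplying \<open>b\<close> or \<open>\<sigma>\<^sup>2\<close> from the left by polynomials in \<open>\<sigma>\<close> yields equal norms.\<close>

lemma factorization:
  assumes b: "b \<in> fibre B g" "norm b \<le> 1"
  obtains \<sigma> y where "\<sigma> \<in> fibre B 0" "fstar B 0 \<sigma> = \<sigma>" "norm \<sigma> \<le> 1" "y \<in> fibre B g" "norm y \<le> 2"
    "lact g \<sigma> y = b"
proof -
  define h where "h = outer g b b"
  obtain s2 where s2: "unit_fibre.positive s2" "s2 \<odot> s2 = h"
    using unit_fibre.positive_sqrt[OF positive_outer[OF b(1)]] unfolding h_def by metis
  obtain \<sigma> where \<sigma>: "unit_fibre.positive \<sigma>" "\<sigma> \<odot> \<sigma> = s2"
    using unit_fibre.positive_sqrt[OF s2(1)] by metis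
  have \<sigma>A: "\<sigma> \<in> fibre B 0" and s2A: "s2 \<in> fibre B 0" and \<sigma>s: "fstar B 0 \<sigma> = \<sigma>" and s2s: "fstar B 0 s2 = s2"
    using \<sigma>(1) s2(1) unit_fibre.positive_in unit_fibre.positive_st by blast+
  have "norm h \<le> 1" using norm_outer[OF b(1)] b(2) by (simp add: h_def power_le_one)
  then have ns2: "norm s2 \<le> 1"
    using unit_fibre.norm_st_mul[OF s2A] s2(2) s2s by (simp add: power2_le_imp_le[of _ 1, simplified])
  then have n\<sigma>: "norm \<sigma> \<le> 1"
    using unit_fibre.norm_st_mul[OF \<sigma>A] \<sigma>(2) \<sigma>s by (simp add: power2_le_imp_le[of _ 1, simplified])
  have transfer: "norm (r *\<^sub>R b - lact g Z b) = norm (r *\<^sub>R s2 - Z \<odot> s2)" if Z: "Z \<in> fibre B 0" for r Z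
  proof -
    let ?u = "r *\<^sub>R b - lact g Z b" and ?v = "r *\<^sub>R s2 - Z \<odot> s2"
    have hA: "h \<in> fibre B 0" using b(1) by (simp add: h_def)
    have "outer g ?u ?u = r *\<^sub>R r *\<^sub>R h - r *\<^sub>R (h \<odot> fstar B 0 Z) - (Z \<odot> (r *\<^sub>R h) - Z \<odot> (h \<odot> fstar B 0 Z))"
      using b(1) Z hA
      by (simp add: outer_linear outer_lact_left outer_lact_right h_def[symmetric] scaleR_diff_right
          unit_fibre.mul_bilinear unit_fibre.mul_assoc)
    moreover have "?v \<odot> fstar B 0 ?v = r *\<^sub>R r *\<^sub>R h - r *\<^sub>R (h \<odot> fstar B 0 Z) - (Z \<odot> (r *\<^sub>R h) - Z \<odot> (h \<odot> fstar B 0 Z))"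
    proof -
      have "s2 \<odot> (s2 \<odot> x) = h \<odot> x" if "x \<in> fibre B 0" for x
        using unit_fibre.mul_assoc[OF s2A s2A that] s2(2) by simp
      then show ?thesis
        using s2A Z hA by (simp add: unit_fibre.st_diff unit_fibre.st_scaleR unit_fibre.st_mul s2s
            unit_fibre.mul_bilinear unit_fibre.mul_assoc s2(2) scaleR_diff_right)
    qed
    ultimately have "norm (outer g ?u ?u) = norm (?v \<odot> fstar B 0 ?v)" by simp
    moreover have "norm (?v \<odot> fstar B 0 ?v) = (norm ?v)\<^sup>2"
      using unit_fibre.norm_st_mul[of "fstar B 0 ?v"] s2A Z by simp
    ultimately have "(norm ?u)\<^sup>2 = (norm ?v)\<^sup>2" using norm_outer[of ?u g] b(1) Z by simp
    then show ?thesis by (simp add: power2_eq_iff_nonneg)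
  qed
  let ?e = "power_unit \<sigma>"
  \<comment> \<open>Since \<open>?e j\<close> is 1 - (1 - \<sigma>)^j, k - Z k is the sum of (1 -
    \<sigma>)^j over j < k, written without the unit.\<close>
  define Z where "Z k = (\<Sum>j<k. ?e j)" for k
  have ZA: "Z k \<in> fibre B 0" for k unfolding Z_def using \<sigma>A by (intro fibre_sum) simp
  have ZS: "Z (Suc k) = Z k + ?e k" for k by (simp add: Z_def)
  define Y where "Y k = real k *\<^sub>R b - lact g (Z k) b" for k
  have YA: "Y k \<in> fibre B g" for k using ZA b(1) by (simp add: Y_def)
  define c where "c k = \<sigma> - ?e k \<odot> \<sigma>" for k
  have cA: "c k \<in> fibre B 0" for k using \<sigma>A by (simp add: c_def)
  have comm: "\<sigma> \<odot> ?e k = ?e k \<odot> \<sigma>" for k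
  proof (induction k)
    case (Suc k)
    have "\<sigma> \<odot> (?e k \<odot> \<sigma>) = ?e k \<odot> (\<sigma> \<odot> \<sigma>)"
      using \<sigma>A by (simp add: Suc flip: unit_fibre.mul_assoc)
    with Suc show ?case using \<sigma>A by (simp add: unit_fibre.mul_bilinear unit_fibre.mul_assoc)
  qed (use \<sigma>A in simp)
  \<comment> \<open>Geometric series: the sum of (1 - \<sigma>)^j \<sigma>^2 over j < k is \<sigma>
    - (1 - \<sigma>)^k \<sigma>, and \<open>c k\<close> is the last term.\<close>
  have V: "real k *\<^sub>R s2 - Z k \<odot> s2 = \<sigma> - c k" for k
  proof (induction k)
    case 0
    then show ?case using \<sigma>A s2A by (simp add: Z_def c_def)
  next
    case (Suc k)
    have "real (Suc k) *\<^sub>R s2 - Z (Suc k) \<odot> s2 = (real k *\<^sub>R s2 - Z k \<odot> s2) + (s2 - ?e k \<odot> s2)"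
      using ZA s2A \<sigma>A by (simp add: ZS unit_fibre.mul_bilinear algebra_simps)
    also have "\<dots> = (\<sigma> - c k) + (s2 - ?e k \<odot> s2)" by (simp only: Suc)
    also have "\<dots> = \<sigma> - c (Suc k)"
      using \<sigma>A s2A by (simp add: c_def unit_fibre.mul_bilinear \<sigma>(2) comm unit_fibre.mul_assoc)
    finally show ?case .
  qed
  have c_decay: "norm (c k) \<le> 1 / real k" if k: "0 < k" for k
  proof (rule unit_fibre.norm_le_mul_bound[OF cA])
    fix x assume x: "x \<in> fibre B 0"
    have eq: "c k \<odot> x = \<sigma> \<odot> x - ?e k \<odot> (\<sigma> \<odot> x)"
      using x \<sigma>A by (simp add: c_def unit_fibre.mul_bilinear unit_fibre.mul_assoc)
    show "norm (c k \<odot> x) \<le> 1 / real k * norm x"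
      unfolding eq using power_unit_decay[OF \<sigma>(1) n\<sigma> x, of k] k by (simp add: le_divide_eq mult.commute)
  qed simp
  have norm_Y_diff: "norm (Y k - Y l) \<le> norm (c k) + norm (c l)" for k l
  proof -
    have "Y k - Y l = (real k - real l) *\<^sub>R b - lact g (Z k - Z l) b"
      using ZA b(1) by (simp add: Y_def fmult_bilinear algebra_simps)
    then have "norm (Y k - Y l) = norm ((real k - real l) *\<^sub>R s2 - (Z k - Z l) \<odot> s2)"
      using transfer[of "Z k - Z l"] ZA by simp
    also have "(real k - real l) *\<^sub>R s2 - (Z k - Z l) \<odot> s2
        = (real k *\<^sub>R s2 - Z k \<odot> s2) - (real l *\<^sub>R s2 - Z l \<odot> s2)"
      using ZA s2A by (simp add: unit_fibre.mul_bilinear algebra_simps)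
    also have "\<dots> = c l - c k" unfolding V by simp
    finally show ?thesis using norm_triangle_ineq4[of "c l" "c k"] by simp
  qed
  have c_lim: "(\<lambda>k. norm (c k)) \<longlonglongrightarrow> 0"
  proof (rule tendsto_sandwich[OF _ _ tendsto_const lim_1_over_n])
    show "\<forall>\<^sub>F k in sequentially. norm (c k) \<le> 1 / of_nat k"
      by (rule eventually_sequentiallyI[of 1]) (simp add: c_decay)
  qed simp
  have "Cauchy Y"
  proof (rule metric_CauchyI)
    fix \<delta> :: real assume "0 < \<delta>"
    then have "0 < \<delta> / 2" by simp
    from LIMSEQ_D[OF c_lim this] obtain N where N: "\<And>k. N \<le> k \<Longrightarrow> norm (c k) < \<delta> / 2" by auto
    have "dist (Y k) (Y l) < \<delta>" if "N \<le> k" "N \<le> l" for k l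
      using norm_Y_diff[of k l] N[OF that(1)] N[OF that(2)] by (simp add: dist_norm)
    then show "\<exists>N. \<forall>k\<ge>N. \<forall>l\<ge>N. dist (Y k) (Y l) < \<delta>" by blast
  qed
  then obtain y where y: "y \<in> fibre B g" "Y \<longlonglongrightarrow> y"
    using fibre_complete[of g, unfolded complete_def, rule_format, of Y] YA by blast
  have "norm y \<le> 2"
  proof (rule LIMSEQ_le_const2[OF tendsto_norm[OF y(2)]], intro exI allI impI)
    fix k assume "(1::nat) \<le> k"
    then have "norm (c k) \<le> 1 / real k" "1 / real k \<le> 1" by (auto intro: c_decay)
    moreover have "norm (Y k) = norm (\<sigma> - c k)" using transfer[OF ZA] V by (simp add: Y_def)
    ultimately show "norm (Y k) \<le> 2"
      using norm_triangle_ineq4[of \<sigma> "c k"] n\<sigma> by simp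
  qed
  moreover have "lact g \<sigma> y = b"
  proof (rule LIMSEQ_unique)
    show "(\<lambda>k. lact g \<sigma> (Y k)) \<longlonglongrightarrow> lact g \<sigma> y"
    proof (rule tendsto_norm_diff_bound)
      show "norm (lact g \<sigma> (Y k) - lact g \<sigma> y) \<le> norm \<sigma> * norm (Y k - y)" for k
        using norm_fmult[OF \<sigma>A, of "Y k - y" g] YA y(1) \<sigma>A by (simp add: fmult_bilinear)
      show "(\<lambda>k. norm \<sigma> * norm (Y k - y)) \<longlonglongrightarrow> 0"
        by (rule tendsto_mult_right_zero[OF tendsto_norm_zero[OF LIM_zero[OF y(2)]]])
    qed
    show "(\<lambda>k. lact g \<sigma> (Y k)) \<longlonglongrightarrow> b"
    proof (rule tendsto_norm_diff_bound)
      show "(\<lambda>k. norm (c k) * norm \<sigma>) \<longlonglongrightarrow> 0" by (rule tendsto_mult_left_zero[OF c_lim])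
      fix k
      \<comment> \<open>\<sigma> times the geometric sum is 1 - (1 - \<sigma>)^k.\<close>
      have "lact g \<sigma> (Y k) = lact g (?e k) b"
      proof (induction k)
        case 0
        then show ?case using b(1) \<sigma>A by (simp add: Y_def Z_def)
      next
        case (Suc k)
        have "Y (Suc k) = Y k + (b - lact g (?e k) b)"
          using ZA b(1) \<sigma>A by (simp add: Y_def ZS fmult_bilinear algebra_simps)
        then show ?case using Suc YA b(1) \<sigma>A by (simp add: fmult_bilinear lact_lact)
      qed
      then have eq: "lact g \<sigma> (Y k) - b = (-1) *\<^sub>R b - lact g (- ?e k) b"
        using b(1) \<sigma>A by (simp add: fmult_bilinear)
      have "norm (lact g \<sigma> (Y k) - b) = norm ((-1) *\<^sub>R s2 - (- ?e k) \<odot> s2)"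
        unfolding eq by (rule transfer) (use \<sigma>A in simp)
      also have "(-1) *\<^sub>R s2 - (- ?e k) \<odot> s2 = - (c k \<odot> \<sigma>)"
        using \<sigma>A s2A by (simp add: c_def unit_fibre.mul_bilinear unit_fibre.mul_assoc \<sigma>(2))
      also have "norm (- (c k \<odot> \<sigma>)) \<le> norm (c k) * norm \<sigma>" using norm_fmult[OF cA \<sigma>A] by simp
      finally show "norm (lact g \<sigma> (Y k) - b) \<le> norm (c k) * norm \<sigma>" .
    qed
  qed
  ultimately show thesis using that \<sigma>A \<sigma>s n\<sigma> y(1) by blast
qed

end

section \<open>Finitely supported sections\<close>

text \<open>The integrated form of a family of maps on the fibres; for T = j it is the canonical map
  from sections to the cross-sectional algebra.\<close>

definition section_sum :: "('g \<Rightarrow> 'b \<Rightarrow> 'z::comm_monoid_add) \<Rightarrow> ('g \<Rightarrow> 'b::zero) \<Rightarrow> 'z"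
  where "section_sum T f = (\<Sum>g | f g \<noteq> 0. T g (f g))"

lemma section_sum_superset:
  assumes "finite F" "{g. f g \<noteq> 0} \<subseteq> F" "\<And>g. T g 0 = 0"
  shows "section_sum T f = (\<Sum>g\<in>F. T g (f g))"
  unfolding section_sum_def using assms by (intro sum.mono_neutral_left) auto

definition delta :: "'g \<Rightarrow> 'b \<Rightarrow> 'g \<Rightarrow> 'b::zero"
  where "delta g b = (\<lambda>t. if t = g then b else 0)"

lemma section_sum_delta: "T g 0 = 0 \<Longrightarrow> section_sum T (delta g b) = T g b"
proof -
  assume "T g 0 = 0"
  moreover have "{t. delta g b t \<noteq> 0} = (if b = 0 then {} else {g})" by (auto simp: delta_def)
  ultimately show ?thesis by (simp add: section_sum_def delta_def)
qed

context fell_bundle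
begin

text \<open>Additivity instead of complex linearity, because the pairings
  \<open>lip (act1 s c L) L'\<close> treated below are conjugate linear in c.\<close>

definition fibre_additive :: "('g \<Rightarrow> 'b \<Rightarrow> 'z::ab_group_add) \<Rightarrow> bool"
  where "fibre_additive T \<longleftrightarrow> (\<forall>g. \<forall>x\<in>fibre B g. \<forall>y\<in>fibre B g. T g (x + y) = T g x + T g y)"

lemma fibre_additiveD:
  assumes "fibre_additive T"
  shows "x \<in> fibre B g \<Longrightarrow> y \<in> fibre B g \<Longrightarrow> T g (x + y) = T g x + T g y" and "T g 0 = 0"
proof -
  show add: "T g (x + y) = T g x + T g y" if "x \<in> fibre B g" "y \<in> fibre B g" for x y
    using assms that unfolding fibre_additive_def by blast
  show "T g 0 = 0" using add[of 0 0] by simp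
qed

lemma fibre_additive_sum:
  assumes T: "fibre_additive T" and u: "\<And>i. i \<in> I \<Longrightarrow> u i \<in> fibre B g"
  shows "T g (\<Sum>i\<in>I. u i) = (\<Sum>i\<in>I. T g (u i))"
  using u
proof (induction I rule: infinite_finite_induct)
  case (insert i I)
  then show ?case using fibre_additiveD(1)[OF T, of "u i" g "sum u I"] fibre_sum[of I u g] by simp
qed (simp_all add: fibre_additiveD[OF T])

lemma sectionsD: "f \<in> sections B \<Longrightarrow> f g \<in> fibre B g" "f \<in> sections B \<Longrightarrow> finite {g. f g \<noteq> 0}"
  by (simp_all add: sections_def)

lemma delta_section: "b \<in> fibre B g \<Longrightarrow> delta g b \<in> sections B"
proof -
  assume "b \<in> fibre B g"
  moreover have "finite {t. delta g b t \<noteq> 0}"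
    by (rule finite_subset[of _ "{g}"]) (auto simp: delta_def)
  ultimately show ?thesis by (auto simp: sections_def delta_def)
qed

lemma section_add: "f \<in> sections B \<Longrightarrow> h \<in> sections B \<Longrightarrow> (\<lambda>g. f g + h g) \<in> sections B"
proof -
  assume f: "f \<in> sections B" and h: "h \<in> sections B"
  have "finite {g. f g + h g \<noteq> 0}"
    by (rule finite_subset[of _ "{g. f g \<noteq> 0} \<union> {g. h g \<noteq> 0}"]) (use f h in \<open>auto simp: sections_def\<close>)
  with f h show ?thesis by (simp add: sections_def)
qed

lemma section_scaleC: "f \<in> sections B \<Longrightarrow> (\<lambda>g. c *\<^sub>C f g) \<in> sections B"
proof -
  assume f: "f \<in> sections B"
  have "finite {g. c *\<^sub>C f g \<noteq> 0}"
    by (rule finite_subset[of _ "{g. f g \<noteq> 0}"]) (use f in \<open>auto simp: sections_def\<close>)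
  with f show ?thesis by (simp add: sections_def)
qed

lemma section_sum_add:
  assumes T: "fibre_additive T" and f: "f \<in> sections B" and h: "h \<in> sections B"
  shows "section_sum T (\<lambda>g. f g + h g) = section_sum T f + section_sum T h"
proof -
  let ?F = "{g. f g \<noteq> 0} \<union> {g. h g \<noteq> 0}"
  have F: "finite ?F" using f h by (simp add: sections_def)
  note T0 = fibre_additiveD(2)[OF T]
  have "section_sum T (\<lambda>g. f g + h g) = (\<Sum>g\<in>?F. T g (f g + h g))"
    by (rule section_sum_superset[where T = T, OF F _ T0]) auto
  also have "\<dots> = (\<Sum>g\<in>?F. T g (f g)) + (\<Sum>g\<in>?F. T g (h g))"
    by (simp add: sum.distrib fibre_additiveD(1)[OF T] sectionsD(1)[OF f] sectionsD(1)[OF h])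
  also have "(\<Sum>g\<in>?F. T g (f g)) = section_sum T f"
    by (rule section_sum_superset[where T = T, OF F _ T0, symmetric]) auto
  also have "(\<Sum>g\<in>?F. T g (h g)) = section_sum T h"
    by (rule section_sum_superset[where T = T, OF F _ T0, symmetric]) auto
  finally show ?thesis .
qed

lemma section_sum_scaleC:
  assumes f: "f \<in> sections B" and T0: "\<And>g. T g 0 = 0"
    and T: "\<And>g x. x \<in> fibre B g \<Longrightarrow> T g (c *\<^sub>C x) = d *\<^sub>C T g x"
  shows "section_sum T (\<lambda>g. c *\<^sub>C f g) = d *\<^sub>C section_sum T f"
proof -
  have "section_sum T (\<lambda>g. c *\<^sub>C f g) = (\<Sum>g | f g \<noteq> 0. T g (c *\<^sub>C f g))"
    by (rule section_sum_superset[where T = T, OF sectionsD(2)[OF f] _ T0]) auto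
  also have "\<dots> = d *\<^sub>C section_sum T f"
    unfolding section_sum_def using sectionsD(1)[OF f]
    by (simp add: T clinear_on_sum[of UNIV "\<lambda>x. d *\<^sub>C x"] clinear_on_def scaleC_add_right scaleC_scaleC mult.commute)
  finally show ?thesis .
qed

lemma section_mult_term_closed:
  assumes "f \<in> sections B" "h \<in> sections B"
  shows "fmult B s (- s + t) (f s) (h (- s + t)) \<in> fibre B t"
  using fmult_closed[OF sectionsD(1)[OF assms(1), of s] sectionsD(1)[OF assms(2), of "- s + t"]]
  by (simp flip: add.assoc)

lemma section_mult_support:
  assumes f: "f \<in> sections B" and h: "h \<in> sections B"
  shows "{t. section_mult B f h t \<noteq> 0} \<subseteq> (\<lambda>(s, r). s + r) ` ({s. f s \<noteq> 0} \<times> {r. h r \<noteq> 0})"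
proof
  fix t assume "t \<in> {t. section_mult B f h t \<noteq> 0}"
  then obtain s where s: "f s \<noteq> 0" "fmult B s (- s + t) (f s) (h (- s + t)) \<noteq> 0"
    unfolding section_mult_def using sum.not_neutral_contains_not_neutral by force
  then have "h (- s + t) \<noteq> 0" using sectionsD(1)[OF f, of s] by auto
  moreover have "t = s + (- s + t)" by (simp flip: add.assoc)
  ultimately show "t \<in> (\<lambda>(s, r). s + r) ` ({s. f s \<noteq> 0} \<times> {r. h r \<noteq> 0})"
    using s(1) by (intro image_eqI[of _ _ "(s, - s + t)"]) auto
qed

lemma section_mult_section:
  assumes f: "f \<in> sections B" and h: "h \<in> sections B"
  shows "section_mult B f h \<in> sections B"
proof -
  have "finite {t. section_mult B f h t \<noteq> 0}"
    using finite_subset[OF section_mult_support[OF f h]] sectionsD(2)[OF f] sectionsD(2)[OF h] by simp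
  moreover have "section_mult B f h t \<in> fibre B t" for t
    unfolding section_mult_def by (intro fibre_sum section_mult_term_closed f h)
  ultimately show ?thesis by (simp add: sections_def)
qed

text \<open>Additivity moves T inside the convolution; then the sums are interchanged and t = s + r
  is substituted.\<close>

lemma section_sum_mult:
  assumes T: "fibre_additive T" and f: "f \<in> sections B" and h: "h \<in> sections B"
  shows "section_sum T (section_mult B f h) = section_sum (\<lambda>s a. section_sum (\<lambda>r b. T (s + r) (fmult B s r a b)) h) f"
proof -
  let ?S = "{s. f s \<noteq> 0}" and ?R = "{r. h r \<noteq> 0}"
  let ?W = "(\<lambda>(s, r). s + r) ` (?S \<times> ?R)"
  have W: "finite ?W" using sectionsD(2)[OF f] sectionsD(2)[OF h] by simp
  note T0 = fibre_additiveD(2)[OF T]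
  have "section_sum T (section_mult B f h) = (\<Sum>t\<in>?W. T t (section_mult B f h t))"
    by (rule section_sum_superset[where T = T, OF W section_mult_support[OF f h] T0])
  also have "\<dots> = (\<Sum>t\<in>?W. \<Sum>s\<in>?S. T t (fmult B s (- s + t) (f s) (h (- s + t))))"
    unfolding section_mult_def
    by (intro sum.cong refl fibre_additive_sum[OF T] section_mult_term_closed f h)
  also have "\<dots> = (\<Sum>s\<in>?S. \<Sum>t\<in>?W. T t (fmult B s (- s + t) (f s) (h (- s + t))))"
    by (rule sum.swap)
  also have "\<dots> = (\<Sum>s\<in>?S. \<Sum>r\<in>?R. T (s + r) (fmult B s r (f s) (h r)))"
  proof (rule sum.cong[OF refl])
    fix s assume s: "s \<in> ?S"
    have "(\<Sum>t\<in>?W. T t (fmult B s (- s + t) (f s) (h (- s + t))))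
        = (\<Sum>t\<in>(\<lambda>r. s + r) ` ?R. T t (fmult B s (- s + t) (f s) (h (- s + t))))"
    proof (rule sum.mono_neutral_right[OF W])
      show "(\<lambda>r. s + r) ` ?R \<subseteq> ?W" using s by auto
      show "\<forall>t\<in>?W - (\<lambda>r. s + r) ` ?R. T t (fmult B s (- s + t) (f s) (h (- s + t))) = 0"
      proof
        fix t assume "t \<in> ?W - (\<lambda>r. s + r) ` ?R"
        moreover have "t = s + (- s + t)" by (simp flip: add.assoc)
        ultimately have "h (- s + t) = 0" by blast
        then show "T t (fmult B s (- s + t) (f s) (h (- s + t))) = 0"
          using sectionsD(1)[OF f, of s] by (simp add: T0)
      qed
    qed
    also have "\<dots> = (\<Sum>r\<in>?R. T (s + r) (fmult B s r (f s) (h r)))"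
      by (subst sum.reindex) (auto simp: inj_on_def simp flip: add.assoc)
    finally show "(\<Sum>t\<in>?W. T t (fmult B s (- s + t) (f s) (h (- s + t))))
        = (\<Sum>r\<in>?R. T (s + r) (fmult B s r (f s) (h r)))" .
  qed
  finally show ?thesis by (simp add: section_sum_def)
qed

lemma section_star_section:
  assumes f: "f \<in> sections B"
  shows "section_star B f \<in> sections B"
    and "{t. section_star B f t \<noteq> 0} = uminus ` {s. f s \<noteq> 0}"
proof -
  have "fstar B s (f s) = 0 \<longleftrightarrow> f s = 0" for s
    using norm_fstar[OF sectionsD(1)[OF f, of s]] by (metis norm_eq_zero)
  then have supp: "section_star B f t \<noteq> 0 \<longleftrightarrow> f (- t) \<noteq> 0" for t by (simp add: section_star_def)
  show eq: "{t. section_star B f t \<noteq> 0} = uminus ` {s. f s \<noteq> 0}"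
  proof (intro equalityI subsetI)
    fix t assume "t \<in> {t. section_star B f t \<noteq> 0}"
    then show "t \<in> uminus ` {s. f s \<noteq> 0}" by (intro image_eqI[of _ _ "- t"]) (simp_all add: supp)
  qed (auto simp: supp)
  have "section_star B f t \<in> fibre B t" for t
    using fstar_closed[OF sectionsD(1)[OF f, of "- t"]] by (simp add: section_star_def)
  then show "section_star B f \<in> sections B"
    using sectionsD(2)[OF f] by (simp add: sections_def eq)
qed

lemma section_sum_star:
  assumes f: "f \<in> sections B"
  shows "section_sum T (section_star B f) = section_sum (\<lambda>s a. T (- s) (fstar B s a)) f"
  unfolding section_sum_def section_star_section(2)[OF f]
  by (subst sum.reindex) (auto simp: section_star_def)

lemma section_mult_delta:
  assumes "b \<in> fibre B g" "c \<in> fibre B h"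
  shows "section_mult B (delta g b) (delta h c) = delta (g + h) (fmult B g h b c)"
proof
  fix t
  show "section_mult B (delta g b) (delta h c) t = delta (g + h) (fmult B g h b c) t"
  proof (cases "b = 0")
    case True
    then show ?thesis using assms by (simp add: section_mult_def delta_def)
  next
    case False
    then have "{s. delta g b s \<noteq> 0} = {g}" by (auto simp: delta_def)
    moreover have "- g + t = h \<longleftrightarrow> t = g + h" by (metis add.assoc add.left_inverse add.right_inverse add_0)
    ultimately show ?thesis using assms by (simp add: section_mult_def delta_def)
  qed
qed

lemma section_star_delta: "section_star B (delta g b) = delta (- g) (fstar B g b)"
  by (auto simp: section_star_def delta_def fun_eq_iff)

section \<open>The universal norm\<close>

lemma cstar_seminormD:
  assumes "cstar_seminorm B p"
  shows "f \<in> sections B \<Longrightarrow> 0 \<le> p f" "f \<in> sections B \<Longrightarrow> p (\<lambda>g. c *\<^sub>C f g) = cmod c * p f"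
    "f \<in> sections B \<Longrightarrow> h \<in> sections B \<Longrightarrow> p (\<lambda>g. f g + h g) \<le> p f + p h"
    "f \<in> sections B \<Longrightarrow> p (section_mult B (section_star B f) f) = (p f)\<^sup>2"
  using assms unfolding cstar_seminorm_def by blast+

text \<open>On the unit fibre this is automatic contractivity; other fibres reduce to it through b^*
  b. It makes the supremum in \<open>universal_norm\<close> finite and the maps j g
  contractive.\<close>

lemma cstar_seminorm_delta_le:
  assumes p: "cstar_seminorm B p" and b: "b \<in> fibre B g"
  shows "p (delta g b) \<le> norm b"
proof -
  note D = cstar_seminormD[OF p delta_section]
  have sq: "(p (delta g x))\<^sup>2 = p (delta 0 (fmult B (- g) g (fstar B g x) x))" if "x \<in> fibre B g" for g x
    using D(4)[OF that] section_mult_delta[OF fstar_closed[OF that] that] by (simp add: section_star_delta)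
  have unit: "p (delta 0 x) \<le> norm x" if "x \<in> fibre B 0" for x
  proof (rule unit_fibre.cstar_compatible_contractive[where q = "\<lambda>x. p (delta 0 x)", OF _ _ that])
    show sq0: "(p (delta 0 x))\<^sup>2 = p (delta 0 (fstar B 0 x \<odot> x))" if "x \<in> fibre B 0" for x
      using sq[OF that] by simp
    have "p (delta 0 (x + y)) \<le> p (delta 0 x) + p (delta 0 y)" if "x \<in> fibre B 0" "y \<in> fibre B 0" for x y
    proof -
      have "delta 0 (x + y) = (\<lambda>g. delta (0::'g) x g + delta 0 y g)" by (auto simp: delta_def)
      then show ?thesis using cstar_seminormD(3)[OF p delta_section[OF that(1)] delta_section[OF that(2)]] by simp
    qed
    moreover have "p (delta 0 (c *\<^sub>C x)) = cmod c * p (delta 0 x)" if "x \<in> fibre B 0" for x c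
    proof -
      have "delta 0 (c *\<^sub>C x) = (\<lambda>g. c *\<^sub>C delta (0::'g) x g)" by (auto simp: delta_def)
      then show ?thesis using D(2)[OF that] by simp
    qed
    ultimately show "unit_fibre.cstar_compatible (\<lambda>x. p (delta 0 x))"
      unfolding unit_fibre.cstar_compatible_def
      by (auto simp: sq0 D(1) intro!: exI[of _ "\<lambda>y. p (delta 0 y)"])
  qed
  have "(p (delta g b))\<^sup>2 \<le> (norm b)\<^sup>2"
    using sq[OF b] unit[of "fmult B (- g) g (fstar B g b) b"] norm_fstar_fmult[OF b]
      fmult_closed[OF fstar_closed[OF b] b] by simp
  then show ?thesis by (rule power2_le_imp_le) simp
qed

lemma cstar_seminorm_bound:
  assumes p: "cstar_seminorm B p" and f: "f \<in> sections B"
  shows "p f \<le> (\<Sum>g | f g \<noteq> 0. norm (f g))"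
proof -
  have "(\<lambda>t. if t \<in> F then f t else 0) \<in> sections B \<and> p (\<lambda>t. if t \<in> F then f t else 0) \<le> (\<Sum>g\<in>F. norm (f g))"
    if "finite F" for F
    using that
  proof (induction F)
    case empty
    have "(\<lambda>t. 0) \<in> sections B" by (simp add: sections_def)
    then show ?case using cstar_seminormD(2)[OF p, of "\<lambda>t. 0" 0] by simp
  next
    case (insert g F)
    have eq: "(\<lambda>t. if t \<in> insert g F then f t else 0) = (\<lambda>t. delta g (f g) t + (if t \<in> F then f t else 0))"
      using insert by (auto simp: delta_def)
    note d = delta_section[OF sectionsD(1)[OF f, of g]] and IH = insert.IH
    show ?case
      unfolding eq
      using section_add[OF d conjunct1[OF IH]] cstar_seminormD(3)[OF p d conjunct1[OF IH]] IH
        cstar_seminorm_delta_le[OF p sectionsD(1)[OF f, of g]] insert.hyps by simp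
  qed
  moreover have "(\<lambda>t. if t \<in> {g. f g \<noteq> 0} then f t else 0) = f" by auto
  ultimately show ?thesis using sectionsD(2)[OF f] by metis
qed

lemma cstar_seminorm_zero: "cstar_seminorm B (\<lambda>f. 0)"
  by (simp add: cstar_seminorm_def)

lemma cstar_seminorm_le_universal:
  assumes "cstar_seminorm B p" "f \<in> sections B"
  shows "p f \<le> universal_norm B f"
  unfolding universal_norm_def
proof (rule cSUP_upper)
  show "bdd_above ((\<lambda>p. p f) ` {p. cstar_seminorm B p})"
    using cstar_seminorm_bound[OF _ assms(2)] by (intro bdd_aboveI2) auto
qed (use assms in simp)

lemma universal_norm_delta_le: "b \<in> fibre B g \<Longrightarrow> universal_norm B (delta g b) \<le> norm b"
  unfolding universal_norm_def
  using cstar_seminorm_zero cstar_seminorm_delta_le by (intro cSUP_least) auto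

end

section \<open>Fibres inside the cross-sectional algebra, and integrated representations\<close>

locale cross_sectional_algebra = fell_bundle B
  for B :: "('g::group_add, 'b::complex_normed_vector) bundle_data" +
  fixes j :: "'g \<Rightarrow> 'b \<Rightarrow> 'p::cstar_algebra"
  assumes full: "full_cross_sectional_algebra B j"
begin

lemma j_linear: "clinear_on (fibre B g) (j g)"
  and j_mult: "x \<in> fibre B g \<Longrightarrow> y \<in> fibre B h \<Longrightarrow> j g x * j h y = j (g + h) (fmult B g h x y)"
  and j_star: "x \<in> fibre B g \<Longrightarrow> adj (j g x) = j (- g) (fstar B g x)"
  and norm_section_sum: "f \<in> sections B \<Longrightarrow> norm (section_sum j f) = universal_norm B f"
  and dense: "closure (section_sum j ` sections B) = UNIV"
  using full unfolding full_cross_sectional_algebra_def section_sum_def by blast+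

lemmas j_simps = clinear_on_add[OF j_linear] clinear_on_scaleC[OF j_linear]
  clinear_on_scaleR[OF j_linear] clinear_on_0[OF j_linear fibre_csubspace]
  clinear_on_diff[OF j_linear fibre_csubspace] clinear_on_uminus[OF j_linear]

lemma fibre_additive_j: "fibre_additive j"
  by (simp add: fibre_additive_def j_simps)

lemma norm_j_eq: "b \<in> fibre B g \<Longrightarrow> norm (j g b) = universal_norm B (delta g b)"
  using norm_section_sum[OF delta_section, of b g] by (simp add: section_sum_delta j_simps)

lemma norm_j_le: "b \<in> fibre B g \<Longrightarrow> norm (j g b) \<le> norm b"
  using norm_j_eq universal_norm_delta_le by simp

end

context fell_representation
begin

lemma fibre_additive_rep: "fibre_additive \<pi>"
  by (simp add: fibre_additive_def rep_simps)

lemma section_sum_rep_mult: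
  assumes "f \<in> sections B" "h \<in> sections B"
  shows "section_sum \<pi> (section_mult B f h) = section_sum \<pi> f o\<^sub>L section_sum \<pi> h"
proof -
  interpret c: bounded_bilinear "(o\<^sub>L) :: ('h \<Rightarrow>\<^sub>L 'h) \<Rightarrow> ('h \<Rightarrow>\<^sub>L 'h) \<Rightarrow> _"
    by (rule bounded_bilinear_blinfun_compose)
  show ?thesis
    unfolding section_sum_mult[OF fibre_additive_rep assms]
    unfolding section_sum_def c.sum_left
    unfolding c.sum_right
    using sectionsD(1)[OF assms(1)] sectionsD(1)[OF assms(2)] by (simp add: rep_mult)
qed

lemma section_sum_rep_star:
  assumes f: "f \<in> sections B"
  shows "cinner (section_sum \<pi> f \<xi>) \<eta> = cinner \<xi> (section_sum \<pi> (section_star B f) \<eta>)"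
  unfolding section_sum_star[OF f]
  unfolding section_sum_def blinfun.sum_left cinner_sum_left cinner_sum_right
  by (intro sum.cong refl rep_adjoint sectionsD(1)[OF f])

lemma cstar_seminorm_rep: "cstar_seminorm B (\<lambda>f. norm (section_sum \<pi> f))"
  unfolding cstar_seminorm_def
proof (intro conjI ballI allI)
  fix f h c assume f: "f \<in> sections B"
  show "norm (section_sum \<pi> (\<lambda>g. c *\<^sub>C f g)) = cmod c * norm (section_sum \<pi> f)"
    by (subst section_sum_scaleC[OF f, where d = c]) (simp_all add: rep_simps norm_scaleC)
  show "norm (section_sum \<pi> (section_star B f)) = norm (section_sum \<pi> f)"
    by (rule adjoint_operator_norms(1)[OF section_sum_rep_star[OF f]])
  show "norm (section_sum \<pi> (section_mult B (section_star B f) f)) = (norm (section_sum \<pi> f))\<^sup>2"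
    unfolding section_sum_rep_mult[OF section_star_section(1)[OF f] f]
    by (rule adjoint_operator_norms(2)[OF section_sum_rep_star[OF f]])
  assume h: "h \<in> sections B"
  show "norm (section_sum \<pi> (\<lambda>g. f g + h g)) \<le> norm (section_sum \<pi> f) + norm (section_sum \<pi> h)"
    unfolding section_sum_add[OF fibre_additive_rep f h] by (rule norm_triangle_ineq)
  show "norm (section_sum \<pi> (section_mult B f h)) \<le> norm (section_sum \<pi> f) * norm (section_sum \<pi> h)"
    unfolding section_sum_rep_mult[OF f h] by (rule norm_blinfun_compose)
qed simp

end

text \<open>The integrated form of \<pi> gives a C*-seminorm, which lies below the universal norm,
  and \<pi> is isometric on fibres. With \<open>norm_j_le\<close> for a cross-sectional algebra, the
  fibres embed isometrically into it.\<close>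

lemma (in faithful_fell_representation) norm_le_universal_norm_delta:
  assumes b: "b \<in> fibre B g"
  shows "norm b \<le> universal_norm B (delta g b)"
  using cstar_seminorm_le_universal[OF cstar_seminorm_rep delta_section[OF b]] norm_rep[OF b]
  by (simp add: section_sum_delta rep_simps)

section \<open>The Hilbert module of a completely positive map\<close>

text \<open>Complete positivity is recorded for the matrices with entries b i^* b j, because these
  are the Gram matrices that the inner product below needs.\<close>

locale cp_map = fell_bundle B
  for B :: "('g::group_add, 'b::complex_normed_vector) bundle_data" +
  fixes \<psi> :: "'g \<Rightarrow> 'b \<Rightarrow> 'q::cstar_algebra"
  assumes \<psi>_linear: "clinear_on (fibre B g) (\<psi> g)"
    and \<psi>_positive: "\<And>n d b. (\<And>i. i < n \<Longrightarrow> b i \<in> fibre B (d i)) \<Longrightarrow>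
      positive_matrix n (\<lambda>i j. \<psi> (- d i + d j) (fmult B (- d i) (d j) (fstar B (d i) (b i)) (b j)))"
begin

lemmas \<psi>_simps = clinear_on_add[OF \<psi>_linear] clinear_on_scaleC[OF \<psi>_linear]
  clinear_on_scaleR[OF \<psi>_linear] clinear_on_0[OF \<psi>_linear fibre_csubspace]
  clinear_on_diff[OF \<psi>_linear fibre_csubspace] clinear_on_uminus[OF \<psi>_linear]

definition kern :: "'g \<Rightarrow> 'b \<Rightarrow> 'g \<Rightarrow> 'b \<Rightarrow> 'q"
  where "kern g b g' b' = \<psi> (- g + g') (fmult B (- g) g' (fstar B g b) b')"

lemma kern_positive_matrix:
  "(\<And>i. i < n \<Longrightarrow> b i \<in> fibre B (d i)) \<Longrightarrow> positive_matrix n (\<lambda>i j. kern (d i) (b i) (d j) (b j))"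
  using \<psi>_positive unfolding kern_def by blast

lemma kern_inner_closed:
  "b \<in> fibre B g \<Longrightarrow> b' \<in> fibre B g' \<Longrightarrow> fmult B (- g) g' (fstar B g b) b' \<in> fibre B (- g + g')"
  by (intro fmult_closed fstar_closed)

text \<open>Symmetry is not among the hypotheses on \<psi>; it is read off the off-diagonal entries
  of a positive 2 x 2 matrix.\<close>

lemma adj_kern:
  assumes "b \<in> fibre B g" "b' \<in> fibre B g'"
  shows "adj (kern g b g' b') = kern g' b' g b"
proof -
  let ?d = "\<lambda>i::nat. if i = 0 then g else g'" and ?b = "\<lambda>i::nat. if i = 0 then b else b'"
  have "positive_matrix 2 (\<lambda>i j. kern (?d i) (?b i) (?d j) (?b j))"
    by (rule kern_positive_matrix) (use assms in simp)
  from adj_entry[OF positive_matrix_form[OF this], of 0 1] show ?thesis by simp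
qed

lemma kern_additive:
  assumes "b' \<in> fibre B g'"
  shows "b1 \<in> fibre B g \<Longrightarrow> b2 \<in> fibre B g \<Longrightarrow> kern g (b1 + b2) g' b' = kern g b1 g' b' + kern g b2 g' b'"
    and "b1 \<in> fibre B g \<Longrightarrow> kern g (c *\<^sub>C b1) g' b' = cnj c *\<^sub>C kern g b1 g' b'"
  using assms by (simp_all add: kern_def fstar_add fstar_scaleC fmult_bilinear fstar_closed \<psi>_simps fmult_closed)

lemma kern_mult:
  assumes "c \<in> fibre B s" "b \<in> fibre B g" "b' \<in> fibre B g'"
  shows "kern (s + g) (fmult B s g c b) g' b' = kern g b (- s + g') (fmult B (- s) g' (fstar B s c) b')"
  unfolding kern_def fstar_fmult[OF assms(1,2)] minus_add add.assoc
  using fmult_assoc[OF fstar_closed[OF assms(2)] fstar_closed[OF assms(1)] assms(3)]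
  by simp

text \<open>A list of triples \<open>(g, b, x)\<close> stands for \<open>\<Sum> b \<otimes> x\<close>, where \<open>b \<in> B\<^sub>g\<close> and \<open>x\<close> is in the
  target algebra; the inner product is determined by
  \<open>\<langle>b \<otimes> x, b' \<otimes> x'\<rangle> = x\<^sup>* \<psi>(b\<^sup>* b') x'\<close>.\<close>

definition ev :: "('g \<times> 'b \<times> 'q) list \<Rightarrow> ('g \<Rightarrow> 'b \<Rightarrow> 'q \<Rightarrow> 'z::comm_monoid_add) \<Rightarrow> 'z"
  where "ev L T = (\<Sum>(g, b, x)\<leftarrow>L. T g b x)"

definition lip :: "('g \<times> 'b \<times> 'q) list \<Rightarrow> ('g \<times> 'b \<times> 'q) list \<Rightarrow> 'q"
  where "lip L L' = ev L (\<lambda>g b x. ev L' (\<lambda>g' b' x'. adj x * kern g b g' b' * x'))"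

definition valid :: "('g \<times> 'b \<times> 'q) list \<Rightarrow> bool"
  where "valid L \<longleftrightarrow> (\<forall>(g, b, x)\<in>set L. b \<in> fibre B g)"

lemma ev_simps [simp]: "ev [] T = 0" "ev ((g, b, x) # L) T = T g b x + ev L T" "ev (L @ L') T = ev L T + ev L' T"
  by (simp_all add: ev_def)

lemma valid_simps [simp]: "valid []" "valid ((g, b, x) # L) \<longleftrightarrow> b \<in> fibre B g \<and> valid L"
  "valid (L @ L') \<longleftrightarrow> valid L \<and> valid L'"
  by (simp_all add: valid_def ball_Un)

lemma ev_cong:
  "valid L \<Longrightarrow> (\<And>g b x. b \<in> fibre B g \<Longrightarrow> T g b x = T' g b x) \<Longrightarrow> ev L T = ev L T'"
  by (induction L) auto

lemma ev_add: "ev L (\<lambda>g b x. T g b x + T' g b x) = ev L T + (ev L T' :: 'z::comm_monoid_add)"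
  by (induction L) (auto simp: add_ac)

lemma ev_ev_swap: "ev L (\<lambda>g b x. ev L' (T g b x)) = ev L' (\<lambda>g' b' x'. ev L (\<lambda>g b x. T g b x g' b' x'))"
proof (induction L)
  case Nil
  show ?case by (induction L') auto
next
  case (Cons a L)
  then show ?case by (cases a) (simp add: ev_add)
qed

lemma lip_append [simp]: "lip (L1 @ L2) L = lip L1 L + lip L2 L" "lip L (L1 @ L2) = lip L L1 + lip L L2"
  by (simp_all add: lip_def ev_add)

lemma lip_Nil [simp]: "lip [] L = 0" "lip L [] = 0"
proof -
  show "lip [] L = 0" by (simp add: lip_def)
  show "lip L [] = 0" unfolding lip_def by (induction L) auto
qed

lemma ev_hom:
  assumes "\<And>x y. h (x + y) = h x + h y" "h 0 = 0"
  shows "ev L (\<lambda>g b x. h (T g b x)) = h (ev L T)"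
  using assms by (induction L) auto

lemma adj_lip:
  assumes "valid L" "valid L'"
  shows "adj (lip L L') = lip L' L"
proof -
  have "adj (lip L L') = ev L (\<lambda>g b x. ev L' (\<lambda>g' b' x'. adj (adj x * kern g b g' b' * x')))"
    unfolding lip_def by (simp add: ev_hom[of adj] adj_add)
  also have "\<dots> = ev L (\<lambda>g b x. ev L' (\<lambda>g' b' x'. adj x' * kern g' b' g b * x))"
    by (intro ev_cong assms) (simp add: adj_mult adj_adj adj_kern mult.assoc)
  also have "\<dots> = lip L' L" unfolding lip_def by (rule ev_ev_swap)
  finally show ?thesis .
qed

lemma ev_nth: "ev L T = (\<Sum>i<length L. case L ! i of (g, b, x) \<Rightarrow> T g b x)"
  by (simp add: ev_def sum_list_sum_nth atLeast0LessThan)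

lemma lip_positive:
  assumes "valid L"
  shows "cstar.positive (lip L L)"
proof -
  let ?n = "length L" and ?g = "\<lambda>i. fst (L ! i)" and ?b = "\<lambda>i. fst (snd (L ! i))" and ?x = "\<lambda>i. snd (snd (L ! i))"
  have "positive_matrix ?n (\<lambda>i j. kern (?g i) (?b i) (?g j) (?b j))"
  proof (rule kern_positive_matrix)
    fix i assume "i < ?n"
    then have "L ! i \<in> set L" by simp
    then show "?b i \<in> fibre B (?g i)" using assms unfolding valid_def by (auto simp: case_prod_beta)
  qed
  from positive_matrix_form[OF this, of ?x] show ?thesis
    by (simp add: lip_def ev_nth case_prod_beta)
qed

definition rmap :: "('q \<Rightarrow> 'q) \<Rightarrow> ('g \<times> 'b \<times> 'q) list \<Rightarrow> ('g \<times> 'b \<times> 'q) list"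
  where "rmap h L = map (\<lambda>(g, b, x). (g, b, h x)) L"

lemma ev_rmap: "ev (rmap h L) T = ev L (\<lambda>g b x. T g b (h x))"
  by (induction L) (auto simp: rmap_def)

lemma valid_rmap [simp]: "valid (rmap h L) \<longleftrightarrow> valid L"
  by (auto simp: valid_def rmap_def)

lemma lip_rmap:
  "lip L (rmap (\<lambda>x. x * a) L') = lip L L' * a" "lip (rmap (\<lambda>x. x * a) L) L' = adj a * lip L L'"
  "lip L (rmap (\<lambda>x. r *\<^sub>R x) L') = r *\<^sub>R lip L L'" "lip (rmap (\<lambda>x. r *\<^sub>R x) L) L' = r *\<^sub>R lip L L'"
proof -
  show "lip L (rmap (\<lambda>x. x * a) L') = lip L L' * a"
    unfolding lip_def ev_rmap
    by (simp add: ev_hom[of "\<lambda>x. x * a"] distrib_right flip: mult.assoc)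
  show "lip (rmap (\<lambda>x. x * a) L) L' = adj a * lip L L'"
    unfolding lip_def ev_rmap adj_mult ev_hom[of "\<lambda>x. adj a * x", OF distrib_left mult_zero_right, symmetric]
    by (intro arg_cong2[where f = ev] refl ext) (simp add: mult.assoc)
  show "lip L (rmap (\<lambda>x. r *\<^sub>R x) L') = r *\<^sub>R lip L L'"
    unfolding lip_def ev_rmap ev_hom[of "\<lambda>x. r *\<^sub>R x", OF scaleR_add_right scaleR_zero_right, symmetric]
    by (intro arg_cong2[where f = ev] refl ext) simp
  show "lip (rmap (\<lambda>x. r *\<^sub>R x) L) L' = r *\<^sub>R lip L L'"
    unfolding lip_def ev_rmap ev_hom[of "\<lambda>x. r *\<^sub>R x", OF scaleR_add_right scaleR_zero_right, symmetric]
    by (intro arg_cong2[where f = ev] refl ext) simp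
qed

definition lnorm :: "('g \<times> 'b \<times> 'q) list \<Rightarrow> real"
  where "lnorm L = sqrt (norm (lip L L))"

lemma lnorm_nonneg [simp]: "0 \<le> lnorm L"
  and lnorm_square: "(lnorm L)\<^sup>2 = norm (lip L L)"
  by (simp_all add: lnorm_def)

lemma lip_Cauchy_Schwarz:
  assumes L: "valid L" and L': "valid L'"
  shows "norm (lip L L') \<le> lnorm L * lnorm L'"
proof -
  have "(norm (lip L L'))\<^sup>2 \<le> norm (lip L L) * norm (lip L' L')"
  proof (rule module_Cauchy_Schwarz[OF adj_lip[OF L L] lip_positive[OF L']])
    fix t
    let ?a = "lip L L'"
    \<comment> \<open>This list represents \<xi> a - t \<eta>, where \<xi> and \<eta> are the
      vectors represented by L and L'.\<close>
    let ?M = "rmap (\<lambda>x. x * ?a) L @ rmap (\<lambda>x. (- t) *\<^sub>R x) L'"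
    have "cstar.positive (lip ?M ?M)" using L L' by (intro lip_positive) simp
    also have "lip ?M ?M = adj ?a * lip L L * ?a - (2 * t) *\<^sub>R (adj ?a * ?a) + (t * t) *\<^sub>R lip L' L'"
      unfolding lip_append lip_rmap adj_lip[OF L L']
      by (simp add: algebra_simps scaleR_2 flip: scaleR_scaleR)
    finally show "cstar.positive (adj ?a * lip L L * ?a - (2 * t) *\<^sub>R (adj ?a * ?a) + (t * t) *\<^sub>R lip L' L')" .
  qed
  then have "(norm (lip L L'))\<^sup>2 \<le> (lnorm L * lnorm L')\<^sup>2"
    by (simp add: power_mult_distrib lnorm_square)
  then show ?thesis by (rule power2_le_imp_le) simp
qed

lemma lnorm_append:
  assumes L: "valid L" and L': "valid L'"
  shows "lnorm (L @ L') \<le> lnorm L + lnorm L'"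
proof (rule power2_le_imp_le)
  have "lip (L @ L') (L @ L') = (lip L L + lip L L') + (lip L' L + lip L' L')" by simp
  then have "(lnorm (L @ L'))\<^sup>2 \<le> (norm (lip L L) + norm (lip L L')) + (norm (lip L' L) + norm (lip L' L'))"
    unfolding lnorm_square by (simp only:) (intro norm_triangle_mono order_refl)
  also have "\<dots> \<le> ((lnorm L)\<^sup>2 + lnorm L * lnorm L') + (lnorm L * lnorm L' + (lnorm L')\<^sup>2)"
    using lip_Cauchy_Schwarz[OF L L'] lip_Cauchy_Schwarz[OF L' L] by (simp add: lnorm_square mult.commute)
  also have "\<dots> = (lnorm L + lnorm L')\<^sup>2" by (simp add: power2_sum)
  finally show "(lnorm (L @ L'))\<^sup>2 \<le> (lnorm L + lnorm L')\<^sup>2" .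
qed simp

text \<open>Substitute for equality in the quotient by null vectors: lists that pair alike with all
  lists represent the same vector.\<close>

lemma lnorm_eqI:
  assumes "valid L" "valid M" "\<And>L'. valid L' \<Longrightarrow> lip L L' = lip M L'"
  shows "lnorm L = lnorm M"
proof -
  have "lip L L = lip M M"
    using assms(3)[OF assms(1)] assms(3)[OF assms(2)] adj_lip[OF assms(1,2)] adj_lip[OF assms(2,1)]
      adj_lip[OF assms(1,1)] by metis
  then show ?thesis by (simp add: lnorm_def)
qed

subsection \<open>The action of the fibres\<close>

definition act1 :: "'g \<Rightarrow> 'b \<Rightarrow> ('g \<times> 'b \<times> 'q) list \<Rightarrow> ('g \<times> 'b \<times> 'q) list"
  where "act1 s c L = map (\<lambda>(g, b, x). (s + g, fmult B s g c b, x)) L"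

lemma ev_act1: "ev (act1 s c L) T = ev L (\<lambda>g b x. T (s + g) (fmult B s g c b) x)"
  by (induction L) (auto simp: act1_def)

lemma valid_act1: "c \<in> fibre B s \<Longrightarrow> valid L \<Longrightarrow> valid (act1 s c L)"
  by (auto simp: valid_def act1_def intro: fmult_closed)

lemma act1_act1:
  "c \<in> fibre B s \<Longrightarrow> d \<in> fibre B r \<Longrightarrow> valid L \<Longrightarrow> act1 s c (act1 r d L) = act1 (s + r) (fmult B s r c d) L"
  by (induction L) (auto simp: act1_def fmult_assoc add.assoc)

lemma lip_act1_left:
  assumes c: "c \<in> fibre B s" and L: "valid L" and L': "valid L'"
  shows "lip (act1 s c L) L' = lip L (act1 (- s) (fstar B s c) L')"
  unfolding lip_def ev_act1 by (intro ev_cong L L') (simp add: kern_mult[OF c])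

lemma lip_act1_additive:
  assumes L: "valid L" and L': "valid L'"
  shows "c \<in> fibre B s \<Longrightarrow> d \<in> fibre B s \<Longrightarrow> lip (act1 s (c + d) L) L' = lip (act1 s c L) L' + lip (act1 s d L) L'"
    and "c \<in> fibre B s \<Longrightarrow> lip (act1 s (z *\<^sub>C c) L) L' = cnj z *\<^sub>C lip (act1 s c L) L'"
proof -
  show "lip (act1 s (c + d) L) L' = lip (act1 s c L) L' + lip (act1 s d L) L'"
    if "c \<in> fibre B s" "d \<in> fibre B s"
    unfolding lip_def ev_act1 ev_add[symmetric]
    using that by (intro ev_cong L L') (simp add: fmult_bilinear kern_additive fmult_closed algebra_simps)
  show "lip (act1 s (z *\<^sub>C c) L) L' = cnj z *\<^sub>C lip (act1 s c L) L'" if "c \<in> fibre B s"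
  proof -
    have "lip (act1 s (z *\<^sub>C c) L) L' = ev L (\<lambda>g b x. ev L' (\<lambda>g' b' x'.
        cnj z *\<^sub>C (adj x * kern (s + g) (fmult B s g c b) g' b' * x')))"
      unfolding lip_def ev_act1
      using that by (intro ev_cong L L') (simp add: fmult_bilinear kern_additive fmult_closed
          mult_scaleC_left mult_scaleC_right)
    then show ?thesis unfolding lip_def ev_act1 by (simp add: ev_hom[of "\<lambda>x. cnj z *\<^sub>C x"] scaleC_add_right)
  qed
qed

lemma fibre_additive_lip_act1: "valid L \<Longrightarrow> valid L' \<Longrightarrow> fibre_additive (\<lambda>s c. lip (act1 s c L) L')"
  by (simp add: fibre_additive_def lip_act1_additive)

text \<open>Vectors are lists, so the action of a section needs its support in some order; by
  \<open>lip_act_left\<close> the pairings do not depend on the choice.\<close>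

definition support_list :: "('g \<Rightarrow> 'b) \<Rightarrow> 'g list"
  where "support_list f = (SOME l. distinct l \<and> set l = {g. f g \<noteq> 0})"

lemma support_list:
  assumes "f \<in> sections B"
  shows "distinct (support_list f)" "set (support_list f) = {g. f g \<noteq> 0}"
proof -
  have "\<exists>l. distinct l \<and> set l = {g. f g \<noteq> 0}"
    using finite_distinct_list[OF sectionsD(2)[OF assms]] by blast
  from someI_ex[OF this] show "distinct (support_list f)" "set (support_list f) = {g. f g \<noteq> 0}"
    unfolding support_list_def by simp_all
qed

definition act :: "('g \<Rightarrow> 'b) \<Rightarrow> ('g \<times> 'b \<times> 'q) list \<Rightarrow> ('g \<times> 'b \<times> 'q) list"
  where "act f L = concat (map (\<lambda>s. act1 s (f s) L) (support_list f))"

lemma valid_act: "f \<in> sections B \<Longrightarrow> valid L \<Longrightarrow> valid (act f L)"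
proof -
  assume f: "f \<in> sections B" and L: "valid L"
  have "valid (concat (map (\<lambda>s. act1 s (f s) L) l))" for l
    by (induction l) (simp_all add: valid_act1 sectionsD(1)[OF f] L)
  then show ?thesis by (simp add: act_def)
qed

lemma lip_act_left:
  assumes f: "f \<in> sections B"
  shows "lip (act f L) L' = section_sum (\<lambda>s c. lip (act1 s c L) L') f"
proof -
  have "lip (concat (map (\<lambda>s. act1 s (f s) L) l)) L' = (\<Sum>s\<leftarrow>l. lip (act1 s (f s) L) L')" for l
    by (induction l) simp_all
  then show ?thesis
    using support_list[OF f] by (simp add: act_def section_sum_def sum_list_distinct_conv_sum_set)
qed

lemma lip_act_adjoint:
  assumes f: "f \<in> sections B" and L: "valid L" and L': "valid L'"
  shows "lip (act f L) L' = lip L (act (section_star B f) L')"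
proof -
  note fs = section_star_section(1)[OF f]
  have "lip L (act (section_star B f) L') = adj (lip (act (section_star B f) L') L)"
    by (rule adj_lip[OF valid_act[OF fs L'] L, symmetric])
  also have "\<dots> = adj (section_sum (\<lambda>s c. lip (act1 (- s) (fstar B s c) L') L) f)"
    by (simp only: lip_act_left[OF fs] section_sum_star[OF f])
  also have "\<dots> = section_sum (\<lambda>s c. lip (act1 s c L) L') f"
    unfolding section_sum_def adj_linear
  proof (rule sum.cong[OF refl])
    fix s
    note fsB = sectionsD(1)[OF f, of s]
    show "adj (lip (act1 (- s) (fstar B s (f s)) L') L) = lip (act1 s (f s) L) L'"
      using adj_lip[OF valid_act1[OF fstar_closed[OF fsB] L'] L] lip_act1_left[OF fsB L L'] by simp
  qed
  finally show ?thesis by (simp add: lip_act_left[OF f])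
qed

text \<open>The two lists differ, so multiplicativity of the action is asserted only after pairing.
  Fibre by fibre, the factor from f moves to the other side as its adjoint.\<close>

lemma lip_act_mult:
  assumes f: "f \<in> sections B" and h: "h \<in> sections B" and L: "valid L" and L': "valid L'"
  shows "lip (act (section_mult B f h) L) L' = lip (act f (act h L)) L'"
proof -
  have "lip (act (section_mult B f h) L) L'
      = section_sum (\<lambda>s a. section_sum (\<lambda>r b. lip (act1 (s + r) (fmult B s r a b) L) L') h) f"
    unfolding lip_act_left[OF section_mult_section[OF f h]]
    by (rule section_sum_mult[OF fibre_additive_lip_act1[OF L L'] f h])
  also have "\<dots> = section_sum (\<lambda>s a. lip (act1 s a (act h L)) L') f"
    unfolding section_sum_def[of _ f]
  proof (rule sum.cong[OF refl])
    fix s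
    note fs = sectionsD(1)[OF f, of s]
    have "section_sum (\<lambda>r b. lip (act1 (s + r) (fmult B s r (f s) b) L) L') h
        = section_sum (\<lambda>r b. lip (act1 r b L) (act1 (- s) (fstar B s (f s)) L')) h"
      unfolding section_sum_def
    proof (rule sum.cong[OF refl])
      fix r
      note hr = sectionsD(1)[OF h, of r]
      show "lip (act1 (s + r) (fmult B s r (f s) (h r)) L) L' = lip (act1 r (h r) L) (act1 (- s) (fstar B s (f s)) L')"
        using lip_act1_left[OF fs valid_act1[OF hr L] L'] act1_act1[OF fs hr L] by simp
    qed
    also have "\<dots> = lip (act h L) (act1 (- s) (fstar B s (f s)) L')"
      by (simp only: lip_act_left[OF h])
    also have "\<dots> = lip (act1 s (f s) (act h L)) L'"
      by (rule lip_act1_left[OF fs valid_act[OF h L] L', symmetric])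
    finally show "section_sum (\<lambda>r b. lip (act1 (s + r) (fmult B s r (f s) b) L) L') h
        = lip (act1 s (f s) (act h L)) L'" .
  qed
  finally show ?thesis by (simp only: lip_act_left[OF f])
qed

end

text \<open>The choice y = a x turns the sandwich into the C*-identity.\<close>

lemma norm_le_of_sandwich:
  fixes a :: "'a::cstar_algebra"
  assumes K: "0 \<le> K" and le: "\<And>x y. norm (adj y * a * x) \<le> K * norm x * norm y"
  shows "norm a \<le> K"
proof (rule cstar.norm_le_mul_bound[OF UNIV_I K])
  fix x
  have "(norm (a * x))\<^sup>2 \<le> K * norm x * norm (a * x)"
    using le[of "a * x" x] cstar_identity[of "a * x"] by (simp add: mult.assoc)
  then show "norm (a * x) \<le> K * norm x"
    by (cases "norm (a * x) = 0") (use K in \<open>simp_all add: power2_eq_square\<close>)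
qed

context cp_map
begin

subsection \<open>Boundedness on the fibres\<close>

lemma \<psi>_unit_positive:
  assumes "unit_fibre.positive a"
  shows "cstar.positive (\<psi> 0 a)"
proof -
  obtain r where r: "unit_fibre.positive r" "r \<odot> r = a"
    using unit_fibre.positive_sqrt[OF assms] by metis
  have "positive_matrix 1 (\<lambda>i j. kern 0 r 0 r)"
    by (rule kern_positive_matrix[of 1 "\<lambda>i. r" "\<lambda>i. 0"]) (use r unit_fibre.positive_in in simp)
  moreover have "kern 0 r 0 r = \<psi> 0 a"
    using r unit_fibre.positive_st[OF r(1)] by (simp add: kern_def)
  ultimately obtain N :: "nat \<Rightarrow> nat \<Rightarrow> 'q" where "\<psi> 0 a = adj (N 0 0) * N 0 0"
    unfolding positive_matrix_def by auto
  then show ?thesis by (simp add: cstar_positive_adj_mult)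
qed

lemma \<psi>_unit_mono:
  assumes "unit_fibre.positive a" "unit_fibre.positive (b - a)"
  shows "norm (\<psi> 0 a) \<le> norm (\<psi> 0 b)"
proof (rule cstar_norm_mono[OF \<psi>_unit_positive[OF assms(1)]])
  have a: "a \<in> fibre B 0" and "b - a \<in> fibre B 0" using assms unit_fibre.positive_in by blast+
  then have "(b - a) + a \<in> fibre B 0" by (intro fibre_add)
  then have b: "b \<in> fibre B 0" by simp
  show "\<psi> 0 a \<preceq> \<psi> 0 b"
    using \<psi>_unit_positive[OF assms(2)] a b by (simp add: cstar_le_def \<psi>_simps)
qed

text \<open>If \<open>\<psi>\<close> were unbounded on positive elements, then \<open>\<psi>(\<Sum>\<^sub>k 2\<^sup>-\<^sup>k a\<^sub>k) \<ge> \<psi>(2\<^sup>-\<^sup>k a\<^sub>k)\<close> would be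
  arbitrarily large for suitable \<open>a\<^sub>k\<close>.\<close>

lemma \<psi>_bounded_on_positive:
  obtains M where "0 \<le> M" "\<And>a. unit_fibre.positive a \<Longrightarrow> norm a \<le> 1 \<Longrightarrow> norm (\<psi> 0 a) \<le> M"
proof (rule ccontr)
  assume "\<not> thesis"
  \<comment> \<open>4^k leaves 2^k after multiplication by the weight (1/2)^k of the series.\<close>
  then have "\<exists>a. unit_fibre.positive a \<and> norm a \<le> 1 \<and> 4 ^ k < norm (\<psi> 0 a)" for k :: nat
    using that[of "4 ^ k"] by (meson not_le zero_le_numeral zero_le_power)
  then obtain a where a: "\<And>k. unit_fibre.positive (a k)" "\<And>k. norm (a k) \<le> 1" "\<And>k::nat. 4 ^ k < norm (\<psi> 0 (a k))"
    by metis
  define u where "u k = (1 / 2) ^ k *\<^sub>R a k" for k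
  have u: "unit_fibre.positive (u k)" for k unfolding u_def by (intro unit_fibre.positive_scaleR a) simp
  have aA: "a k \<in> fibre B 0" for k using unit_fibre.positive_in[OF a(1)] .
  define S where "S n = (\<Sum>k<n. u k)" for n
  have SA: "S n \<in> fibre B 0" for n
    unfolding S_def by (rule unit_fibre.positive_in[OF unit_fibre.positive_sum[OF u]])
  have S_diff: "norm (S m - S n) \<le> 2 * (1 / 2) ^ n - 2 * (1 / 2) ^ m" if "n \<le> m" for m n
    using that
  proof (induction m rule: dec_induct)
    case (step m)
    have "norm (u m) \<le> (1 / 2) ^ m" using a(2)[of m] by (simp add: u_def mult_left_le)
    moreover have "S (Suc m) - S n = (S m - S n) + u m" by (simp add: S_def)
    ultimately have "norm (S (Suc m) - S n) \<le> (2 * (1 / 2) ^ n - 2 * (1 / 2) ^ m) + (1 / 2) ^ m"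
      using step.IH by (simp only: norm_triangle_mono)
    then show ?case by simp
  qed simp
  have "Cauchy S"
  proof (rule CauchyI')
    fix e :: real assume "0 < e"
    then obtain N where N: "(1 / 2 :: real) ^ N < e / 2"
      using real_arch_pow_inv[of "e / 2" "1 / 2"] by auto
    show "\<exists>M. \<forall>m\<ge>M. \<forall>n>m. dist (S m) (S n) < e"
    proof (rule exI[of _ N], intro allI impI)
      fix m n :: nat assume mn: "N \<le> m" "m < n"
      have "dist (S m) (S n) \<le> 2 * (1 / 2) ^ m - 2 * (1 / 2) ^ n"
        using S_diff[of m n] mn by (simp add: dist_norm norm_minus_commute)
      also have "\<dots> \<le> 2 * (1 / 2) ^ m" by simp
      also have "\<dots> \<le> 2 * (1 / 2) ^ N" using mn by (intro mult_left_mono power_decreasing) auto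
      also have "\<dots> < e" using N by simp
      finally show "dist (S m) (S n) < e" .
    qed
  qed
  then obtain l where l: "l \<in> fibre B 0" "S \<longlonglongrightarrow> l"
    using fibre_complete[of 0, unfolded complete_def, rule_format, of S] SA by blast
  obtain k where k: "norm (\<psi> 0 l) < 2 ^ k" using real_arch_pow[of 2 "norm (\<psi> 0 l)"] by auto
  have "unit_fibre.positive (l - u k)"
  proof (rule unit_fibre.positive_limit)
    show "(\<lambda>n. S (n + Suc k) - u k) \<longlonglongrightarrow> l - u k"
      by (intro tendsto_diff tendsto_const LIMSEQ_ignore_initial_segment l(2))
    fix n
    have "S (n + Suc k) = u k + (\<Sum>j\<in>{..<n + Suc k} - {k}. u j)"
      unfolding S_def by (rule sum.remove) auto
    then have "S (n + Suc k) - u k = (\<Sum>j\<in>{..<n + Suc k} - {k}. u j)" by simp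
    then show "unit_fibre.positive (S (n + Suc k) - u k)" by (simp only: unit_fibre.positive_sum u)
  qed
  from \<psi>_unit_mono[OF u this] have "(1 / 2) ^ k * norm (\<psi> 0 (a k)) \<le> norm (\<psi> 0 l)"
    using aA by (simp add: u_def \<psi>_simps)
  moreover have "(1 / 2) ^ k * 4 ^ k < (1 / 2 :: real) ^ k * norm (\<psi> 0 (a k))"
    using a(3)[of k] by (intro mult_strict_left_mono) auto
  moreover have "(1 / 2) ^ k * 4 ^ k = (2 :: real) ^ k" by (simp flip: power_mult_distrib)
  ultimately show False using k by linarith
qed

lemma lip_single: "lip [(g, b, x)] [(g', b', x')] = adj x * kern g b g' b' * x'"
  by (simp add: lip_def)

lemma norm_conj_le: "norm (adj x * a * (x :: 'a::cstar_algebra)) \<le> norm a * (norm x)\<^sup>2"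
proof -
  have "norm (adj x * a * x) \<le> norm (adj x * a) * norm x" by (rule norm_mult_ineq)
  also have "\<dots> \<le> (norm (adj x) * norm a) * norm x" by (intro mult_right_mono norm_mult_ineq) simp
  finally show ?thesis by (simp add: power2_eq_square mult_ac)
qed

text \<open>Write b = \<sigma> y. Then z^* \<psi>(b) x is the inner product of
  \<open>(0, \<sigma>, z)\<close> and \<open>(g, y, x)\<close>, so Cauchy-Schwarz bounds it by the
  values of \<psi> at \<sigma>^2 and y^* y. These are positive of norm at most 1 and 4, which gives
  the constant 2 M0.\<close>

lemma \<psi>_bounded:
  obtains M where "0 \<le> M" "\<And>g b. b \<in> fibre B g \<Longrightarrow> norm (\<psi> g b) \<le> M * norm b"
proof -
  obtain M0 where M0: "0 \<le> M0" "\<And>a. unit_fibre.positive a \<Longrightarrow> norm a \<le> 1 \<Longrightarrow> norm (\<psi> 0 a) \<le> M0"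
    using \<psi>_bounded_on_positive by metis
  have scaled: "norm (\<psi> 0 a) \<le> 4 * M0" if a: "unit_fibre.positive a" "norm a \<le> 4" for a
    using M0(2)[of "(1 / 4) *\<^sub>R a"] a unit_fibre.positive_in[OF a(1)]
    by (simp add: unit_fibre.positive_scaleR \<psi>_simps)
  have unit: "norm (\<psi> g b) \<le> 2 * M0" if b: "b \<in> fibre B g" "norm b \<le> 1" for g b
  proof (rule norm_le_of_sandwich)
    obtain \<sigma> y where \<sigma>: "\<sigma> \<in> fibre B 0" "fstar B 0 \<sigma> = \<sigma>" "norm \<sigma> \<le> 1"
      and y: "y \<in> fibre B g" "norm y \<le> 2" and eq: "lact g \<sigma> y = b"
      using factorization[OF b] by metis
    have k1: "kern 0 \<sigma> g y = \<psi> g b" using eq \<sigma> by (simp add: kern_def)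
    have k2: "norm (kern 0 \<sigma> 0 \<sigma>) \<le> M0"
    proof -
      have "norm (\<sigma> \<odot> \<sigma>) \<le> 1" using unit_fibre.norm_st_mul[OF \<sigma>(1)] \<sigma>(2,3) by (simp add: power_le_one)
      then show ?thesis using M0(2)[of "\<sigma> \<odot> \<sigma>"] unit_fibre.positive_st_mul[OF \<sigma>(1)] \<sigma>(2)
        by (simp add: kern_def)
    qed
    have k3: "norm (kern g y g y) \<le> 4 * M0"
    proof -
      have "(norm y)\<^sup>2 \<le> 2\<^sup>2" using y(2) by (intro power_mono) auto
      then show ?thesis
        using scaled[OF positive_inner[OF y(1)]] norm_fstar_fmult[OF y(1)] by (simp add: kern_def)
    qed
    fix x z
    have "norm (adj z * \<psi> g b * x) \<le> lnorm [(0, \<sigma>, z)] * lnorm [(g, y, x)]"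
      using lip_Cauchy_Schwarz[of "[(0, \<sigma>, z)]" "[(g, y, x)]"] \<sigma> y by (simp add: lip_single k1)
    also have "\<dots> \<le> sqrt (M0 * (norm z)\<^sup>2) * sqrt (4 * M0 * (norm x)\<^sup>2)"
      unfolding lnorm_def lip_single
      by (intro mult_mono real_sqrt_le_mono order_trans[OF norm_conj_le] mult_right_mono k2 k3)
        (use M0(1) in auto)
    also have "\<dots> = 2 * M0 * norm x * norm z"
      using M0(1) by (simp add: real_sqrt_mult)
    finally show "norm (adj z * \<psi> g b * x) \<le> 2 * M0 * norm x * norm z" .
  qed (use M0 in simp)
  have "norm (\<psi> g b) \<le> 2 * M0 * norm b" if b: "b \<in> fibre B g" for g b
  proof (cases "b = 0")
    case True
    then show ?thesis by (simp add: \<psi>_simps)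
  next
    case False
    then show ?thesis using unit[of "(1 / norm b) *\<^sub>R b" g] b by (simp add: \<psi>_simps field_simps)
  qed
  then show thesis using that[of "2 * M0"] M0(1) by simp
qed

lemma norm_kern_le:
  assumes M: "0 \<le> M" "\<And>g b. b \<in> fibre B g \<Longrightarrow> norm (\<psi> g b) \<le> M * norm b"
    and b: "b \<in> fibre B g" "b' \<in> fibre B g'"
  shows "norm (kern g b g' b') \<le> M * (norm b * norm b')"
proof -
  have "norm (kern g b g' b') \<le> M * norm (fmult B (- g) g' (fstar B g b) b')"
    unfolding kern_def by (rule M(2)[OF kern_inner_closed[OF b]])
  also have "\<dots> \<le> M * (norm b * norm b')"
    using norm_fmult[OF fstar_closed[OF b(1)] b(2)] norm_fstar[OF b(1)] M(1) by (intro mult_left_mono) auto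
  finally show ?thesis .
qed

subsection \<open>Boundedness of the action\<close>

lemma norm_ev_le:
  assumes "valid L" "\<And>g b x. b \<in> fibre B g \<Longrightarrow> norm (T g b x) \<le> r * S g b x"
  shows "norm (ev L T) \<le> r * ev L S"
  using assms(1)
proof (induction L)
  case (Cons a L)
  then show ?case
    using norm_triangle_mono[OF assms(2), of "fst (snd a)" "fst a" "ev L T" "r * ev L S" "snd (snd a)"]
    by (cases a) (simp add: distrib_left)
qed simp

text \<open>The right constant comes from a crude one: with z k = y^(2^k), estimating term by term
  gives sqrt Q ||y||^(2^k), where Q depends on L. Cauchy-Schwarz relates z k to z (k + 1), and the
  iteration removes Q.\<close>

lemma lnorm_act1_unit_le:
  assumes y: "y \<in> fibre B 0" "fstar B 0 y = y" and L: "valid L"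
  shows "lnorm (act1 0 y L) \<le> lnorm L * norm y"
proof -
  obtain M where M: "0 \<le> M" "\<And>g b. b \<in> fibre B g \<Longrightarrow> norm (\<psi> g b) \<le> M * norm b"
    using \<psi>_bounded by metis
  define z where "z = rec_nat y (\<lambda>k z. z \<odot> z)"
  have z_simps: "z 0 = y" "z (Suc k) = z k \<odot> z k" for k by (simp_all add: z_def)
  have z: "z k \<in> fibre B 0 \<and> fstar B 0 (z k) = z k \<and> norm (z k) \<le> norm y ^ (2 ^ k)" for k
  proof (induction k)
    case (Suc k)
    have "norm (z k \<odot> z k) \<le> norm y ^ (2 ^ k) * norm y ^ (2 ^ k)"
      using norm_fmult[of "z k" 0 "z k" 0] Suc by (meson mult_mono norm_ge_zero order_trans)
    then show ?case using Suc by (simp add: z_simps unit_fibre.st_mul mult_2 power_add)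
  qed (use y in \<open>simp add: z_simps\<close>)
  define a where "a k = lnorm (act1 0 (z k) L)" for k
  note vz = valid_act1[OF conjunct1[OF z] L]
  \<comment> \<open>The triangle inequality over all pairs of entries of L, with the bound M for
    \<psi>; the norms of z k factor out.\<close>
  define Q where "Q = ev L (\<lambda>g b x. ev L (\<lambda>g' b' x'. M * (norm b * norm b') * norm x * norm x'))"
  have Q: "norm (lip (act1 0 (z k) L) (act1 0 (z k) L)) \<le> (norm (z k))\<^sup>2 * Q" for k
    unfolding lip_def ev_act1 Q_def
  proof (intro norm_ev_le L)
    fix g b x g' b' x' assume b: "b \<in> fibre B g" "b' \<in> fibre B g'"
    let ?b = "lact g (z k) b" and ?b' = "lact g' (z k) b'"
    have zk: "z k \<in> fibre B 0" using z by blast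
    have "norm (adj x * kern (0 + g) ?b (0 + g') ?b' * x') \<le> norm x * norm (kern g ?b g' ?b') * norm x'"
      using order_trans[OF norm_mult_ineq mult_right_mono[OF norm_mult_ineq]] by (metis add_0 norm_adj norm_ge_zero)
    also have "\<dots> \<le> norm x * (M * ((norm (z k) * norm b) * (norm (z k) * norm b'))) * norm x'"
    proof (intro mult_right_mono mult_left_mono)
      have "norm (kern g ?b g' ?b') \<le> M * (norm ?b * norm ?b')"
        using b zk by (intro norm_kern_le[OF M]) simp_all
      also have "\<dots> \<le> M * ((norm (z k) * norm b) * (norm (z k) * norm b'))"
        using norm_fmult[OF zk b(1)] norm_fmult[OF zk b(2)] M(1) by (intro mult_left_mono mult_mono) auto
      finally show "norm (kern g ?b g' ?b') \<le> M * ((norm (z k) * norm b) * (norm (z k) * norm b'))" .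
    qed auto
    finally show "norm (adj x * kern (0 + g) ?b (0 + g') ?b' * x')
        \<le> (norm (z k))\<^sup>2 * (M * (norm b * norm b') * norm x * norm x')"
      by (simp add: power2_eq_square mult_ac)
  qed
  have Q0: "0 \<le> Q"
  proof -
    have ev0: "0 \<le> ev L' T" if "\<And>g b x. 0 \<le> T g b x" for L' and T :: "_ \<Rightarrow> _ \<Rightarrow> _ \<Rightarrow> real"
      by (induction L') (auto simp: that add_nonneg_nonneg)
    show ?thesis unfolding Q_def using M(1) by (intro ev0) simp
  qed
  have "a 0 \<le> lnorm L * norm y"
  proof (rule iterated_cauchy_schwarz)
    fix k
    have "lip (act1 0 (z k) L) (act1 0 (z k) L) = lip L (act1 0 (z (Suc k)) L)"
      using lip_act1_left[OF conjunct1[OF z] L vz, of k k] act1_act1[of "z k" 0 "z k" 0 L] z[of k] L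
      by (simp add: z_simps)
    then show "(a k)\<^sup>2 \<le> lnorm L * a (Suc k)"
      using lip_Cauchy_Schwarz[OF L vz[of "Suc k"]] by (simp add: a_def lnorm_square)
    have "a k \<le> sqrt ((norm (z k))\<^sup>2 * Q)" unfolding a_def lnorm_def by (rule real_sqrt_le_mono[OF Q])
    also have "\<dots> = sqrt Q * norm (z k)" by (simp add: real_sqrt_mult)
    also have "\<dots> \<le> sqrt Q * norm y ^ (2 ^ k)" using z[of k] Q0 by (intro mult_left_mono) auto
    also have "\<dots> \<le> sqrt Q * 2 ^ k * norm y ^ (2 ^ k)"
      using Q0 mult_left_mono[of 1 "2 ^ k :: real" "sqrt Q"] by (intro mult_right_mono) auto
    finally show "a k \<le> sqrt Q * 2 ^ k * norm y ^ (2 ^ k)" .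
  qed (use Q0 in \<open>auto simp: a_def\<close>)
  then show ?thesis by (simp add: a_def z_simps)
qed

lemma lnorm_act1_le:
  assumes c: "c \<in> fibre B s" and L: "valid L"
  shows "lnorm (act1 s c L) \<le> norm c * lnorm L"
proof (rule power2_le_imp_le)
  let ?y = "fmult B (- s) s (fstar B s c) c"
  have y: "?y \<in> fibre B 0" "fstar B 0 ?y = ?y"
    using unit_fibre.positive_in unit_fibre.positive_st positive_inner[OF c] by blast+
  have "lip (act1 s c L) (act1 s c L) = lip L (act1 0 ?y L)"
    using lip_act1_left[OF c L valid_act1[OF c L]] act1_act1[OF fstar_closed[OF c] c L] by simp
  then have "(lnorm (act1 s c L))\<^sup>2 \<le> lnorm L * lnorm (act1 0 ?y L)"
    using lip_Cauchy_Schwarz[OF L valid_act1[OF y(1) L]] by (simp add: lnorm_square)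
  also have "\<dots> \<le> lnorm L * (lnorm L * norm ?y)"
    by (intro mult_left_mono lnorm_act1_unit_le y L) simp
  also have "\<dots> = (norm c * lnorm L)\<^sup>2"
    using norm_fstar_fmult[OF c] by (simp add: power2_eq_square mult_ac)
  finally show "(lnorm (act1 s c L))\<^sup>2 \<le> (norm c * lnorm L)\<^sup>2" .
qed simp

lemma lnorm_act_le:
  assumes f: "f \<in> sections B" and L: "valid L"
  shows "lnorm (act f L) \<le> (\<Sum>s | f s \<noteq> 0. norm (f s)) * lnorm L"
proof -
  have "valid (concat (map (\<lambda>s. act1 s (f s) L) l)) \<and>
      lnorm (concat (map (\<lambda>s. act1 s (f s) L) l)) \<le> (\<Sum>s\<leftarrow>l. norm (f s)) * lnorm L" for l
  proof (induction l)
    case Nil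
    then show ?case by (simp add: lnorm_def)
  next
    case (Cons s l)
    note fs = sectionsD(1)[OF f, of s]
    show ?case
      using Cons valid_act1[OF fs L] lnorm_append[OF valid_act1[OF fs L] conjunct1[OF Cons]] lnorm_act1_le[OF fs L]
      by (simp add: distrib_right)
  qed
  from conjunct2[OF this[of "support_list f"]] show ?thesis
    by (simp only: act_def sum_list_distinct_conv_sum_set support_list[OF f])
qed

subsection \<open>The C*-seminorm of the module\<close>

definition opnorm :: "('g \<Rightarrow> 'b) \<Rightarrow> real"
  where "opnorm f = Inf {K. 0 \<le> K \<and> (\<forall>L. valid L \<longrightarrow> lnorm (act f L) \<le> K * lnorm L)}"

lemma opnorm_le: "0 \<le> K \<Longrightarrow> (\<And>L. valid L \<Longrightarrow> lnorm (act f L) \<le> K * lnorm L) \<Longrightarrow> opnorm f \<le> K"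
  unfolding opnorm_def by (intro cInf_lower bdd_belowI[of _ 0]) auto

lemma opnorm:
  assumes f: "f \<in> sections B"
  shows opnorm_nonneg: "0 \<le> opnorm f" and lnorm_act_opnorm: "valid L \<Longrightarrow> lnorm (act f L) \<le> opnorm f * lnorm L"
proof -
  let ?S = "{K. 0 \<le> K \<and> (\<forall>L. valid L \<longrightarrow> lnorm (act f L) \<le> K * lnorm L)}"
  have ne: "?S \<noteq> {}"
    using lnorm_act_le[OF f] sum_nonneg[of "{s. f s \<noteq> 0}" "\<lambda>s. norm (f s)"] by auto
  show "0 \<le> opnorm f" unfolding opnorm_def using ne by (intro cInf_greatest) auto
  show "lnorm (act f L) \<le> opnorm f * lnorm L" if L: "valid L"
  proof (cases "lnorm L = 0")
    case True
    then show ?thesis using lnorm_act_le[OF f L] by simp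
  next
    case False
    then have pos: "0 < lnorm L" using lnorm_nonneg[of L] by linarith
    have "lnorm (act f L) / lnorm L \<le> opnorm f"
      unfolding opnorm_def using ne L pos by (intro cInf_greatest) (auto simp: field_simps)
    then show ?thesis using pos by (simp add: field_simps)
  qed
qed

lemma section_star_star: "f \<in> sections B \<Longrightarrow> section_star B (section_star B f) = f"
  using fstar_fstar[OF sectionsD(1)] by (fastforce simp: section_star_def fun_eq_iff)

lemma lip_self_act:
  assumes f: "f \<in> sections B" and L: "valid L"
  shows "lip (act f L) (act f L) = lip L (act (section_mult B (section_star B f) f) L)"
proof -
  note fs = section_star_section(1)[OF f]
  note ff = section_mult_section[OF fs f]
  have "lip L (act (section_mult B (section_star B f) f) L) = adj (lip (act (section_mult B (section_star B f) f) L) L)"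
    by (rule adj_lip[OF valid_act[OF ff L] L, symmetric])
  also have "\<dots> = adj (lip (act (section_star B f) (act f L)) L)"
    by (simp only: lip_act_mult[OF fs f L L])
  also have "\<dots> = lip L (act (section_star B f) (act f L))"
    by (rule adj_lip[OF valid_act[OF fs valid_act[OF f L]] L])
  finally show ?thesis using lip_act_adjoint[OF f L valid_act[OF f L]] by simp
qed

lemma cstar_seminorm_opnorm: "cstar_seminorm B opnorm"
proof -
  have scale_le: "opnorm (\<lambda>g. c *\<^sub>C f g) \<le> cmod c * opnorm f" if f: "f \<in> sections B" for c f
  proof (rule opnorm_le)
    fix L assume L: "valid L"
    let ?X = "act (\<lambda>g. c *\<^sub>C f g) L" and ?Y = "act f L"
    note vX = valid_act[OF section_scaleC[OF f, of c] L] and vY = valid_act[OF f L]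
    have XY: "lip ?X L' = cnj c *\<^sub>C lip ?Y L'" if L': "valid L'" for L'
      unfolding lip_act_left[OF f] lip_act_left[OF section_scaleC[OF f]]
      by (rule section_sum_scaleC[OF f fibre_additiveD(2)[OF fibre_additive_lip_act1[OF L L']]
            lip_act1_additive(2)[OF L L']])
    have "lip ?X ?X = cnj c *\<^sub>C adj (lip ?X ?Y)" using XY[OF vX] adj_lip[OF vX vY] by simp
    also have "\<dots> = (cnj c * c) *\<^sub>C lip ?Y ?Y"
      using XY[OF vY] adj_lip[OF vY vY] by (simp add: adj_scaleC scaleC_scaleC)
    finally have "(lnorm ?X)\<^sup>2 = (cmod c * lnorm ?Y)\<^sup>2"
      by (simp add: lnorm_square norm_scaleC norm_mult power_mult_distrib) (simp add: power2_eq_square)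
    then have "lnorm ?X = cmod c * lnorm ?Y" by (simp add: power2_eq_iff_nonneg)
    then show "lnorm ?X \<le> cmod c * opnorm f * lnorm L"
      using lnorm_act_opnorm[OF f L] by (simp add: mult.assoc mult_left_mono)
  qed (simp add: opnorm_nonneg[OF f])
  have star_le: "opnorm (section_star B f) \<le> opnorm f" if f: "f \<in> sections B" for f
  proof (rule opnorm_le)
    note fs = section_star_section(1)[OF f]
    fix L assume L: "valid L"
    note vs = valid_act[OF fs L]
    have "(lnorm (act (section_star B f) L))\<^sup>2 = norm (lip L (act f (act (section_star B f) L)))"
      unfolding lnorm_square lip_act_adjoint[OF fs L vs] section_star_star[OF f] by simp
    also have "\<dots> \<le> lnorm L * lnorm (act f (act (section_star B f) L))"
      by (rule lip_Cauchy_Schwarz[OF L valid_act[OF f vs]])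
    also have "\<dots> \<le> lnorm L * (opnorm f * lnorm (act (section_star B f) L))"
      by (intro mult_left_mono lnorm_act_opnorm f vs) simp
    finally show "lnorm (act (section_star B f) L) \<le> opnorm f * lnorm L"
      using opnorm_nonneg[OF f]
        mult_right_le_imp_le[of "lnorm (act (section_star B f) L)" "lnorm (act (section_star B f) L)" "opnorm f * lnorm L"]
        lnorm_nonneg[of "act (section_star B f) L"]
      by (cases "lnorm (act (section_star B f) L) = 0") (simp_all add: power2_eq_square mult_ac)
  qed (rule opnorm_nonneg[OF f])
  have mult_le: "opnorm (section_mult B f h) \<le> opnorm f * opnorm h" if f: "f \<in> sections B" and h: "h \<in> sections B" for f h
  proof (rule opnorm_le)
    fix L assume L: "valid L"
    have "lnorm (act (section_mult B f h) L) = lnorm (act f (act h L))"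
      by (intro lnorm_eqI valid_act section_mult_section f h L lip_act_mult)
    also have "\<dots> \<le> opnorm f * (opnorm h * lnorm L)"
      using lnorm_act_opnorm[OF f valid_act[OF h L]] lnorm_act_opnorm[OF h L] opnorm_nonneg[OF f]
      by (meson mult_left_mono order_trans)
    finally show "lnorm (act (section_mult B f h) L) \<le> opnorm f * opnorm h * lnorm L" by (simp add: mult.assoc)
  qed (simp add: opnorm_nonneg f h)
  show ?thesis
    unfolding cstar_seminorm_def
  proof (intro conjI ballI allI)
    fix f c assume f: "f \<in> sections B"
    note fs = section_star_section(1)[OF f]
    show "0 \<le> opnorm f" by (rule opnorm_nonneg[OF f])
    show "opnorm (\<lambda>g. c *\<^sub>C f g) = cmod c * opnorm f"
    proof (cases "c = 0")
      case True
      then show ?thesis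
        using scale_le[OF f, of c] opnorm_nonneg[OF section_scaleC[OF f, of c]] by simp
    next
      case False
      have "opnorm f = opnorm (\<lambda>g. (1 / c) *\<^sub>C c *\<^sub>C f g)" using False by (simp add: scaleC_scaleC)
      also have "\<dots> \<le> cmod (1 / c) * opnorm (\<lambda>g. c *\<^sub>C f g)" by (rule scale_le[OF section_scaleC[OF f]])
      finally have "cmod c * opnorm f \<le> opnorm (\<lambda>g. c *\<^sub>C f g)"
        using False by (simp add: norm_divide field_simps)
      with scale_le[OF f, of c] show ?thesis by simp
    qed
    show "opnorm (section_star B f) = opnorm f"
      using star_le[OF f] star_le[OF fs] section_star_star[OF f] by simp
    show "opnorm (section_mult B (section_star B f) f) = (opnorm f)\<^sup>2"
    proof (rule antisym)
      have "opnorm (section_mult B (section_star B f) f) \<le> opnorm (section_star B f) * opnorm f"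
        by (rule mult_le[OF fs f])
      also have "\<dots> \<le> opnorm f * opnorm f" by (intro mult_right_mono star_le f opnorm_nonneg)
      finally show "opnorm (section_mult B (section_star B f) f) \<le> (opnorm f)\<^sup>2" by (simp add: power2_eq_square)
      note ff = section_mult_section[OF fs f]
      have "opnorm f \<le> sqrt (opnorm (section_mult B (section_star B f) f))"
      proof (rule opnorm_le)
        fix L assume L: "valid L"
        have "(lnorm (act f L))\<^sup>2 \<le> lnorm L * lnorm (act (section_mult B (section_star B f) f) L)"
          unfolding lnorm_square lip_self_act[OF f L] by (rule lip_Cauchy_Schwarz[OF L valid_act[OF ff L]])
        also have "\<dots> \<le> lnorm L * (opnorm (section_mult B (section_star B f) f) * lnorm L)"
          by (intro mult_left_mono lnorm_act_opnorm ff L) simp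
        also have "\<dots> = (sqrt (opnorm (section_mult B (section_star B f) f)) * lnorm L)\<^sup>2"
          using opnorm_nonneg[OF ff] by (simp add: power_mult_distrib) (simp add: power2_eq_square)
        finally show "lnorm (act f L) \<le> sqrt (opnorm (section_mult B (section_star B f) f)) * lnorm L"
          by (rule power2_le_imp_le) (simp add: opnorm_nonneg[OF ff])
      qed (simp add: opnorm_nonneg[OF ff])
      from power_mono[OF this opnorm_nonneg[OF f], of 2]
      show "(opnorm f)\<^sup>2 \<le> opnorm (section_mult B (section_star B f) f)"
        by (simp add: opnorm_nonneg[OF ff])
    qed
    fix h assume h: "h \<in> sections B"
    show "opnorm (section_mult B f h) \<le> opnorm f * opnorm h" by (rule mult_le[OF f h])
    show "opnorm (\<lambda>g. f g + h g) \<le> opnorm f + opnorm h"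
    proof (rule opnorm_le)
      fix L assume L: "valid L"
      note vf = valid_act[OF f L] and vh = valid_act[OF h L]
      have "lnorm (act (\<lambda>g. f g + h g) L) = lnorm (act f L @ act h L)"
      proof (rule lnorm_eqI[OF valid_act[OF section_add[OF f h] L]])
        show "valid (act f L @ act h L)" using vf vh by simp
        fix L' assume L': "valid L'"
        show "lip (act (\<lambda>g. f g + h g) L) L' = lip (act f L @ act h L) L'"
          unfolding lip_append lip_act_left[OF f] lip_act_left[OF h] lip_act_left[OF section_add[OF f h]]
          by (rule section_sum_add[OF fibre_additive_lip_act1[OF L L'] f h])
      qed
      also have "\<dots> \<le> opnorm f * lnorm L + opnorm h * lnorm L"
        using lnorm_append[OF vf vh] lnorm_act_opnorm[OF f L] lnorm_act_opnorm[OF h L] by linarith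
      finally show "lnorm (act (\<lambda>g. f g + h g) L) \<le> (opnorm f + opnorm h) * lnorm L"
        by (simp add: distrib_right)
    qed (simp add: opnorm_nonneg f h)
  qed
qed

text \<open>The compressed sum, between z^* and x, is the inner product of e (x) z with f applied to
  e' (x) x. Since \<psi> is bounded by K at e^* e and at the analogous product for e', these vectors
  have norms at most sqrt K ||z|| and sqrt K ||x||, which yields exactly the constant K.\<close>

lemma norm_section_sum_sandwich_le:
  assumes K: "\<And>g b. b \<in> fibre B g \<Longrightarrow> norm b \<le> 1 \<Longrightarrow> norm (\<psi> g b) \<le> K"
    and f: "f \<in> sections B"
    and e: "e \<in> fibre B 0" "norm e \<le> 1" "fstar B 0 e = e" and e': "e' \<in> fibre B 0" "norm e' \<le> 1"
  shows "norm (section_sum (\<lambda>s c. \<psi> s (lact s e (fmult B s 0 c e'))) f) \<le> K * opnorm f" (is "norm ?T \<le> _")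
proof (rule norm_le_of_sandwich)
  have K0: "0 \<le> K" using order_trans[OF norm_ge_zero K[of 0 0]] by simp
  show "0 \<le> K * opnorm f" using K0 opnorm_nonneg[OF f] by simp
  fix x z :: 'q
  have lnorm_single: "lnorm [(0, a, y)] \<le> sqrt K * norm y" if a: "a \<in> fibre B 0" "norm a \<le> 1" for a and y :: 'q
  proof -
    have "norm (fstar B 0 a \<odot> a) \<le> 1"
      using unit_fibre.norm_st_mul[OF a(1)] a(2) by (simp add: power_le_one)
    then have "norm (kern 0 a 0 a) \<le> K" using a by (simp add: kern_def K)
    then have "norm (adj y * kern 0 a 0 a * y) \<le> K * (norm y)\<^sup>2"
      by (intro order_trans[OF norm_conj_le] mult_right_mono) auto
    then have "sqrt (norm (adj y * kern 0 a 0 a * y)) \<le> sqrt (K * (norm y)\<^sup>2)" by (rule real_sqrt_le_mono)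
    then show ?thesis by (simp add: lnorm_def lip_single real_sqrt_mult)
  qed
  let ?E = "[(0 :: 'g, e, z)]" and ?E' = "[(0 :: 'g, e', x)]"
  have vE: "valid ?E" "valid ?E'" using e e' by simp_all
  \<comment> \<open>The action stands in the conjugate linear first slot, hence the adjoint.\<close>
  have "adj (lip (act f ?E') ?E) = (\<Sum>s | f s \<noteq> 0. adj (lip (act1 s (f s) ?E') ?E))"
    by (simp add: lip_act_left[OF f] section_sum_def)
  also have "\<dots> = (\<Sum>s | f s \<noteq> 0. adj z * \<psi> s (lact s e (fmult B s 0 (f s) e')) * x)"
  proof (rule sum.cong[OF refl])
    fix s
    note fs = sectionsD(1)[OF f, of s]
    have fe': "fmult B s 0 (f s) e' \<in> fibre B s" using fmult_closed[OF fs e'(1)] by simp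
    have "adj (lip (act1 s (f s) ?E') ?E) = lip ?E (act1 s (f s) ?E')"
      by (rule adj_lip[OF valid_act1[OF fs vE(2)] vE(1)])
    also have "\<dots> = adj z * kern 0 e s (fmult B s 0 (f s) e') * x"
      by (simp add: act1_def lip_single)
    also have "kern 0 e s (fmult B s 0 (f s) e') = \<psi> s (lact s e (fmult B s 0 (f s) e'))"
      using e by (simp add: kern_def)
    finally show "adj (lip (act1 s (f s) ?E') ?E) = adj z * \<psi> s (lact s e (fmult B s 0 (f s) e')) * x" .
  qed
  also have "\<dots> = adj z * ?T * x"
    by (simp add: section_sum_def sum_distrib_left sum_distrib_right)
  finally have eq: "adj (lip (act f ?E') ?E) = adj z * ?T * x" .
  have "norm (adj z * ?T * x) = norm (lip (act f ?E') ?E)" unfolding eq[symmetric] by simp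
  also have "\<dots> \<le> lnorm (act f ?E') * lnorm ?E" by (rule lip_Cauchy_Schwarz[OF valid_act[OF f vE(2)] vE(1)])
  also have "\<dots> \<le> (opnorm f * lnorm ?E') * lnorm ?E"
    by (intro mult_right_mono lnorm_act_opnorm f vE) simp
  also have "\<dots> \<le> (opnorm f * (sqrt K * norm x)) * (sqrt K * norm z)"
    by (rule mult_mono[OF mult_left_mono[OF lnorm_single[OF e']] lnorm_single[OF e(1,2)]])
      (use opnorm_nonneg[OF f] K0 in simp_all)
  also have "\<dots> = K * opnorm f * norm x * norm z"
  proof -
    have "(opnorm f * (sqrt K * norm x)) * (sqrt K * norm z) = (sqrt K * sqrt K) * opnorm f * norm x * norm z"
      by (simp only: mult_ac)
    then show ?thesis using K0 by simp
  qed
  finally show "norm (adj z * ?T * x) \<le> K * opnorm f * norm x * norm z" .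
qed

text \<open>Replacing f(s) by e f(s) e' costs at most C \<delta> by the crude bound M, while the
  compressed sum obeys the sharp bound K. The error is arbitrarily small, so M disappears.\<close>

theorem norm_section_sum_le:
  assumes K: "\<And>g b. b \<in> fibre B g \<Longrightarrow> norm b \<le> 1 \<Longrightarrow> norm (\<psi> g b) \<le> K"
    and f: "f \<in> sections B"
  shows "norm (section_sum \<psi> f) \<le> K * universal_norm B f"
proof -
  obtain M where M: "0 \<le> M" "\<And>g b. b \<in> fibre B g \<Longrightarrow> norm (\<psi> g b) \<le> M * norm b"
    using \<psi>_bounded by metis
  have K0: "0 \<le> K" using order_trans[OF norm_ge_zero K[of 0 0]] by simp
  let ?F = "{s. f s \<noteq> 0}"
  have F: "finite ?F" by (rule sectionsD(2)[OF f])
  note fs = sectionsD(1)[OF f]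
  define C where "C = real (card ?F) * (M * 2)"
  have C: "0 \<le> C" using M(1) by (simp add: C_def)
  have "norm (section_sum \<psi> f) \<le> K * opnorm f"
  proof (rule field_le_epsilon)
    fix \<epsilon> :: real assume \<epsilon>: "0 < \<epsilon>"
    define \<delta> where "\<delta> = \<epsilon> / (C + 1)"
    have \<delta>: "0 < \<delta>" "C * \<delta> \<le> \<epsilon>"
      using \<epsilon> C by (simp_all add: \<delta>_def field_simps)
    obtain e where e: "e \<in> fibre B 0" "norm e \<le> 1" "fstar B 0 e = e"
      "\<And>s. s \<in> ?F \<Longrightarrow> norm (f s - lact s e (f s)) < \<delta>"
      using approximate_unit[OF F, of f "\<lambda>s. s" \<delta>] fs \<delta>(1) by metis
    \<comment> \<open>A left approximate unit for the adjoints of the f(s), which have degree - s,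
      acts on the f(s) from the right.\<close>
    obtain e' where e': "e' \<in> fibre B 0" "norm e' \<le> 1" "fstar B 0 e' = e'"
      "\<And>s. s \<in> ?F \<Longrightarrow> norm (fstar B s (f s) - lact (- s) e' (fstar B s (f s))) < \<delta>"
      using approximate_unit[OF F, of "\<lambda>s. fstar B s (f s)" uminus \<delta>] fstar_closed[OF fs] \<delta>(1) by metis
    let ?c = "\<lambda>s. lact s e (fmult B s 0 (f s) e')"
    have close: "norm (f s - ?c s) \<le> 2 * \<delta>" if s: "s \<in> ?F" for s
    proof -
      have fe': "fmult B s 0 (f s) e' \<in> fibre B s" using fmult_closed[OF fs e'(1)] by simp
      have "fstar B s (f s - fmult B s 0 (f s) e') = fstar B s (f s) - lact (- s) e' (fstar B s (f s))"
        using fstar_fmult[OF fs[of s] e'(1)] fstar_linear(3)[OF fs fe'] e'(3) by simp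
      then have "norm (f s - fmult B s 0 (f s) e') < \<delta>"
        using e'(4)[OF s] norm_fstar[of "f s - fmult B s 0 (f s) e'" s] fs fe' by simp
      moreover have "norm (lact s e (f s - fmult B s 0 (f s) e')) \<le> norm (f s - fmult B s 0 (f s) e')"
        using norm_fmult[OF e(1), of "f s - fmult B s 0 (f s) e'" s] fs fe'
          mult_right_mono[OF e(2), of "norm (f s - fmult B s 0 (f s) e')"] by simp
      moreover have eq: "f s - ?c s = (f s - lact s e (f s)) + lact s e (f s - fmult B s 0 (f s) e')"
        using fs fe' e(1) by (simp add: fmult_bilinear)
      ultimately show ?thesis
        unfolding eq
        using e(4)[OF s] norm_triangle_ineq[of "f s - lact s e (f s)" "lact s e (f s - fmult B s 0 (f s) e')"]
        by linarith
    qed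
    have "norm (section_sum \<psi> f - section_sum (\<lambda>s c. \<psi> s (lact s e (fmult B s 0 c e'))) f)
        \<le> (\<Sum>s\<in>?F. M * (2 * \<delta>))"
      unfolding section_sum_def sum_subtractf[symmetric]
    proof (rule sum_norm_le)
      fix s assume s: "s \<in> ?F"
      have c: "?c s \<in> fibre B s" using fmult_closed[OF fs e'(1)] e(1) by simp
      have "norm (\<psi> s (f s) - \<psi> s (?c s)) \<le> M * norm (f s - ?c s)"
        using M(2)[of "f s - ?c s" s] fs c by (simp add: \<psi>_simps)
      also have "\<dots> \<le> M * (2 * \<delta>)" using close[OF s] M(1) by (intro mult_left_mono)
      finally show "norm (\<psi> s (f s) - \<psi> s (?c s)) \<le> M * (2 * \<delta>)" .
    qed
    also have "\<dots> = C * \<delta>" by (simp add: C_def)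
    finally have "norm (section_sum \<psi> f - section_sum (\<lambda>s c. \<psi> s (lact s e (fmult B s 0 c e'))) f) \<le> \<epsilon>"
      using \<delta>(2) by simp
    moreover have "norm (section_sum (\<lambda>s c. \<psi> s (lact s e (fmult B s 0 c e'))) f) \<le> K * opnorm f"
      by (rule norm_section_sum_sandwich_le[OF K f e(1-3) e'(1,2)])
    ultimately show "norm (section_sum \<psi> f) \<le> K * opnorm f + \<epsilon>"
      using norm_triangle_ineq2[of "section_sum \<psi> f" "section_sum (\<lambda>s c. \<psi> s (lact s e (fmult B s 0 c e'))) f"]
      by simp
  qed
  also have "\<dots> \<le> K * universal_norm B f"
    using cstar_seminorm_le_universal[OF cstar_seminorm_opnorm f] K0 by (intro mult_left_mono)
  finally show ?thesis .
qed

end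

section \<open>The extension to the cross-sectional algebras\<close>

lemma bounded_linear_scaleC: "bounded_linear (\<lambda>x :: 'a::complex_normed_vector. c *\<^sub>C x)"
  by (rule bounded_linear_intro[where K = "cmod c"])
    (auto simp: scaleC_add_right scaleR_scaleC scaleC_scaleC norm_scaleC mult.commute)

locale cp_extension = cp_map B \<psi> + B: cross_sectional_algebra B jB
  for B :: "('g::group_add, 'b::complex_normed_vector) bundle_data"
    and jB :: "'g \<Rightarrow> 'b \<Rightarrow> 'p::cstar_algebra"
    and \<psi> :: "'g \<Rightarrow> 'b \<Rightarrow> 'q::cstar_algebra"
begin

lemma fibre_additive_\<psi>: "fibre_additive \<psi>"
  by (simp add: fibre_additive_def \<psi>_simps)

lemma section_sum_minus:
  assumes "fibre_additive T" "f \<in> sections B" "h \<in> sections B"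
    and "\<And>g x. x \<in> fibre B g \<Longrightarrow> T g ((- 1) *\<^sub>C x) = (- 1) *\<^sub>C T g x"
  shows "section_sum T (\<lambda>g. f g + (- 1) *\<^sub>C h g) = section_sum T f - section_sum T h"
  unfolding section_sum_add[OF assms(1,2) section_scaleC[OF assms(3)]]
  using section_sum_scaleC[where T = T and c = "- 1" and d = "- 1", OF assms(3) fibre_additiveD(2)[OF assms(1)] assms(4)]
  by simp

text \<open>Whether sections embed into the algebra is left open; the estimate \<open>diff\<close>
  shows at once that the map on their images is well defined and continuous with bound K.\<close>

lemma extension:
  assumes K: "\<And>g b. b \<in> fibre B g \<Longrightarrow> norm b \<le> 1 \<Longrightarrow> norm (\<psi> g b) \<le> K"
  obtains \<Phi> :: "'p \<Rightarrow> 'q" where "clinear_on UNIV \<Phi>" "\<And>a. norm (\<Phi> a) \<le> K * norm a"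
    "\<And>g b. b \<in> fibre B g \<Longrightarrow> \<Phi> (jB g b) = \<psi> g b"
proof -
  have K0: "0 \<le> K" using order_trans[OF norm_ge_zero K[of 0 0]] by simp
  let ?J = "section_sum jB" and ?P = "section_sum \<psi>"
  have diff: "norm (?P f - ?P h) \<le> K * norm (?J f - ?J h)" if f: "f \<in> sections B" and h: "h \<in> sections B" for f h
  proof -
    have fh: "(\<lambda>g. f g + (- 1) *\<^sub>C h g) \<in> sections B" by (rule section_add[OF f section_scaleC[OF h]])
    have "?P f - ?P h = ?P (\<lambda>g. f g + (- 1) *\<^sub>C h g)"
      by (rule section_sum_minus[OF fibre_additive_\<psi> f h \<psi>_simps(2), symmetric])
    moreover have "?J f - ?J h = ?J (\<lambda>g. f g + (- 1) *\<^sub>C h g)"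
      by (rule section_sum_minus[OF B.fibre_additive_j f h B.j_simps(2), symmetric])
    ultimately show ?thesis
      using norm_section_sum_le[OF K fh] B.norm_section_sum[OF fh] by simp
  qed
  have approx: "\<exists>f. (\<forall>n. f n \<in> sections B) \<and> (\<lambda>n. ?J (f n)) \<longlonglongrightarrow> a" for a
  proof -
    have "a \<in> closure (?J ` sections B)" using B.dense by simp
    then obtain u where u: "\<And>n. u n \<in> ?J ` sections B" "u \<longlonglongrightarrow> a"
      unfolding closure_sequential by blast
    from u(1) have "\<forall>n. \<exists>f. f \<in> sections B \<and> u n = ?J f" by blast
    from choice[OF this] obtain f where f: "\<And>n. f n \<in> sections B" "\<And>n. u n = ?J (f n)" by blast
    from f(2) have "u = (\<lambda>n. ?J (f n))" by (rule ext)
    with f(1) u(2) show ?thesis by auto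
  qed
  have conv: "convergent (\<lambda>n. ?P (f n))" if f: "\<And>n. f n \<in> sections B" and lim: "(\<lambda>n. ?J (f n)) \<longlonglongrightarrow> a" for f a
  proof (rule Cauchy_convergent, rule metric_CauchyI)
    fix e :: real assume e: "0 < e"
    have K1: "0 < K + 1" using K0 by simp
    have "Cauchy (\<lambda>n. ?J (f n))" by (rule LIMSEQ_imp_Cauchy[OF lim])
    moreover have "0 < e / (K + 1)" using e K1 by simp
    ultimately obtain N where N: "\<And>m n. N \<le> m \<Longrightarrow> N \<le> n \<Longrightarrow> dist (?J (f m)) (?J (f n)) < e / (K + 1)"
      using metric_CauchyD by blast
    have "dist (?P (f m)) (?P (f n)) < e" if mn: "N \<le> m" "N \<le> n" for m n
    proof -
      have "dist (?P (f m)) (?P (f n)) \<le> (K + 1) * dist (?J (f m)) (?J (f n))"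
        using diff[OF f f, of m n] by (simp add: dist_norm distrib_right add_increasing2)
      also have "\<dots> < e" using N[OF mn] K1 by (simp add: field_simps)
      finally show ?thesis .
    qed
    then show "\<exists>N. \<forall>m\<ge>N. \<forall>n\<ge>N. dist (?P (f m)) (?P (f n)) < e" by blast
  qed
  define F where "F a = (SOME f. (\<forall>n. f n \<in> sections B) \<and> (\<lambda>n. ?J (f n)) \<longlonglongrightarrow> a)" for a
  have F: "F a n \<in> sections B" "(\<lambda>n. ?J (F a n)) \<longlonglongrightarrow> a" for a n
    using someI_ex[OF approx[of a]] unfolding F_def by blast+
  define \<Phi> where "\<Phi> a = lim (\<lambda>n. ?P (F a n))" for a
  have \<Phi>: "(\<lambda>n. ?P (f n)) \<longlonglongrightarrow> \<Phi> a"
    if f: "\<And>n. f n \<in> sections B" and lim: "(\<lambda>n. ?J (f n)) \<longlonglongrightarrow> a" for f a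
  proof -
    have "(\<lambda>n. ?P (F a n)) \<longlonglongrightarrow> \<Phi> a"
      unfolding \<Phi>_def using conv[OF F(1,2)] by (simp add: convergent_LIMSEQ_iff)
    \<comment> \<open>Any approximating sequence has the limit of the chosen one \<open>F a\<close>,
      so linearity can be checked on sums and multiples of sequences.\<close>
    moreover have "(\<lambda>n. ?P (f n) - ?P (F a n)) \<longlonglongrightarrow> 0"
    proof (rule tendsto_norm_diff_bound)
      show "norm (?P (f n) - ?P (F a n) - 0) \<le> K * norm (?J (f n) - ?J (F a n))" for n
        using diff[OF f F(1)] by simp
      have "(\<lambda>n. ?J (f n) - ?J (F a n)) \<longlonglongrightarrow> a - a" by (intro tendsto_diff lim F(2))
      then show "(\<lambda>n. K * norm (?J (f n) - ?J (F a n))) \<longlonglongrightarrow> 0"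
        by (intro tendsto_mult_right_zero tendsto_norm_zero) simp
    qed
    ultimately have "(\<lambda>n. (?P (f n) - ?P (F a n)) + ?P (F a n)) \<longlonglongrightarrow> 0 + \<Phi> a" by (intro tendsto_add)
    then show ?thesis by simp
  qed
  have sec: "\<Phi> (?J f) = ?P f" if "f \<in> sections B" for f
    using \<Phi>[of "\<lambda>n. f" "?J f"] that LIMSEQ_unique tendsto_const by blast
  have "clinear_on UNIV \<Phi>"
    unfolding clinear_on_def
  proof (intro conjI ballI allI)
    fix a b c
    have "(\<lambda>n. ?P (\<lambda>g. F a n g + F b n g)) \<longlonglongrightarrow> \<Phi> (a + b)"
    proof (rule \<Phi>)
      show "(\<lambda>n. ?J (\<lambda>g. F a n g + F b n g)) \<longlonglongrightarrow> a + b"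
        unfolding section_sum_add[OF B.fibre_additive_j F(1) F(1)] by (intro tendsto_add F(2))
    qed (intro section_add F(1))
    moreover have "(\<lambda>n. ?P (\<lambda>g. F a n g + F b n g)) \<longlonglongrightarrow> \<Phi> a + \<Phi> b"
      unfolding section_sum_add[OF fibre_additive_\<psi> F(1) F(1)] by (intro tendsto_add \<Phi> F)
    ultimately show "\<Phi> (a + b) = \<Phi> a + \<Phi> b" by (rule LIMSEQ_unique)
    have "(\<lambda>n. ?P (\<lambda>g. c *\<^sub>C F a n g)) \<longlonglongrightarrow> \<Phi> (c *\<^sub>C a)"
    proof (rule \<Phi>)
      show "(\<lambda>n. ?J (\<lambda>g. c *\<^sub>C F a n g)) \<longlonglongrightarrow> c *\<^sub>C a"
        using bounded_linear.tendsto[OF bounded_linear_scaleC F(2), of c a]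
        by (subst section_sum_scaleC[where d = c, OF F(1)]) (simp_all add: B.j_simps)
    qed (intro section_scaleC F(1))
    moreover have "(\<lambda>n. ?P (\<lambda>g. c *\<^sub>C F a n g)) \<longlonglongrightarrow> c *\<^sub>C \<Phi> a"
      using bounded_linear.tendsto[OF bounded_linear_scaleC \<Phi>[OF F], of c a]
      by (subst section_sum_scaleC[where d = c, OF F(1)]) (simp_all add: \<psi>_simps)
    ultimately show "\<Phi> (c *\<^sub>C a) = c *\<^sub>C \<Phi> a" by (rule LIMSEQ_unique)
  qed
  moreover have "norm (\<Phi> a) \<le> K * norm a" for a
  proof (rule LIMSEQ_le)
    show "(\<lambda>n. norm (?P (F a n))) \<longlonglongrightarrow> norm (\<Phi> a)" by (intro tendsto_norm \<Phi> F)
    show "(\<lambda>n. K * norm (?J (F a n))) \<longlonglongrightarrow> K * norm a"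
      by (intro tendsto_mult tendsto_const tendsto_norm F)
    show "\<exists>N. \<forall>n\<ge>N. norm (?P (F a n)) \<le> K * norm (?J (F a n))"
      using norm_section_sum_le[OF K F(1)] by (simp add: B.norm_section_sum[OF F(1)])
  qed
  moreover have "\<Phi> (jB g b) = \<psi> g b" if "b \<in> fibre B g" for g b
    using sec[OF delta_section[OF that]] by (simp add: section_sum_delta B.j_simps \<psi>_simps)
  ultimately show thesis using that by blast
qed

text \<open>Represents the elementary tensor of the section f with x. The inner product of two of
  these is x^* \<Phi>(F^* H) y, where F and H are the images of the sections in the algebra.\<close>

definition section_vec :: "('g \<Rightarrow> 'b) \<Rightarrow> 'q \<Rightarrow> ('g \<times> 'b \<times> 'q) list"
  where "section_vec f x = map (\<lambda>s. (s, f s, x)) (support_list f)"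

lemma ev_section_vec:
  assumes f: "f \<in> sections B"
  shows "ev (section_vec f x) T = section_sum (\<lambda>s c. T s c x) f"
  using support_list[OF f]
  by (simp add: ev_def section_vec_def section_sum_def o_def sum_list_distinct_conv_sum_set)

lemma valid_section_vec: "f \<in> sections B \<Longrightarrow> valid (section_vec f x)"
  using sectionsD(1)[of f] by (auto simp: valid_def section_vec_def)

text \<open>The sum of the terms u i^* \<Phi>(a i^* a j) u j with the a i from sections is the inner
  product of a module vector with itself, hence positive; density and continuity of \<Phi> give all
  a i. A matrix N^* N is the sum over k of such Gram matrices of the rows of N.\<close>

lemma completely_positive_extension:
  assumes lin: "clinear_on UNIV \<Phi>" and bound: "\<And>a. norm (\<Phi> a) \<le> K * norm a"
    and ext: "\<And>g b. b \<in> fibre B g \<Longrightarrow> \<Phi> (jB g b) = \<psi> g b"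
  shows "completely_positive \<Phi>"
proof -
  note \<Phi>_sum = clinear_on_sum[OF lin csubspace_UNIV UNIV_I]
  let ?J = "section_sum jB"
  have lip_section_vec: "lip (section_vec f x) (section_vec h y) = adj x * \<Phi> (adj (?J f) * ?J h) * y"
    if f: "f \<in> sections B" and h: "h \<in> sections B" for f h x y
  proof -
    have "adj (?J f) * ?J h = (\<Sum>s | f s \<noteq> 0. \<Sum>r | h r \<noteq> 0. jB (- s + r) (fmult B (- s) r (fstar B s (f s)) (h r)))"
      using sectionsD(1)[OF f] sectionsD(1)[OF h]
      by (simp add: section_sum_def sum_product B.j_star B.j_mult fstar_closed)
    then have "\<Phi> (adj (?J f) * ?J h) = (\<Sum>s | f s \<noteq> 0. \<Sum>r | h r \<noteq> 0. kern s (f s) r (h r))"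
      using sectionsD(1)[OF f] sectionsD(1)[OF h]
      by (simp add: \<Phi>_sum ext kern_inner_closed kern_def)
    then show ?thesis
      unfolding lip_def ev_section_vec[OF f] ev_section_vec[OF h]
      by (simp add: section_sum_def sum_distrib_left sum_distrib_right)
  qed
  have bl: "bounded_linear \<Phi>"
    by (rule bounded_linear_intro[where K = K])
      (simp_all add: clinear_on_add[OF lin] clinear_on_scaleR[OF lin] bound mult.commute)
  have bl_adj: "bounded_linear (adj :: 'x::cstar_algebra \<Rightarrow> 'x)"
    by (rule bounded_linear_intro[where K = 1]) (simp_all add: adj_add)
  have dense: "cstar.positive (\<Sum>i<n. \<Sum>j<n. adj (u i) * \<Phi> (adj (?J (f i)) * ?J (f j)) * u j)"
    if f: "\<And>i. f i \<in> sections B" for n :: nat and f u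
  proof -
    define L where "L n = concat (map (\<lambda>i. section_vec (f i) (u i)) [0..<n])" for n :: nat
    have lip1: "lip (L n) L' = (\<Sum>i<n. lip (section_vec (f i) (u i)) L')" for n L'
      by (induction n) (simp_all add: L_def)
    have lip2: "lip L' (L n) = (\<Sum>i<n. lip L' (section_vec (f i) (u i)))" for n L'
      by (induction n) (simp_all add: L_def)
    have "valid (L n)" for n
      by (induction n) (simp_all add: L_def valid_section_vec f)
    then have "cstar.positive (lip (L n) (L n))" by (rule lip_positive)
    then show ?thesis unfolding lip1 unfolding lip2 by (simp add: lip_section_vec f)
  qed
  have row: "cstar.positive (\<Sum>i<n. \<Sum>j<n. adj (u i) * \<Phi> (adj (a i) * a j) * u j)" for n :: nat and a u
  proof -
    have "\<exists>v. (\<forall>m. v m \<in> ?J ` sections B) \<and> v \<longlonglongrightarrow> a i" for i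
      using B.dense closure_sequential[of "a i" "?J ` sections B"] by auto
    then obtain v where v: "\<And>i m. v i m \<in> ?J ` sections B" "\<And>i. v i \<longlonglongrightarrow> a i" by metis
    have "\<exists>f. f \<in> sections B \<and> v i m = ?J f" for i m using v(1)[of i m] by blast
    then obtain f where f: "\<And>i m. f i m \<in> sections B" "\<And>i m. v i m = ?J (f i m)" by metis
    show ?thesis
    proof (rule cstar.positive_limit)
      show "cstar.positive (\<Sum>i<n. \<Sum>j<n. adj (u i) * \<Phi> (adj (v i m) * v j m) * u j)" for m
        unfolding f(2) by (rule dense[OF f(1)])
      show "(\<lambda>m. \<Sum>i<n. \<Sum>j<n. adj (u i) * \<Phi> (adj (v i m) * v j m) * u j)
          \<longlonglongrightarrow> (\<Sum>i<n. \<Sum>j<n. adj (u i) * \<Phi> (adj (a i) * a j) * u j)"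
        by (intro tendsto_sum tendsto_mult tendsto_const bounded_linear.tendsto[OF bl]
            bounded_linear.tendsto[OF bl_adj] v(2))
    qed
  qed
  show ?thesis
    unfolding completely_positive_def
  proof (intro conjI lin allI impI)
    fix n :: nat and M :: "nat \<Rightarrow> nat \<Rightarrow> 'p"
    assume "positive_matrix n M"
    then obtain N where N: "\<And>i j. i < n \<Longrightarrow> j < n \<Longrightarrow> M i j = (\<Sum>k<n. adj (N k i) * N k j)"
      unfolding positive_matrix_def by blast
    show "positive_matrix n (\<lambda>i j. \<Phi> (M i j))"
    proof (rule positive_matrix_of_form)
      fix u :: "nat \<Rightarrow> 'q"
      have "(\<Sum>i<n. \<Sum>j<n. adj (u i) * \<Phi> (M i j) * u j)
          = (\<Sum>i<n. \<Sum>j<n. \<Sum>k<n. adj (u i) * \<Phi> (adj (N k i) * N k j) * u j)"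
        by (intro sum.cong refl) (simp add: N \<Phi>_sum sum_distrib_left sum_distrib_right)
      also have "\<dots> = (\<Sum>i<n. \<Sum>k<n. \<Sum>j<n. adj (u i) * \<Phi> (adj (N k i) * N k j) * u j)"
        by (intro sum.cong refl sum.swap)
      also have "\<dots> = (\<Sum>k<n. \<Sum>i<n. \<Sum>j<n. adj (u i) * \<Phi> (adj (N k i) * N k j) * u j)"
        by (rule sum.swap)
      finally show "cstar.positive (\<Sum>i<n. \<Sum>j<n. adj (u i) * \<Phi> (M i j) * u j)"
        by (simp only: cstar.positive_sum row)
    qed
  qed
qed

end

section \<open>Lifting through a faithful representation\<close>

locale cp_lifting = B: fell_bundle B + C: faithful_fell_representation C \<pi> + jC: cross_sectional_algebra C jC
  for B :: "('g::group_add, 'b::complex_normed_vector) bundle_data"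
    and C :: "('g, 'c::complex_normed_vector) bundle_data"
    and jC :: "'g \<Rightarrow> 'c \<Rightarrow> 'q::cstar_algebra"
    and \<pi> :: "'g \<Rightarrow> 'c \<Rightarrow> ('h::complex_hilbert \<Rightarrow>\<^sub>L 'h)" +
  fixes \<phi> :: "'g \<Rightarrow> 'b \<Rightarrow> ('h \<Rightarrow>\<^sub>L 'h)"
  assumes \<phi>_cp: "completely_positive_on_bundle B \<phi>"
    and \<phi>_image: "\<phi> g ` fibre B g \<subseteq> \<pi> g ` fibre C g"
begin

lemma \<phi>_linear: "clinear_on (fibre B g) (\<phi> g)"
  using \<phi>_cp by (simp add: completely_positive_on_bundle_def)

definition lift :: "'g \<Rightarrow> 'b \<Rightarrow> 'c"
  where "lift g b = inv_into (fibre C g) (\<pi> g) (\<phi> g b)"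

lemma lift:
  assumes "b \<in> fibre B g"
  shows lift_in: "lift g b \<in> fibre C g" and rep_lift: "\<pi> g (lift g b) = \<phi> g b"
proof -
  have "\<phi> g b \<in> \<pi> g ` fibre C g" using \<phi>_image assms by blast
  then show "lift g b \<in> fibre C g" "\<pi> g (lift g b) = \<phi> g b"
    unfolding lift_def by (rule inv_into_into, rule f_inv_into_f)
qed

lemma lift_eqI: "b \<in> fibre B g \<Longrightarrow> c \<in> fibre C g \<Longrightarrow> \<pi> g c = \<phi> g b \<Longrightarrow> lift g b = c"
  using inj_onD[OF C.inj_on_rep] lift[of b g] by metis

definition lifted :: "'g \<Rightarrow> 'b \<Rightarrow> 'q"
  where "lifted g b = jC g (lift g b)"

text \<open>Both \<pi> and \<open>jC\<close> are isometric on the fibres of C. The equality of the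
  norms of \<phi> and of its extension rests on this.\<close>

lemma norm_lifted: "b \<in> fibre B g \<Longrightarrow> norm (lifted g b) = norm (\<phi> g b)"
  using C.norm_rep[OF lift_in, of b g] rep_lift[of b g] jC.norm_j_le[OF lift_in, of b g]
    jC.norm_j_eq[OF lift_in, of b g] C.norm_le_universal_norm_delta[OF lift_in, of b g]
  by (simp add: lifted_def)

lemma lifted_linear: "clinear_on (fibre B g) (lifted g)"
  unfolding clinear_on_def
proof (intro conjI ballI allI)
  fix x c assume x: "x \<in> fibre B g"
  have "lift g (c *\<^sub>C x) = c *\<^sub>C lift g x"
    using x by (intro lift_eqI) (simp_all add: lift C.rep_simps clinear_on_scaleC[OF \<phi>_linear]
        csubspace_scaleC[OF B.fibre_csubspace] csubspace_scaleC[OF C.fibre_csubspace])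
  then show "lifted g (c *\<^sub>C x) = c *\<^sub>C lifted g x"
    using lift_in[OF x] by (simp add: lifted_def jC.j_simps)
  fix y assume y: "y \<in> fibre B g"
  have "lift g (x + y) = lift g x + lift g y"
    using x y by (intro lift_eqI) (simp_all add: lift C.rep_simps clinear_on_add[OF \<phi>_linear]
        csubspace_add[OF B.fibre_csubspace] csubspace_add[OF C.fibre_csubspace])
  then show "lifted g (x + y) = lifted g x + lifted g y"
    using lift_in[OF x] lift_in[OF y] by (simp add: lifted_def jC.j_simps)
qed

text \<open>A row \<open>(b\<^sub>0, \<dots>, b\<^sub>n\<^sub>-\<^sub>1)\<close> with \<open>b\<^sub>i \<in> B\<close> in degree \<open>d i\<close> is a row of a matrix of
  \<open>bundle_matrices\<close> only if that row has degree \<open>0\<close>; hence the extra index \<open>n\<close>.\<close>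

lemma gram_positive_operator_matrix:
  assumes b: "\<And>i. i < n \<Longrightarrow> b i \<in> fibre B (d i)"
  shows "positive_operator_matrix n (\<lambda>i j. \<phi> (- d i + d j) (fmult B (- d i) (d j) (fstar B (d i) (b i)) (b j)))"
proof -
  \<comment> \<open>With degree 0 at index n, row n of N has entries of degrees d j; the other rows
    vanish, so N^* N has the entries b i^* b j.\<close>
  define t where "t i = (if i < n then d i else 0)" for i
  define N where "N k j = (if k = n \<and> j < n then b j else 0)" for k j
  define M where "M = bundle_matrix_mult B (Suc n) t (bundle_matrix_star B t N) N"
  have N: "N \<in> bundle_matrices B (Suc n) t"
    using b by (simp add: bundle_matrices_def N_def t_def)
  have M: "M i j = fmult B (- d i) (d j) (fstar B (d i) (b i)) (b j)" if ij: "i < n" "j < n" for i j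
  proof -
    have "fmult B (- t i + t k) (- t k + t j) (fstar B (- t k + t i) (N k i)) (N k j) = 0" if "k < n" for k
      using that by (simp add: N_def)
    then have "M i j = fmult B (- t i + t n) (- t n + t j) (fstar B (- t n + t i) (N n i)) (N n j)"
      by (simp add: M_def bundle_matrix_mult_def bundle_matrix_star_def)
    then show ?thesis using ij by (simp add: N_def t_def)
  qed
  have "positive_bundle_matrix B (Suc n) t M"
    unfolding positive_bundle_matrix_def M_def using N by blast
  then have pos: "positive_operator_matrix (Suc n) (\<lambda>i j. \<phi> (- t i + t j) (M i j))"
    using \<phi>_cp unfolding completely_positive_on_bundle_def by simp
  show ?thesis
    unfolding positive_operator_matrix_def
  proof
    fix \<xi> :: "nat \<Rightarrow> 'h"
    \<comment> \<open>The zero in coordinate n drops row and column n of M.\<close>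
    define \<eta> where "\<eta> i = (if i < n then \<xi> i else 0)" for i
    have "(\<Sum>i<Suc n. cinner (\<Sum>j<Suc n. \<phi> (- t i + t j) (M i j) (\<eta> j)) (\<eta> i)) \<in> \<real>\<^sub>\<ge>\<^sub>0"
      using pos unfolding positive_operator_matrix_def by blast
    also have "(\<Sum>i<Suc n. cinner (\<Sum>j<Suc n. \<phi> (- t i + t j) (M i j) (\<eta> j)) (\<eta> i))
        = (\<Sum>i<n. cinner (\<Sum>j<n. \<phi> (- d i + d j) (fmult B (- d i) (d j) (fstar B (d i) (b i)) (b j)) (\<xi> j)) (\<xi> i))"
      by (simp add: \<eta>_def M t_def blinfun.zero_right)
    finally show "(\<Sum>i<n. cinner (\<Sum>j<n. \<phi> (- d i + d j) (fmult B (- d i) (d j) (fstar B (d i) (b i)) (b j)) (\<xi> j)) (\<xi> i)) \<in> \<real>\<^sub>\<ge>\<^sub>0" .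
  qed
qed

text \<open>The root is needed over C and not merely among operators on H, because \<open>jC\<close>
  is defined on the fibres of C: being multiplicative and *-preserving, it carries Q = \<rho>^*
  \<rho> to N^* N.\<close>

lemma lifted_positive:
  assumes b: "\<And>i. i < n \<Longrightarrow> b i \<in> fibre B (d i)"
  shows "positive_matrix n (\<lambda>i j. lifted (- d i + d j) (fmult B (- d i) (d j) (fstar B (d i) (b i)) (b j)))"
proof -
  define P where "P i j = fmult B (- d i) (d j) (fstar B (d i) (b i)) (b j)" for i j
  define Q where "Q i j = lift (- d i + d j) (P i j)" for i j
  have P: "P i j \<in> fibre B (- d i + d j)" if "i < n" "j < n" for i j
    unfolding P_def using b that by (intro B.fmult_closed B.fstar_closed)
  have "Q \<in> bundle_matrices C n d" using lift_in[OF P] by (simp add: bundle_matrices_def Q_def)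
  moreover have "positive_operator_matrix n (\<lambda>i j. \<pi> (- d i + d j) (Q i j))"
    using gram_positive_operator_matrix[OF b] rep_lift[OF P]
    by (simp add: positive_operator_matrix_def Q_def P_def)
  ultimately have "positive_bundle_matrix C n d Q" by (rule C.positive_bundle_matrix_of_rep)
  then obtain \<rho> where \<rho>: "\<rho> \<in> bundle_matrices C n d"
    and Q: "\<And>i j. i < n \<Longrightarrow> j < n \<Longrightarrow> Q i j = bundle_matrix_mult C n d (bundle_matrix_star C d \<rho>) \<rho> i j"
    unfolding positive_bundle_matrix_def by blast
  have \<rho>_in: "\<rho> i j \<in> fibre C (- d i + d j)" if "i < n" "j < n" for i j
    using \<rho> that by (simp add: bundle_matrices_def)
  define N where "N k i = jC (- d k + d i) (\<rho> k i)" for k i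
  show ?thesis
    unfolding positive_matrix_def
  proof (intro exI[of _ N] allI impI)
    fix i j assume ij: "i < n" "j < n"
    have deg: "- (- d k + d i) = - d i + d k" for k by (simp add: minus_add)
    have deg2: "- d i + d k + (- d k + d j) = - d i + d j" for k by (simp add: add.assoc)
    have st: "fstar C (- d k + d i) (\<rho> k i) \<in> fibre C (- d i + d k)" if "k < n" for k
      using C.fstar_closed[OF \<rho>_in[OF that ij(1)]] by (simp only: deg)
    have summand: "fmult C (- d i + d k) (- d k + d j) (fstar C (- d k + d i) (\<rho> k i)) (\<rho> k j) \<in> fibre C (- d i + d j)"
      if "k < n" for k
      using C.fmult_closed[OF st[OF that] \<rho>_in[OF that ij(2)]] by (simp only: deg2)
    have "lifted (- d i + d j) (P i j) = jC (- d i + d j) (Q i j)" by (simp add: lifted_def Q_def)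
    also have "\<dots> = (\<Sum>k<n. jC (- d i + d j)
        (fmult C (- d i + d k) (- d k + d j) (fstar C (- d k + d i) (\<rho> k i)) (\<rho> k j)))"
      unfolding Q[OF ij] bundle_matrix_mult_def bundle_matrix_star_def
      using summand by (intro clinear_on_sum[OF jC.j_linear C.fibre_csubspace]) simp
    also have "\<dots> = (\<Sum>k<n. adj (N k i) * N k j)"
    proof (rule sum.cong[OF refl])
      fix k assume "k \<in> {..<n}"
      then have k: "k < n" by simp
      show "jC (- d i + d j) (fmult C (- d i + d k) (- d k + d j) (fstar C (- d k + d i) (\<rho> k i)) (\<rho> k j))
          = adj (N k i) * N k j"
        unfolding N_def jC.j_star[OF \<rho>_in[OF k ij(1)]] deg jC.j_mult[OF st[OF k] \<rho>_in[OF k ij(2)]] deg2 ..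
    qed
    finally show "lifted (- d i + d j) (fmult B (- d i) (d j) (fstar B (d i) (b i)) (b j))
        = (\<Sum>k<n. adj (N k i) * N k j)" by (simp only: P_def)
  qed
qed

end

theorem propositionA9:
  fixes B :: "('g::group_add, 'b::complex_normed_vector) bundle_data"
    and C :: "('g, 'c::complex_normed_vector) bundle_data"
    and jB :: "'g \<Rightarrow> 'b \<Rightarrow> 'p::cstar_algebra"
    and jC :: "'g \<Rightarrow> 'c \<Rightarrow> 'q::cstar_algebra"
    and \<pi> :: "'g \<Rightarrow> 'c \<Rightarrow> ('h::complex_hilbert \<Rightarrow>\<^sub>L 'h)"
    and \<phi> :: "'g \<Rightarrow> 'b \<Rightarrow> ('h \<Rightarrow>\<^sub>L 'h)"
  assumes "fell_bundle B" and "fell_bundle C"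
    and "full_cross_sectional_algebra B jB"
    and "full_cross_sectional_algebra C jC"
    and "faithful_representation C \<pi>"
    and "completely_positive_on_bundle B \<phi>"
    and "\<And>g. \<phi> g ` fibre B g \<subseteq> \<pi> g ` fibre C g"
  shows "\<exists>\<phi>' :: 'p \<Rightarrow> 'q.
    completely_positive \<phi>' \<and>
    map_norm \<phi>' = bundle_map_norm B \<phi> \<and>
    (\<forall>g. \<forall>b\<in>fibre B g. \<exists>c\<in>fibre C g. \<phi>' (jB g b) = jC g c \<and> \<pi> g c = \<phi> g b)"
proof -
  interpret C: faithful_fell_representation C \<pi>
    using assms(2,5)
    by (simp add: faithful_fell_representation_def fell_representation_def fell_representation_axioms_def
        faithful_fell_representation_axioms_def faithful_representation_def)
  interpret L: cp_lifting B C jC \<pi> \<phi>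
    using assms C.faithful_fell_representation_axioms
    by (simp add: cp_lifting_def cp_lifting_axioms_def cross_sectional_algebra_def cross_sectional_algebra_axioms_def)
  interpret E: cp_extension B jB L.lifted
    using assms(1,3) L.lifted_linear L.lifted_positive
    by (simp add: cp_extension_def cross_sectional_algebra_def cross_sectional_algebra_axioms_def
        cp_map_def cp_map_axioms_def)
  let ?S = "{norm (\<phi> g b) |g b. b \<in> fibre B g \<and> norm b \<le> 1}"
  define K where "K = bundle_map_norm B \<phi>"
  \<comment> \<open>\<open>bundle_map_norm\<close> is a real supremum, so its set must be bounded
    before values can be compared with it; \<phi> inherits the bound from the lifted map.\<close>
  obtain M where M: "0 \<le> M" "\<And>g b. b \<in> fibre B g \<Longrightarrow> norm (L.lifted g b) \<le> M * norm b"
    using E.\<psi>_bounded by metis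
  have "norm (\<phi> g b) \<le> M" if b: "b \<in> fibre B g" "norm b \<le> 1" for g b
    using M(2)[OF b(1)] mult_left_mono[OF b(2) M(1)] L.norm_lifted[OF b(1)] by simp
  then have "bdd_above ?S" by (intro bdd_aboveI[of _ M]) blast
  then have K: "norm (\<phi> g b) \<le> K" if "b \<in> fibre B g" "norm b \<le> 1" for g b
    unfolding K_def bundle_map_norm_def using that by (intro cSup_upper) auto
  then have K': "norm (L.lifted g b) \<le> K" if "b \<in> fibre B g" "norm b \<le> 1" for g b
    using that L.norm_lifted by simp
  obtain \<Phi> where \<Phi>: "clinear_on UNIV \<Phi>" "\<And>a. norm (\<Phi> a) \<le> K * norm a"
    "\<And>g b. b \<in> fibre B g \<Longrightarrow> \<Phi> (jB g b) = L.lifted g b"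
    using E.extension[OF K'] by metis
  have K0: "0 \<le> K" using order_trans[OF norm_ge_zero K[of 0 0]] by simp
  have le: "norm (\<Phi> a) \<le> K" if "norm a \<le> 1" for a
    using \<Phi>(2)[of a] mult_left_mono[OF that K0] by simp
  have "map_norm \<Phi> = K"
  proof (rule antisym)
    show "map_norm \<Phi> \<le> K"
      unfolding map_norm_def using le by (intro cSup_least) (auto intro: exI[of _ 0])
    \<comment> \<open>\<open>jB\<close> is contractive on fibres, so each b of norm at most 1 gives
      an element of the unit ball of the algebra at which \<Phi> has the norm of
      \<open>\<phi> g b\<close>.\<close>
    have "norm (\<phi> g b) \<le> map_norm \<Phi>" if b: "b \<in> fibre B g" "norm b \<le> 1" for g b
      unfolding map_norm_def
    proof (rule cSup_upper)
      show "norm (\<phi> g b) \<in> {norm (\<Phi> a) |a. norm a \<le> 1}"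
        using \<Phi>(3)[OF b(1)] L.norm_lifted[OF b(1)] order_trans[OF E.B.norm_j_le[OF b(1)] b(2)] by force
      show "bdd_above {norm (\<Phi> a) |a. norm a \<le> 1}"
        using le by (intro bdd_aboveI[of _ K]) blast
    qed
    then show "K \<le> map_norm \<Phi>"
      unfolding K_def bundle_map_norm_def
      by (intro cSup_least) (auto intro!: exI[of _ 0])
  qed
  moreover have "completely_positive \<Phi>" by (rule E.completely_positive_extension[OF \<Phi>])
  moreover have "\<exists>c\<in>fibre C g. \<Phi> (jB g b) = jC g c \<and> \<pi> g c = \<phi> g b" if "b \<in> fibre B g" for g b
    using L.lift[OF that] \<Phi>(3)[OF that] by (auto simp: L.lifted_def)
  ultimately show ?thesis unfolding K_def by blast
qed

end
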